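(* There is a fixed-parameter tractable (FPT) algorithm for the (decoupled) \textsc{Spanner} problem parameterized by the total removed weight $\overline{W}$ and the tightness $\tau$ of the instance. Precisely: given a connected undirected graph $G=(V,E)$ with $n=|V|$, $m=|E|$, edge weights $w\colon E\to\mathbb{N}_{\ge 0}$, edge lengths $\ell\colon E\to\mathbb{N}_{\ge 1}$, a stretch factor $\alpha\ge 1$ and a number $\overline{W}\in\mathbb{N}$, the algorithm decides whether $G$ has an $\alpha$-spanner $H=(V,F)$ with $w(E\setminus F)\ge \overline{W}$ in time $$\mathcal{T}\in\mathcal{O}\big(\overline{W}^{\,2\overline{W}+1}\,\tau^{2\overline{W}}\cdot \mathrm{SPSP}(n,m)+\mathrm{APSP}_2(n,m)\big),$$ where $\tau$ is the tightness of the instance, and it identifies a witness (i.e., such a spanner $H$), if one exists, in $\mathcal{O}(\mathcal{T}+n^2m^2)$ time.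
   Context: For a subgraph $G'\subseteq G$ and $u,v\in V$, $\ell_{G'}[u,v]$ is the length of a shortest $u$-$v$-path in $G'$ w.r.t. $\ell$. A subgraph $H=(V,F)$, $F\subseteq E$, is an $\alpha$-spanner of $G$ if $\ell_H[u,v]\le\alpha\,\ell_G[u,v]$ for all $u,v\in V$; equivalently, for all $\{u,v\}\in E$. The set of terminal pairs is $K=E$. For a set $X$ of edges, $w(X)=\sum_{e\in X}w(e)$. "Decoupled" means that $w$ and $\ell$ are independent and arbitrary. For $\{u,v\}\in E$, a simple $u$-$v$-path $P$ is settling if $\ell(P)\le\alpha\,\ell_G[u,v]$; it is alternative if it does not contain the edge $\{u,v\}$. $\mathcal{P}_{uv}$ is the set of all settling $u$-$v$-paths. As a preprocessing convention, edges that do not settle themselves (i.e., $\ell(\{u,v\})>\alpha\,\ell_G[u,v]$) are assumed to have been removed from the instance. An edge $\{u,v\}$ is mandatory if $\mathcal{P}_{uv}$ contains no alternative path. The trivial edges $T\subseteq E$ are the mandatory edges and the edges of weight $0$; the nontrivial edges are $N=E\setminus T$. A terminal pair $\{u,v\}\in E$ is critical if no settling $u$-$v$-path consists only of trivial edges; $C$ denotes the set of critical terminal pairs ($C\subseteq N$). For $\{u,v\}\in C$, the tightest alternative path $A_{uv}\in\mathcal{P}_{uv}$ is an alternative settling path with the minimum number of nontrivial edges, and $A^N_{uv}=A_{uv}\cap N$ is its set of nontrivial edges. The tightness of the instance is $\tau=\max\{|A^N_{uv}| : \{u,v\}\in C\}$. $\mathrm{SPSP}(n,m)$ and $\mathrm{APSP}_2(n,m)$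 denote the running time of suitable algorithms for the single-pair shortest path problem and for the all-pairs-2-shortest-paths problem (two shortest paths for each node pair), respectively, on a graph with $n$ nodes and $m$ edges; $\mathrm{APSP}_2(n,m)\in\mathcal{O}(nm+n^2\log n)$. An algorithm is FPT w.r.t. a (possibly combined) parameter $k$ if on instance $I$ it runs in $\mathcal{O}(f(k)\cdot p(\langle I\rangle))$ time for a computable function $f$ and a polynomial $p$ in the encoding length $\langle I\rangle$. *)

theory Defs
  imports
    "HOL-Library.Extended_Real"
    "HOL-Library.Log_Nat"
    "HOL-Computational_Algebra.Polynomial"
begin

section \<open>Spanners and tightness\<close>

text \<open>
  Undirected simple graphs are given by a vertex set \<open>V\<close> and a set \<open>E\<close> of two-element subsets
  of \<open>V\<close>; a simple path is its list of (distinct) vertices.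
\<close>

definition simple_graph :: "'a set \<Rightarrow> 'a set set \<Rightarrow> bool" where
  "simple_graph V E \<longleftrightarrow> finite V \<and> (\<forall>e\<in>E. \<exists>u\<in>V. \<exists>v\<in>V. u \<noteq> v \<and> e = {u, v})"

definition edges_of :: "'a list \<Rightarrow> 'a set set" where
  "edges_of P = {{P ! i, P ! Suc i} | i. Suc i < length P}"

definition paths :: "'a set set \<Rightarrow> 'a \<Rightarrow> 'a \<Rightarrow> 'a list set" where
  "paths E u v = {P. P \<noteq> [] \<and> hd P = u \<and> last P = v \<and> distinct P \<and> edges_of P \<subseteq> E}"

definition connected_graph :: "'a set \<Rightarrow> 'a set set \<Rightarrow> bool" where
  "connected_graph V E \<longleftrightarrow> V \<noteq> {} \<and> (\<forall>u\<in>V. \<forall>v\<in>V. paths E u v \<noteq> {})"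

definition path_len :: "('a set \<Rightarrow> nat) \<Rightarrow> 'a list \<Rightarrow> nat" where
  "path_len l P = sum l (edges_of P)"

text \<open>The distance is \<open>\<infinity>\<close> if there is no path (the infimum of the empty set).\<close>

definition sp_dist :: "'a set set \<Rightarrow> ('a set \<Rightarrow> nat) \<Rightarrow> 'a \<Rightarrow> 'a \<Rightarrow> ereal" where
  "sp_dist E l u v = (INF P\<in>paths E u v. ereal (real (path_len l P)))"

definition is_spanner ::
    "'a set \<Rightarrow> 'a set set \<Rightarrow> ('a set \<Rightarrow> nat) \<Rightarrow> real \<Rightarrow> 'a set set \<Rightarrow> bool" where
  "is_spanner V E l \<alpha> F \<longleftrightarrow>
     F \<subseteq> E \<and> (\<forall>u\<in>V. \<forall>v\<in>V. sp_dist F l u v \<le> ereal \<alpha> * sp_dist E l u v)"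

definition settling_paths ::
    "'a set set \<Rightarrow> ('a set \<Rightarrow> nat) \<Rightarrow> real \<Rightarrow> 'a \<Rightarrow> 'a \<Rightarrow> 'a list set" where
  "settling_paths E l \<alpha> u v =
     {P \<in> paths E u v. ereal (real (path_len l P)) \<le> ereal \<alpha> * sp_dist E l u v}"

definition alternative_paths ::
    "'a set set \<Rightarrow> ('a set \<Rightarrow> nat) \<Rightarrow> real \<Rightarrow> 'a \<Rightarrow> 'a \<Rightarrow> 'a list set" where
  "alternative_paths E l \<alpha> u v = {P \<in> settling_paths E l \<alpha> u v. {u, v} \<notin> edges_of P}"

definition self_settling :: "'a set set \<Rightarrow> ('a set \<Rightarrow> nat) \<Rightarrow> real \<Rightarrow> 'a set set" where
  "self_settling E l \<alpha> =
     {{u, v} | u v. {u, v} \<in> E \<and> ereal (real (l {u, v})) \<le> ereal \<alpha> * sp_dist E l u v}"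

definition mandatory :: "'a set set \<Rightarrow> ('a set \<Rightarrow> nat) \<Rightarrow> real \<Rightarrow> 'a set set" where
  "mandatory E l \<alpha> = {{u, v} | u v. {u, v} \<in> E \<and> alternative_paths E l \<alpha> u v = {}}"

definition trivial_edges ::
    "'a set set \<Rightarrow> ('a set \<Rightarrow> nat) \<Rightarrow> ('a set \<Rightarrow> nat) \<Rightarrow> real \<Rightarrow> 'a set set" where
  "trivial_edges E w l \<alpha> = mandatory E l \<alpha> \<union> {e \<in> E. w e = 0}"

definition nontrivial_edges ::
    "'a set set \<Rightarrow> ('a set \<Rightarrow> nat) \<Rightarrow> ('a set \<Rightarrow> nat) \<Rightarrow> real \<Rightarrow> 'a set set" where
  "nontrivial_edges E w l \<alpha> = E - trivial_edges E w l \<alpha>"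

definition critical ::
    "'a set set \<Rightarrow> ('a set \<Rightarrow> nat) \<Rightarrow> ('a set \<Rightarrow> nat) \<Rightarrow> real \<Rightarrow> 'a set set" where
  "critical E w l \<alpha> =
     {{u, v} | u v. {u, v} \<in> E \<and>
        \<not> (\<exists>P\<in>settling_paths E l \<alpha> u v. edges_of P \<subseteq> trivial_edges E w l \<alpha>)}"

definition tightest_alternative ::
    "'a set set \<Rightarrow> ('a set \<Rightarrow> nat) \<Rightarrow> ('a set \<Rightarrow> nat) \<Rightarrow> real \<Rightarrow> 'a \<Rightarrow> 'a \<Rightarrow> 'a list \<Rightarrow> bool" where
  "tightest_alternative E w l \<alpha> u v A \<longleftrightarrow>
     A \<in> alternative_paths E l \<alpha> u v \<and>
     (\<forall>P\<in>alternative_paths E l \<alpha> u v.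
        card (edges_of A \<inter> nontrivial_edges E w l \<alpha>)
          \<le> card (edges_of P \<inter> nontrivial_edges E w l \<alpha>))"

text \<open>The tightness is 0 if there is no critical pair.\<close>

definition tightness ::
    "'a set set \<Rightarrow> ('a set \<Rightarrow> nat) \<Rightarrow> ('a set \<Rightarrow> nat) \<Rightarrow> real \<Rightarrow> nat" where
  "tightness E w l \<alpha> =
     Max (insert 0 {card (edges_of A \<inter> nontrivial_edges E w l \<alpha>) | u v A.
            {u, v} \<in> critical E w l \<alpha> \<and> tightest_alternative E w l \<alpha> u v A})"


section \<open>Word RAM programs\<close>

text \<open>
  Algorithms are programs for a structured random access machine. The memory consists of
  arrays named by natural numbers; a program mentions finitely many of them by constant name, so
  that this is the usual RAM memory up to interleaving.

  Every step has unit cost, including multiplication and division, but all values occurring in a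
  run, also intermediate ones and addresses, must be below a given bound \<open>B\<close>, i.e. fit into words
  of \<open>log B\<close> bits. A program that exceeds the bound has no run.
\<close>

datatype binop = Plus | Minus | Times | Div | Less

fun apply_op :: "binop \<Rightarrow> nat \<Rightarrow> nat \<Rightarrow> nat" where
  "apply_op Plus x y = x + y"
| "apply_op Minus x y = x - y"
| "apply_op Times x y = x * y"
| "apply_op Div x y = x div y"
| "apply_op Less x y = (if x < y then 1 else 0)"

datatype expr = Const nat | Read nat expr | Op binop expr expr

type_synonym memory = "nat \<Rightarrow> nat \<Rightarrow> nat"

fun val :: "memory \<Rightarrow> expr \<Rightarrow> nat" where
  "val s (Const k) = k"
| "val s (Read a e) = s a (val s e)"
| "val s (Op f e1 e2) = apply_op f (val s e1) (val s e2)"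

fun fits :: "nat \<Rightarrow> memory \<Rightarrow> expr \<Rightarrow> bool" where
  "fits B s (Const k) \<longleftrightarrow> k < B"
| "fits B s (Read a e) \<longleftrightarrow> fits B s e \<and> s a (val s e) < B"
| "fits B s (Op f e1 e2) \<longleftrightarrow> fits B s e1 \<and> fits B s e2 \<and> val s (Op f e1 e2) < B"

fun cost :: "expr \<Rightarrow> nat" where
  "cost (Const k) = 1"
| "cost (Read a e) = 1 + cost e"
| "cost (Op f e1 e2) = 1 + cost e1 + cost e2"

text \<open>
  \<open>Call p a k b j\<close> runs \<open>p\<close> in a fresh memory whose input consists of the first \<open>k\<close> cells of array
  \<open>a\<close>, and copies the first \<open>j\<close> output cells back into array \<open>b\<close>. The cost comprises the running
  time of \<open>p\<close> and one step for each cell copied. Programs are finite terms, so there is no recursion.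
\<close>

datatype com =
    Skip
  | Assign nat expr expr
  | Seq com com
  | Cond expr com com
  | While expr com
  | Call com nat expr nat expr

text \<open>Input is placed in array 0, and output is taken from array 1.\<close>

definition load :: "nat list \<Rightarrow> memory" where
  "load xs = (\<lambda>a i. if a = 0 \<and> i < length xs then xs ! i else 0)"

text \<open>\<open>exec B c s t s'\<close>: with word bound \<open>B\<close>, \<open>c\<close> started in \<open>s\<close> halts in \<open>s'\<close> after \<open>t\<close> steps.\<close>

inductive exec :: "nat \<Rightarrow> com \<Rightarrow> memory \<Rightarrow> nat \<Rightarrow> memory \<Rightarrow> bool" for B :: nat where
  Skip: "exec B Skip s 1 s"
| Assign: "fits B s i \<Longrightarrow> fits B s e \<Longrightarrow>
    exec B (Assign a i e) s (1 + cost i + cost e) (s(a := (s a)(val s i := val s e)))"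
| Seq: "exec B c1 s t1 s' \<Longrightarrow> exec B c2 s' t2 s'' \<Longrightarrow> exec B (Seq c1 c2) s (t1 + t2) s''"
| CondTrue: "fits B s e \<Longrightarrow> val s e \<noteq> 0 \<Longrightarrow> exec B c1 s t s' \<Longrightarrow>
    exec B (Cond e c1 c2) s (1 + cost e + t) s'"
| CondFalse: "fits B s e \<Longrightarrow> val s e = 0 \<Longrightarrow> exec B c2 s t s' \<Longrightarrow>
    exec B (Cond e c1 c2) s (1 + cost e + t) s'"
| WhileFalse: "fits B s e \<Longrightarrow> val s e = 0 \<Longrightarrow> exec B (While e c) s (1 + cost e) s"
| WhileTrue: "fits B s e \<Longrightarrow> val s e \<noteq> 0 \<Longrightarrow> exec B c s t1 s' \<Longrightarrow> exec B (While e c) s' t2 s'' \<Longrightarrow>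
    exec B (While e c) s (1 + cost e + t1 + t2) s''"
| Call: "fits B s k \<Longrightarrow> fits B s j \<Longrightarrow> exec B p (load (map (s a) [0..<val s k])) t s' \<Longrightarrow>
    exec B (Call p a k b j) s (1 + cost k + cost j + val s k + val s j + t)
      (s(b := (\<lambda>i. if i < val s j then s' 1 i else s b i)))"

definition magnitude :: "nat list \<Rightarrow> nat" where
  "magnitude xs = 2 + length xs + sum_list xs"

text \<open>
  \<open>solves p X enc bound ok\<close>: on every input \<open>x \<in> X\<close>, encoded as the list \<open>enc x\<close>, program \<open>p\<close>
  produces an output accepted by \<open>ok\<close> in time \<open>O(bound x)\<close>. As usual, words have
  \<open>O(log (magnitude (enc x)))\<close> bits, and reading the input counts towards the running time.
\<close>

definition solves ::
    "com \<Rightarrow> 'i set \<Rightarrow> ('i \<Rightarrow> nat list) \<Rightarrow> ('i \<Rightarrow> nat) \<Rightarrow> ('i \<Rightarrow> (nat \<Rightarrow> nat) \<Rightarrow> bool) \<Rightarrow> bool" where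
  "solves p X enc bound ok \<longleftrightarrow>
     (\<exists>K c. \<forall>x\<in>X. \<exists>t s. exec (magnitude (enc x) ^ c) p (load (enc x)) t s \<and>
        length (enc x) + t \<le> K * bound x \<and> ok x (s 1))"

definition decides_answer :: "('i \<Rightarrow> bool) \<Rightarrow> 'i \<Rightarrow> (nat \<Rightarrow> nat) \<Rightarrow> bool" where
  "decides_answer Q x out \<longleftrightarrow> out 0 = (if Q x then 1 else 0)"

definition polynomially_bounded :: "(nat \<Rightarrow> nat \<Rightarrow> nat) \<Rightarrow> bool" where
  "polynomially_bounded T \<longleftrightarrow> (\<exists>K k. \<forall>n m. T n m \<le> K * (n + m + 1) ^ k)"

definition computable2 :: "(nat \<Rightarrow> nat \<Rightarrow> nat) \<Rightarrow> bool" where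
  "computable2 f \<longleftrightarrow> (\<exists>p. \<forall>x y. \<exists>B t s. exec B p (load [x, y]) t s \<and> s 1 0 = f x y)"

text \<open>The number of bits of a list, with one additional bit to delimit each entry.\<close>

definition bit_length :: "nat list \<Rightarrow> nat" where
  "bit_length xs = (\<Sum>x\<leftarrow>xs. floorlog 2 x + 1)"

text \<open>
  Fixed-parameter tractability with respect to the combined parameter \<open>(\<kappa>1, \<kappa>2)\<close>; the program is
  not given the values of the parameters, except as far as they are part of the encoding.
\<close>

definition fpt_algorithm ::
    "com \<Rightarrow> 'i set \<Rightarrow> ('i \<Rightarrow> nat list) \<Rightarrow> ('i \<Rightarrow> nat) \<Rightarrow> ('i \<Rightarrow> nat) \<Rightarrow> ('i \<Rightarrow> bool) \<Rightarrow> bool" where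
  "fpt_algorithm p X enc \<kappa>1 \<kappa>2 Q \<longleftrightarrow>
     (\<exists>f (q :: nat poly). computable2 f \<and>
        solves p X enc (\<lambda>x. f (\<kappa>1 x) (\<kappa>2 x) * poly q (bit_length (enc x))) (decides_answer Q))"


section \<open>Problems\<close>

text \<open>
  Inputs have vertex set \<open>{..<nodes I}\<close>. The values of \<open>len\<close> and \<open>weight\<close> matter on edges only.
\<close>

record wgraph =
  nodes :: nat
  edge_list :: "(nat \<times> nat) list"
  len :: "nat set \<Rightarrow> nat"

abbreviation to_edge :: "nat \<times> nat \<Rightarrow> nat set" where
  "to_edge e \<equiv> {fst e, snd e}"

definition verts :: "'b wgraph_scheme \<Rightarrow> nat set" where
  "verts I = {..<nodes I}"

definition edges :: "'b wgraph_scheme \<Rightarrow> nat set set" where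
  "edges I = set (map to_edge (edge_list I))"

abbreviation num_edges :: "'b wgraph_scheme \<Rightarrow> nat" where
  "num_edges I \<equiv> length (edge_list I)"

definition valid_graph :: "'b wgraph_scheme \<Rightarrow> bool" where
  "valid_graph I \<longleftrightarrow>
     distinct (map to_edge (edge_list I)) \<and> simple_graph (verts I) (edges I) \<and>
     connected_graph (verts I) (edges I) \<and> (\<forall>e\<in>edges I. 1 \<le> len I e)"

definition encode_graph :: "wgraph \<Rightarrow> nat list" where
  "encode_graph I =
     [nodes I, num_edges I] @
     concat (map (\<lambda>e. [fst e, snd e, len I (to_edge e)]) (edge_list I))"

text \<open>
  Of the algorithms for the two shortest path problems only the lengths of the paths are required.
\<close>

definition spsp_instances :: "(wgraph \<times> nat \<times> nat) set" where
  "spsp_instances = {(I, u, v). valid_graph I \<and> u \<in> verts I \<and> v \<in> verts I}"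

definition encode_spsp :: "wgraph \<times> nat \<times> nat \<Rightarrow> nat list" where
  "encode_spsp = (\<lambda>(I, u, v). u # v # encode_graph I)"

definition spsp_answer :: "wgraph \<times> nat \<times> nat \<Rightarrow> (nat \<Rightarrow> nat) \<Rightarrow> bool" where
  "spsp_answer = (\<lambda>(I, u, v) out. ereal (real (out 0)) = sp_dist (edges I) (len I) u v)"

definition solves_SPSP :: "com \<Rightarrow> (nat \<Rightarrow> nat \<Rightarrow> nat) \<Rightarrow> bool" where
  "solves_SPSP p T \<longleftrightarrow>
     solves p spsp_instances encode_spsp (\<lambda>(I, u, v). T (nodes I) (num_edges I)) spsp_answer"

definition two_shortest_paths ::
    "'a set set \<Rightarrow> ('a set \<Rightarrow> nat) \<Rightarrow> 'a \<Rightarrow> 'a \<Rightarrow> 'a list \<Rightarrow> 'a list \<Rightarrow> bool" where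
  "two_shortest_paths E l u v P Q \<longleftrightarrow>
     P \<in> paths E u v \<and> Q \<in> paths E u v \<and> P \<noteq> Q \<and> path_len l P \<le> path_len l Q \<and>
     (\<forall>R\<in>paths E u v - {P, Q}. path_len l Q \<le> path_len l R)"

text \<open>
  The output is an \<open>n \<times> n\<close> table of pairs of lengths; the second length is 0 if there is only one
  simple path.
\<close>

definition apsp2_answer :: "wgraph \<Rightarrow> (nat \<Rightarrow> nat) \<Rightarrow> bool" where
  "apsp2_answer I out \<longleftrightarrow>
     (\<forall>u\<in>verts I. \<forall>v\<in>verts I. u \<noteq> v \<longrightarrow>
        (let d1 = out (2 * (u * nodes I + v)); d2 = out (2 * (u * nodes I + v) + 1) in
           (\<exists>P Q. two_shortest_paths (edges I) (len I) u v P Q \<and>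
              d1 = path_len (len I) P \<and> d2 = path_len (len I) Q) \<or>
           (\<exists>P. paths (edges I) u v = {P} \<and> d1 = path_len (len I) P \<and> d2 = 0)))"

definition solves_APSP2 :: "com \<Rightarrow> (nat \<Rightarrow> nat \<Rightarrow> nat) \<Rightarrow> bool" where
  "solves_APSP2 p T \<longleftrightarrow>
     solves p {I. valid_graph I} encode_graph (\<lambda>I. T (nodes I) (num_edges I)) apsp2_answer"

text \<open>The stretch factor is given as a fraction.\<close>

record spanner_inst = wgraph +
  weight :: "nat set \<Rightarrow> nat"
  stretch_num :: nat
  stretch_den :: nat
  removed_weight :: nat

definition stretch :: "spanner_inst \<Rightarrow> real" where
  "stretch I = real (stretch_num I) / real (stretch_den I)"

definition spanner_instances :: "spanner_inst set" where
  "spanner_instances = {I. valid_graph I \<and> 0 < stretch_den I \<and> 1 \<le> stretch I}"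

definition encode_spanner :: "spanner_inst \<Rightarrow> nat list" where
  "encode_spanner I =
     [nodes I, num_edges I, stretch_num I, stretch_den I, removed_weight I] @
     concat (map (\<lambda>e. [fst e, snd e, weight I (to_edge e), len I (to_edge e)]) (edge_list I))"

definition is_solution :: "spanner_inst \<Rightarrow> nat set set \<Rightarrow> bool" where
  "is_solution I F \<longleftrightarrow>
     is_spanner (verts I) (edges I) (len I) (stretch I) F \<and>
     removed_weight I \<le> sum (weight I) (edges I - F)"

definition has_solution :: "spanner_inst \<Rightarrow> bool" where
  "has_solution I \<longleftrightarrow> (\<exists>F. is_solution I F)"

text \<open>
  A witness is output as a flag, followed by the indicator vector of \<open>F\<close> in the order of the
  edges in the input.
\<close>

definition witness_answer :: "spanner_inst \<Rightarrow> (nat \<Rightarrow> nat) \<Rightarrow> bool" where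
  "witness_answer I out \<longleftrightarrow>
     (if has_solution I
      then out 0 = 1 \<and>
        is_solution I {to_edge (edge_list I ! i) | i. i < num_edges I \<and> out (Suc i) \<noteq> 0}
      else out 0 = 0)"

text \<open>
  By convention, edges that do not settle themselves are removed before the tightness is
  determined. Instances themselves are not assumed to be preprocessed.
\<close>

definition inst_tightness :: "spanner_inst \<Rightarrow> nat" where
  "inst_tightness I =
     tightness (self_settling (edges I) (len I) (stretch I)) (weight I) (len I) (stretch I)"

definition spanner_time ::
    "(nat \<Rightarrow> nat \<Rightarrow> nat) \<Rightarrow> (nat \<Rightarrow> nat \<Rightarrow> nat) \<Rightarrow> spanner_inst \<Rightarrow> nat" where
  "spanner_time SPSP APSP2 I =
     removed_weight I ^ (2 * removed_weight I + 1) *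
     inst_tightness I ^ (2 * removed_weight I) * SPSP (nodes I) (num_edges I)
     + APSP2 (nodes I) (num_edges I)"

end

theory Submission
  imports Defs
begin

text \<open>
  Let \<open>W = removed_weight\<close> and let \<open>\<tau>\<close> be the tightness. Removing a set of nontrivial edges is
  correct as soon as every removed edge is settled by a path of remaining edges, and as nontrivial
  edges have positive weight, at most \<open>W\<close> of them need to be removed. The noncritical ones can all be
  removed at once; if this reaches the required weight, or if there is no critical edge, then the
  answer is known after two all-pairs computations. Otherwise, assign to each nontrivial edge an alternative path with at most
  \<open>\<tau>\<close> nontrivial edges. This is a digraph of outdegree at most \<open>\<tau>\<close>, so any
  \<open>W * (2 * \<tau> + 1)\<close> nontrivial edges contain \<open>W\<close> independent ones, and these can be removed
  together. Trying all choices among the first \<open>k\<close> nontrivial edges for \<open>k = 1, 2, \<dots>\<close>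
  therefore stops with \<open>k \<le> W * (2 * \<tau> + 1)\<close>, although \<open>\<tau>\<close> is not known to the program; each
  choice is checked by at most \<open>W\<close> shortest path queries.
\<close>

section \<open>Paths and distances\<close>

text \<open>The time bound dictates the form of the search. Up to
  \<open>W * (2 * \<tau> + 1) \<le> 3 * W * \<tau>\<close> values of \<open>k\<close>, each with
  \<open>k ^ W\<close> choices and \<open>W\<close> queries, cost about
  \<open>(3 * W * \<tau>) ^ (W + 1) * W\<close> queries; the powers of 3 and the surplus are
  absorbed by \<open>W ^ (2 * W + 1) * \<tau> ^ (2 * W)\<close>. This needs
  \<open>\<tau> > 0\<close>: with no critical edge \<open>\<tau>\<close> is 0 and, for positive
  \<open>W\<close>, the search term vanishes, so that case must be settled before the search.

  Instances are not preprocessed, whereas the tightness refers to the set \<open>E'\<close> of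
  self-settling edges. Both views agree because shortest paths, also those inside a spanner, use
  only edges of \<open>E'\<close>. In the same way the mandatory edges can be read off a table for
  the whole graph.

  The running times of the subroutines are arbitrary functions, yet they have to pay for all
  overhead of the program. For the part linear in \<open>m\<close> this holds because reading the
  input is charged; for the \<open>n * n\<close> cells of a table, because a correct all-pairs
  program must write that many nonzero distances, up to a constant factor.\<close>

lemma edges_of_Nil [simp]: "edges_of [] = {}"
  and edges_of_single [simp]: "edges_of [x] = {}"
  by (auto simp: edges_of_def)

lemma edges_of_Cons [simp]: "edges_of (x # y # zs) = insert {x, y} (edges_of (y # zs))"
proof -
  have "{i. Suc i < length (x # y # zs)} = insert 0 (Suc ` {i. Suc i < length (y # zs)})"
    by (auto simp: image_iff less_Suc_eq_0_disj)
  moreover have "edges_of P = (\<lambda>i. {P ! i, P ! Suc i}) ` {i. Suc i < length P}" for P :: "'a list"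
    by (auto simp: edges_of_def)
  ultimately show ?thesis
    by (simp add: image_image)
qed

lemma edges_of_append: "edges_of (xs @ x # ys) = edges_of (xs @ [x]) \<union> edges_of (x # ys)"
proof (induction xs)
  case (Cons a xs)
  then show ?case by (cases xs) auto
qed simp

lemma edges_of_rev [simp]: "edges_of (rev P) = edges_of P"
proof (induction P)
  case (Cons a P)
  then show ?case
    by (cases P) (auto simp: edges_of_append[of _ _ "[_]"] insert_commute)
qed simp

lemma finite_edges_of [simp]: "finite (edges_of P)"
  by (induction P rule: induct_list012) auto

lemma edges_of_subset_set: "e \<in> edges_of P \<Longrightarrow> e \<subseteq> set P"
  by (induction P rule: induct_list012) auto

lemma edges_of_split:
  "e \<in> edges_of P \<Longrightarrow> \<exists>xs a b ys. P = xs @ a # b # ys \<and> e = {a, b}"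
proof (induction P rule: induct_list012)
  case (3 x y zs)
  show ?case
  proof (cases "e = {x, y}")
    case True
    then show ?thesis by (metis append_Nil)
  next
    case False
    then obtain xs a b ys where "y # zs = xs @ a # b # ys \<and> e = {a, b}"
      using 3 by auto
    then show ?thesis by (metis append_Cons)
  qed
qed auto

text \<open>Cutting out the closed part between two occurrences of a vertex keeps the endpoints and
  adds no edge, so induction on the length reaches a simple path. Concatenated paths are simplified
  in this way, hence only inclusions between edge sets are available for them.\<close>

lemma walk_to_path:
  assumes "xs \<noteq> []"
  shows "\<exists>P\<in>paths (edges_of xs) (hd xs) (last xs). True"
  using assms
proof (induction "length xs" arbitrary: xs rule: less_induct)
  case less
  show ?case
  proof (cases "distinct xs")
    case True
    then show ?thesis using less.prems by (auto simp: paths_def)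
  next
    case False
    then obtain as x bs cs where xs: "xs = as @ [x] @ bs @ [x] @ cs"
      using not_distinct_decomp by blast
    define ys where "ys = as @ x # cs"
    have "edges_of ys \<subseteq> edges_of xs"
      unfolding xs ys_def
      using edges_of_append[of as x cs] edges_of_append[of as x "bs @ x # cs"]
        edges_of_append[of "x # bs" x cs] by auto
    moreover have "length ys < length xs" "ys \<noteq> []" "hd ys = hd xs" "last ys = last xs"
      by (auto simp: xs ys_def hd_append)
    ultimately show ?thesis
      using less.hyps[of ys] by (fastforce simp: paths_def)
  qed
qed

lemma pathsD:
  assumes "P \<in> paths F u v"
  shows "edges_of P \<subseteq> F" "distinct P" "hd P = u" "last P = v" "P \<noteq> []"
  using assms by (auto simp: paths_def)

lemma paths_mono: "P \<in> paths F u v \<Longrightarrow> edges_of P \<subseteq> G \<Longrightarrow> P \<in> paths G u v"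
  by (auto simp: paths_def)

lemma paths_join:
  assumes "P \<in> paths F u v" and "Q \<in> paths G v w"
  shows "\<exists>R\<in>paths (F \<union> G) u w. edges_of R \<subseteq> edges_of P \<union> edges_of Q"
proof -
  obtain P' where P': "P = P' @ [v]"
    using assms(1) by (metis append_butlast_last_id pathsD(4,5))
  obtain Q' where Q': "Q = v # Q'"
    using assms(2) by (metis list.collapse pathsD(3,5))
  let ?W = "P' @ v # Q'"
  have W: "edges_of ?W = edges_of P \<union> edges_of Q"
    unfolding P' Q' by (rule edges_of_append)
  have "hd ?W = u" "last ?W = w"
    using assms P' Q' by (auto simp: paths_def hd_append split: if_splits)
  then obtain R where "R \<in> paths (edges_of ?W) u w"
    using walk_to_path[of ?W] by auto
  then show ?thesis
    using W pathsD(1)[OF assms(1)] pathsD(1)[OF assms(2)] by (intro bexI[of _ R]) (auto simp: paths_def)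
qed

lemma paths_rev: "P \<in> paths F u v \<Longrightarrow> rev P \<in> paths F v u"
  by (auto simp: paths_def hd_rev last_rev)

lemma paths_edge: "{u, v} \<in> F \<Longrightarrow> u \<noteq> v \<Longrightarrow> [u, v] \<in> paths F u v"
  by (auto simp: paths_def)

lemma paths_refl [simp]: "[u] \<in> paths F u u"
  by (auto simp: paths_def)

lemma path_len_mono: "edges_of P \<subseteq> A \<Longrightarrow> finite A \<Longrightarrow> path_len l P \<le> sum l A"
  unfolding path_len_def by (intro sum_mono2) auto

lemma path_len_join:
  assumes "edges_of R \<subseteq> edges_of P \<union> edges_of Q"
  shows "path_len l R \<le> path_len l P + path_len l Q"
proof -
  have "path_len l R \<le> sum l (edges_of P \<union> edges_of Q)"
    using assms by (intro path_len_mono) auto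
  also have "\<dots> \<le> path_len l P + path_len l Q"
    using sum.union_inter[of "edges_of P" "edges_of Q" l] by (simp add: path_len_def)
  finally show ?thesis .
qed

lemma path_len_rev [simp]: "path_len l (rev P) = path_len l P"
  by (simp add: path_len_def)

lemma path_len_single [simp]: "path_len l [x] = 0"
  by (simp add: path_len_def)

lemma path_len_pair [simp]: "path_len l [x, y] = l {x, y}"
  by (simp add: path_len_def)

lemma path_len_Cons:
  assumes "distinct (x # y # zs)"
  shows "path_len l (x # y # zs) = l {x, y} + path_len l (y # zs)"
proof -
  have "{x, y} \<notin> edges_of (y # zs)"
    using assms edges_of_subset_set[of "{x, y}" "y # zs"] by auto
  then show ?thesis by (simp add: path_len_def)
qed

text \<open>In a simple path \<open>u\<close> can only come first and \<open>v\<close> only last, so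
  an edge joining them leaves no room for other vertices. Hence alternative means different from
  \<open>[u, v]\<close>, which a table of second shortest paths can detect.\<close>

lemma path_with_edge:
  assumes P: "P \<in> paths F u v" and "{u, v} \<in> edges_of P"
  shows "P = [u, v]"
proof -
  obtain xs a b ys where *: "P = xs @ a # b # ys" "{u, v} = {a, b}"
    using edges_of_split[OF assms(2)] by blast
  have "xs = []"
  proof (rule ccontr)
    assume "xs \<noteq> []"
    then have "u \<in> set xs" "v \<in> set (b # ys)"
      using P * by (auto simp: paths_def hd_append)
    then show False
      using P * by (auto simp: paths_def doubleton_eq_iff split: if_splits)
  qed
  then have "P = u # b # ys" "b = v"
    using P * by (auto simp: paths_def doubleton_eq_iff)
  moreover have "ys = []"
    using P \<open>P = u # b # ys\<close> \<open>b = v\<close> last_in_set[of ys] by (auto simp: paths_def split: if_splits)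
  ultimately show ?thesis by simp
qed

lemma path_replace:
  assumes P: "P \<in> paths F u v" and e: "{a, b} \<in> edges_of P" and Q: "Q \<in> paths G a b"
  shows "\<exists>R\<in>paths ((F - {{a, b}}) \<union> G) u v. edges_of R \<subseteq> (edges_of P - {{a, b}}) \<union> edges_of Q"
proof -
  obtain xs c d ys where s: "P = xs @ c # d # ys" "{a, b} = {c, d}"
    using edges_of_split[OF e] by blast
  obtain Q' where Q': "Q' \<in> paths G c d" "edges_of Q' = edges_of Q"
    using Q s(2) paths_rev[OF Q] by (auto simp: doubleton_eq_iff)
  have dis: "distinct P" using P by (rule pathsD)
  have edg: "edges_of P = edges_of (xs @ [c]) \<union> ({{c, d}} \<union> edges_of (d # ys))"
    unfolding s(1) by (subst edges_of_append) simp
  have n1: "{c, d} \<notin> edges_of (xs @ [c])"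
    using dis s(1) edges_of_subset_set[of "{c, d}" "xs @ [c]"] by auto
  have n2: "{c, d} \<notin> edges_of (d # ys)"
    using dis s(1) edges_of_subset_set[of "{c, d}" "d # ys"] by auto
  have p1: "xs @ [c] \<in> paths (edges_of P - {{a, b}}) u c"
    using P dis n1 edg unfolding paths_def s by (auto simp: hd_append)
  have p2: "d # ys \<in> paths (edges_of P - {{a, b}}) d v"
    using P dis n2 edg unfolding paths_def s by (auto)
  obtain R1 where R1: "R1 \<in> paths ((edges_of P - {{a, b}}) \<union> edges_of Q) u d"
    using paths_join[OF p1 paths_mono[OF Q'(1) subset_refl]] Q'(2) by auto
  obtain R where R: "R \<in> paths ((edges_of P - {{a, b}}) \<union> edges_of Q) u v"
    using paths_join[OF R1 p2] by (auto simp: Un_absorb2)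
  then show ?thesis
    using pathsD(1)[OF P] pathsD(1)[OF Q] by (intro bexI[of _ R]) (auto simp: paths_def)
qed

text \<open>Otherwise splicing the detour \<open>Q\<close> in for the edge would yield a shorter
  path. It is applied in the whole graph, in a spanner and in the graph without one edge, each time
  to show that the edges of a shortest path settle themselves.\<close>

lemma shortest_path_edge_le:
  assumes P: "P \<in> paths F u v" and e: "{a, b} \<in> edges_of P" and Q: "Q \<in> paths G a b"
    and min: "\<And>R. R \<in> paths ((F - {{a, b}}) \<union> G) u v \<Longrightarrow> path_len l P \<le> path_len l R"
  shows "l {a, b} \<le> path_len l Q"
proof -
  obtain R where R: "R \<in> paths ((F - {{a, b}}) \<union> G) u v"
    "edges_of R \<subseteq> (edges_of P - {{a, b}}) \<union> edges_of Q"
    using path_replace[OF P e Q] by blast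
  have "path_len l P \<le> path_len l R" using min R(1) by blast
  also have "\<dots> \<le> sum l (edges_of P - {{a, b}}) + path_len l Q"
    using path_len_mono[OF R(2), of l] sum.union_inter[of "edges_of P - {{a, b}}" "edges_of Q" l]
    by (simp add: path_len_def)
  finally show ?thesis
    using e by (simp add: path_len_def sum.remove[of _ "{a, b}"])
qed

section \<open>Distances as natural numbers\<close>

definition gdist :: "'a set set \<Rightarrow> ('a set \<Rightarrow> nat) \<Rightarrow> 'a \<Rightarrow> 'a \<Rightarrow> nat" where
  "gdist E l u v = (INF P\<in>paths E u v. path_len l P)"

lemma gdist_le: "P \<in> paths E u v \<Longrightarrow> gdist E l u v \<le> path_len l P"
  unfolding gdist_def by (rule cINF_lower) auto

lemma gdist_attained:
  assumes "paths E u v \<noteq> {}"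
  obtains P where "P \<in> paths E u v" "path_len l P = gdist E l u v"
proof -
  have "gdist E l u v \<in> path_len l ` paths E u v"
    unfolding gdist_def by (rule Inf_nat_def1) (use assms in simp)
  then show thesis using that by force
qed

lemma sp_dist_gdist:
  assumes "paths E u v \<noteq> {}"
  shows "sp_dist E l u v = ereal (real (gdist E l u v))"
proof (rule antisym)
  obtain P where "P \<in> paths E u v" "path_len l P = gdist E l u v"
    using gdist_attained assms .
  then show "sp_dist E l u v \<le> ereal (real (gdist E l u v))"
    unfolding sp_dist_def by (metis INF_lower)
  show "ereal (real (gdist E l u v)) \<le> sp_dist E l u v"
    unfolding sp_dist_def by (intro INF_greatest) (simp add: gdist_le)
qed

lemma sp_dist_le_iff:
  "sp_dist E l u v \<le> ereal c \<longleftrightarrow> (\<exists>P\<in>paths E u v. real (path_len l P) \<le> c)"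
proof (cases "paths E u v = {}")
  case True
  then show ?thesis by (simp add: sp_dist_def top_ereal_def)
next
  case False
  obtain P where "P \<in> paths E u v" "path_len l P = gdist E l u v"
    using gdist_attained False .
  then show ?thesis
    using gdist_le[of _ E u v l] by (auto simp: sp_dist_gdist[OF False] intro!: bexI[of _ P] intro: order_trans[rotated])
qed

lemma gdist_commute: "gdist E l u v = gdist E l v u"
proof -
  have "path_len l ` paths E u v \<subseteq> path_len l ` paths E v u" for u v
    by (auto simp: path_len_def image_iff intro!: bexI[OF _ paths_rev])
  then have "path_len l ` paths E u v = path_len l ` paths E v u" by blast
  then show ?thesis by (simp add: gdist_def)
qed

section \<open>Removable edges\<close>

text \<open>The stretch is kept as a fraction \<open>p / q\<close>, so that every comparison becomes
  an inequality between products of natural numbers, in the form in which the program evaluates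
  it.\<close>

locale stretched_graph =
  fixes V :: "'a set" and E :: "'a set set" and l w :: "'a set \<Rightarrow> nat" and p q :: nat
  assumes simple: "simple_graph V E" and conn: "connected_graph V E"
    and len_pos: "e \<in> E \<Longrightarrow> 1 \<le> l e" and q_pos: "0 < q" and q_le_p: "q \<le> p"
begin

abbreviation "\<alpha> \<equiv> real p / real q"
abbreviation "d \<equiv> gdist E l"
abbreviation "E' \<equiv> self_settling E l \<alpha>"
abbreviation "T \<equiv> trivial_edges E' w l \<alpha>"
abbreviation "N \<equiv> nontrivial_edges E' w l \<alpha>"
abbreviation "C \<equiv> critical E' w l \<alpha>"
abbreviation "\<tau> \<equiv> tightness E' w l \<alpha>"

definition settled :: "'a set set \<Rightarrow> 'a \<Rightarrow> 'a \<Rightarrow> bool" where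
  "settled F u v \<longleftrightarrow> (\<exists>P\<in>paths F u v. q * path_len l P \<le> p * d u v)"

definition removable :: "'a set set \<Rightarrow> bool" where
  "removable R \<longleftrightarrow> R \<subseteq> N \<and> (\<forall>u v. {u, v} \<in> R \<longrightarrow> settled (E' - R) u v)"

lemma scaled_le_iff: "real x \<le> \<alpha> * real y \<longleftrightarrow> q * x \<le> p * y"
proof -
  have "real x \<le> \<alpha> * real y \<longleftrightarrow> real (q * x) \<le> real (p * y)"
    using q_pos by (simp add: field_simps)
  then show ?thesis by (simp only: of_nat_le_iff)
qed

lemma edgeD: "{u, v} \<in> E \<Longrightarrow> u \<in> V \<and> v \<in> V \<and> u \<noteq> v"
  using simple by (fastforce simp: simple_graph_def doubleton_eq_iff)

lemma edgeE:
  assumes "e \<in> E"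
  obtains u v where "e = {u, v}" "u \<in> V" "v \<in> V" "u \<noteq> v"
  using simple assms by (auto simp: simple_graph_def)

lemma finite_E: "finite E"
proof (rule finite_subset)
  show "E \<subseteq> Pow V" using simple by (auto simp: simple_graph_def)
qed (use simple in \<open>simp add: simple_graph_def\<close>)

lemma paths_ne: "u \<in> V \<Longrightarrow> v \<in> V \<Longrightarrow> paths E u v \<noteq> {}"
  using conn by (simp add: connected_graph_def)

lemma sp_dist_E: "u \<in> V \<Longrightarrow> v \<in> V \<Longrightarrow> sp_dist E l u v = ereal (real (d u v))"
  by (intro sp_dist_gdist paths_ne)

lemma d_commute: "d u v = d v u"
  by (rule gdist_commute)

lemma d_edge_le: "{u, v} \<in> E \<Longrightarrow> d u v \<le> l {u, v}"
  using gdist_le[OF paths_edge, of u v E l] edgeD by auto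

lemma self_settling_iff: "{u, v} \<in> E' \<longleftrightarrow> {u, v} \<in> E \<and> q * l {u, v} \<le> p * d u v"
proof -
  have "{u, v} \<in> E' \<longleftrightarrow> (\<exists>x y. {u, v} = {x, y} \<and> {x, y} \<in> E \<and> q * l {x, y} \<le> p * d x y)"
    unfolding self_settling_def
    by (force simp: sp_dist_E dest: edgeD simp flip: scaled_le_iff)
  also have "\<dots> \<longleftrightarrow> {u, v} \<in> E \<and> q * l {u, v} \<le> p * d u v"
    using d_commute by (auto simp: doubleton_eq_iff insert_commute)
  finally show ?thesis .
qed

section \<open>Edges that settle themselves\<close>

lemma E'_subset: "E' \<subseteq> E"
  unfolding self_settling_def by auto

lemma E'_edgeE:
  assumes "e \<in> E'"
  obtains u v where "e = {u, v}" "u \<in> V" "v \<in> V"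
  using assms E'_subset edgeE by (metis subsetD)

text \<open>An edge on a shortest path is no longer than a shortest path between its own ends, so
  \<open>q \<le> p\<close> lets it settle itself. Consequently dropping all other edges changes no
  distance, and \<open>d\<close> serves for \<open>E\<close> and \<open>E'\<close> alike.\<close>

lemma shortest_in_E':
  assumes P: "P \<in> paths E u v" and len: "path_len l P = d u v"
  shows "P \<in> paths E' u v"
proof (rule paths_mono[OF P], rule subsetI)
  fix e assume e: "e \<in> edges_of P"
  then have "e \<in> E" using pathsD(1)[OF P] by auto
  then obtain a b where ab: "e = {a, b}" "a \<in> V" "b \<in> V" by (rule edgeE)
  obtain Q where Q: "Q \<in> paths E a b" "path_len l Q = d a b"
    using gdist_attained[OF paths_ne[OF ab(2,3)]] .
  have "l {a, b} \<le> path_len l Q"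
  proof (rule shortest_path_edge_le[OF P _ Q(1)])
    show "{a, b} \<in> edges_of P" using e ab(1) by simp
    show "path_len l P \<le> path_len l R" if "R \<in> paths (E - {{a, b}} \<union> E) u v" for R
      unfolding len using that by (intro gdist_le) (auto simp: paths_def)
  qed
  then have "q * l {a, b} \<le> p * d a b"
    using Q(2) q_le_p by (simp add: mult_mono)
  then show "e \<in> E'"
    using ab(1) \<open>e \<in> E\<close> self_settling_iff by auto
qed

lemma shortest_pathE:
  assumes "u \<in> V" "v \<in> V"
  obtains P where "P \<in> paths E' u v" "path_len l P = d u v"
  using gdist_attained[OF paths_ne[OF assms]] shortest_in_E' by metis

lemma sp_dist_E':
  assumes "u \<in> V" "v \<in> V"
  shows "sp_dist E' l u v = ereal (real (d u v))"
proof (rule antisym)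
  show "sp_dist E' l u v \<le> ereal (real (d u v))"
    using shortest_pathE[OF assms] by (metis sp_dist_le_iff order_refl)
  have "paths E' u v \<subseteq> paths E u v" using E'_subset by (auto simp: paths_def)
  then show "ereal (real (d u v)) \<le> sp_dist E' l u v"
    unfolding sp_dist_def by (auto intro!: INF_greatest gdist_le)
qed

lemma settling_iff:
  assumes "u \<in> V" "v \<in> V"
  shows "P \<in> settling_paths E' l \<alpha> u v \<longleftrightarrow> P \<in> paths E' u v \<and> q * path_len l P \<le> p * d u v"
  by (simp add: settling_paths_def sp_dist_E'[OF assms] flip: scaled_le_iff)

lemma settled_mono: "settled F u v \<Longrightarrow> F \<subseteq> G \<Longrightarrow> settled G u v"
  unfolding settled_def by (force simp: paths_def)

lemma settled_commute: "settled F u v \<longleftrightarrow> settled F v u"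
proof -
  have "settled F u v" if "settled F v u" for u v
    using that unfolding settled_def d_commute[of v u] by (metis paths_rev path_len_rev)
  then show ?thesis by blast
qed

text \<open>Each edge of \<open>P\<close> is replaced by a path in \<open>F\<close> that settles it.
  Edges of \<open>E'\<close> suffice because shortest paths use no others; this is the passage from
  edges to all pairs in \<open>is_spannerI\<close>.\<close>

lemma stretched_path:
  assumes "P \<in> paths E' u v" and "\<And>x y. {x, y} \<in> E' \<Longrightarrow> settled F x y"
  shows "\<exists>R\<in>paths F u v. q * path_len l R \<le> p * path_len l P"
  using assms(1)
proof (induction P arbitrary: u rule: induct_list012)
  case (2 x)
  then show ?case by (auto simp: paths_def intro!: bexI[of _ "[x]"])
next
  case (3 x y zs)
  then have xu: "x = u" and e: "{x, y} \<in> E'" and P': "y # zs \<in> paths E' y v"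
    and dis: "distinct (x # y # zs)"
    by (auto simp: paths_def)
  obtain R where R: "R \<in> paths F y v" "q * path_len l R \<le> p * path_len l (y # zs)"
    using 3 P' by blast
  obtain Q where Q: "Q \<in> paths F u y" "q * path_len l Q \<le> p * d u y"
    using assms(2)[OF e] xu by (auto simp: settled_def)
  obtain S where S: "S \<in> paths F u v" "edges_of S \<subseteq> edges_of Q \<union> edges_of R"
    using paths_join[OF Q(1) R(1)] by auto
  have "q * path_len l S \<le> q * (path_len l Q + path_len l R)"
    using path_len_join[OF S(2)] by simp
  also have "\<dots> \<le> p * d u y + p * path_len l (y # zs)"
    using Q(2) R(2) by (simp add: distrib_left)
  also have "\<dots> \<le> p * l {u, y} + p * path_len l (y # zs)"
    using d_edge_le[of u y] e xu E'_subset by auto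
  finally show ?case
    using S(1) path_len_Cons[OF dis] xu by (auto simp: distrib_left)
qed (auto simp: paths_def)

lemma is_spannerI:
  assumes "F \<subseteq> E" and "\<And>x y. {x, y} \<in> E' \<Longrightarrow> settled F x y"
  shows "is_spanner V E l \<alpha> F"
  unfolding is_spanner_def
proof (intro conjI ballI)
  fix u v assume uv: "u \<in> V" "v \<in> V"
  obtain P where "P \<in> paths E' u v" "path_len l P = d u v"
    using shortest_pathE[OF uv] .
  then obtain R where "R \<in> paths F u v" "q * path_len l R \<le> p * d u v"
    using stretched_path assms(2) by metis
  then show "sp_dist F l u v \<le> ereal \<alpha> * sp_dist E l u v"
    by (auto simp: sp_dist_E[OF uv] sp_dist_le_iff scaled_le_iff simp del: times_divide_eq_left)
qed fact

lemma self_settled: "{u, v} \<in> E' \<Longrightarrow> {u, v} \<in> F \<Longrightarrow> settled F u v"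
  using edgeD[of u v] E'_subset
  by (auto simp: settled_def self_settling_iff intro!: bexI[of _ "[u, v]"] paths_edge)

text \<open>A shortest path in a spanner only uses edges that settle themselves.\<close>

lemma spanner_settled:
  assumes F: "is_spanner V E l \<alpha> F" and uv: "u \<in> V" "v \<in> V"
  shows "settled (F \<inter> E') u v"
proof -
  have FE: "F \<subseteq> E" using F by (simp add: is_spanner_def)
  have short: "\<exists>P\<in>paths F x y. q * path_len l P \<le> p * d x y" if "x \<in> V" "y \<in> V" for x y
    using F that
    by (auto simp: is_spanner_def sp_dist_E sp_dist_le_iff scaled_le_iff simp del: times_divide_eq_left)
  then have "paths F u v \<noteq> {}" using uv by blast
  from gdist_attained[OF this]
  obtain P where P: "P \<in> paths F u v" "path_len l P = gdist F l u v" .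
  have "edges_of P \<subseteq> E'"
  proof
    fix e assume e: "e \<in> edges_of P"
    then have "e \<in> E" using pathsD(1)[OF P(1)] FE by auto
    then obtain a b where ab: "e = {a, b}" "a \<in> V" "b \<in> V" by (rule edgeE)
    \<comment> \<open>The spanner settles the pair \<open>a\<close>, \<open>b\<close> as well, and
      the edge on the shortest path \<open>P\<close> is no longer than that settling path.\<close>
    obtain Q where Q: "Q \<in> paths F a b" "q * path_len l Q \<le> p * d a b"
      using short ab by blast
    have "l {a, b} \<le> path_len l Q"
    proof (rule shortest_path_edge_le[OF P(1) _ Q(1)])
      show "{a, b} \<in> edges_of P" using e ab(1) by simp
      show "path_len l P \<le> path_len l R" if "R \<in> paths (F - {{a, b}} \<union> F) u v" for R
        unfolding P(2) using that by (intro gdist_le) (auto simp: paths_def)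
    qed
    then have "q * l {a, b} \<le> p * d a b"
      using Q(2) by (meson mult_le_mono2 order_trans)
    then show "e \<in> E'" using ab(1) \<open>e \<in> E\<close> self_settling_iff by auto
  qed
  moreover obtain Q where "Q \<in> paths F u v" "q * path_len l Q \<le> p * d u v"
    using short uv by blast
  then have "q * path_len l P \<le> p * d u v"
    unfolding P(2) using gdist_le[of Q F u v l] by (meson mult_le_mono2 order_trans)
  ultimately show ?thesis
    using P(1) unfolding settled_def by (intro bexI[of _ P]) (auto simp: paths_def)
qed

text \<open>Alternative paths are defined inside \<open>E'\<close>, but the table is computed for
  \<open>E\<close>. Let \<open>Q\<close> be shortest among the paths avoiding \<open>{u, v}\<close>.
  If an edge \<open>{a, b}\<close> of \<open>Q\<close> did not settle itself, then \<open>p * d a b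
  < q * l {a, b} \<le> q * path_len l Q \<le> p * d u v\<close>, so a shortest path between
  \<open>a\<close> and \<open>b\<close> would be too short to contain \<open>{u, v}\<close>. It
  could then replace \<open>{a, b}\<close> in \<open>Q\<close>, which makes \<open>{a, b}\<close> no
  longer than \<open>d a b\<close>, a contradiction.\<close>

lemma alternative_iff:
  assumes "{u, v} \<in> E'"
  shows "alternative_paths E' l \<alpha> u v \<noteq> {} \<longleftrightarrow>
    (\<exists>P\<in>paths E u v. P \<noteq> [u, v] \<and> q * path_len l P \<le> p * d u v)" (is "?L \<longleftrightarrow> ?R")
proof
  have uv: "u \<in> V" "v \<in> V" "u \<noteq> v" and uvE: "{u, v} \<in> E"
    using edgeD[of u v] assms E'_subset by auto
  show ?R if L: ?L
  proof -
    obtain P where "P \<in> alternative_paths E' l \<alpha> u v" using L by blast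
    then have "P \<in> paths E' u v" "q * path_len l P \<le> p * d u v" "{u, v} \<notin> edges_of P"
      by (simp_all add: alternative_paths_def settling_iff[OF uv(1,2)])
    moreover from this have "P \<noteq> [u, v]" by auto
    ultimately show ?R using E'_subset by (intro bexI[of _ P] conjI) (auto simp: paths_def)
  qed
  show ?L if R: ?R
  proof -
    obtain P where P: "P \<in> paths E u v" "P \<noteq> [u, v]" "q * path_len l P \<le> p * d u v"
      using R by blast
    let ?F = "E - {{u, v}}"
    have "P \<in> paths ?F u v"
      using P path_with_edge[of P E u v] by (auto simp: paths_def)
    then have "paths ?F u v \<noteq> {}" by blast
    from gdist_attained[OF this]
    obtain Q where Q: "Q \<in> paths ?F u v" "path_len l Q = gdist ?F l u v" .
    have lenQ: "q * path_len l Q \<le> p * d u v"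
      unfolding Q(2) using gdist_le[OF \<open>P \<in> paths ?F u v\<close>, of l] P(3) by (meson mult_le_mono2 order_trans)
    have "edges_of Q \<subseteq> E'"
    proof (rule subsetI, rule ccontr)
      fix e assume e: "e \<in> edges_of Q" and nE': "e \<notin> E'"
      then have "e \<in> E" using pathsD(1)[OF Q(1)] by auto
      then obtain a b where ab: "e = {a, b}" "a \<in> V" "b \<in> V" by (rule edgeE)
      obtain R where R: "R \<in> paths E a b" "path_len l R = d a b"
        using gdist_attained[OF paths_ne[OF ab(2,3)]] .
      have lt: "p * d a b < q * l {a, b}"
        using nE' ab(1) \<open>e \<in> E\<close> self_settling_iff by auto
      have "l {a, b} \<le> path_len l Q"
        unfolding path_len_def using e ab(1) by (intro member_le_sum) auto
      then have "p * d a b < p * d u v"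
        using lt lenQ by (meson le_trans less_le_trans mult_le_mono2)
      then have "d a b < l {u, v}"
        using d_edge_le[OF uvE] by (meson less_le_trans mult_less_cancel1)
      then have "{u, v} \<notin> edges_of R"
        using member_le_sum[of "{u, v}" "edges_of R" l] R(2) by (force simp: path_len_def)
      then have R': "R \<in> paths ?F a b" using R(1) by (auto simp: paths_def)
      have "l {a, b} \<le> path_len l R"
      proof (rule shortest_path_edge_le[OF Q(1) _ R'])
        show "{a, b} \<in> edges_of Q" using e ab(1) by simp
        show "path_len l Q \<le> path_len l S" if "S \<in> paths (?F - {{a, b}} \<union> ?F) u v" for S
          unfolding Q(2) using that by (intro gdist_le) (auto simp: paths_def)
      qed
      then have "q * l {a, b} \<le> p * d a b"
        using R(2) q_le_p by (simp add: mult_mono)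
      then show False using lt by simp
    qed
    then have "Q \<in> alternative_paths E' l \<alpha> u v"
      using Q(1) lenQ by (auto simp: alternative_paths_def settling_iff[OF uv(1,2)] paths_def)
    then show ?L by blast
  qed
qed

section \<open>Mandatory, trivial and critical edges\<close>

lemma mandatory_iff:
  "{u, v} \<in> mandatory E' l \<alpha> \<longleftrightarrow> {u, v} \<in> E' \<and> alternative_paths E' l \<alpha> u v = {}"
proof -
  have "alternative_paths E' l \<alpha> u v = {}"
    if "alternative_paths E' l \<alpha> v u = {}" "{u, v} \<in> E'" for u v
  proof -
    have "rev P \<in> alternative_paths E' l \<alpha> v u" if "P \<in> alternative_paths E' l \<alpha> u v" for P
      using that \<open>{u, v} \<in> E'\<close> E'_subset edgeD[of u v] paths_rev[of P E' u v] d_commute[of u v]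
      by (auto simp: alternative_paths_def settling_iff path_len_def insert_commute)
    then show ?thesis using that by blast
  qed
  then show ?thesis
    unfolding mandatory_def by (auto simp: doubleton_eq_iff insert_commute)
qed

lemma T_subset: "T \<subseteq> E'"
  by (auto simp: trivial_edges_def mandatory_def)

lemma N_subset: "N \<subseteq> E'"
  by (auto simp: nontrivial_edges_def)

lemma finite_N: "finite N"
  using N_subset E'_subset finite_E by (meson finite_subset)

lemma critical_iff: "{u, v} \<in> C \<longleftrightarrow> {u, v} \<in> E' \<and> \<not> settled T u v"
proof -
  have *: "(\<exists>P\<in>settling_paths E' l \<alpha> x y. edges_of P \<subseteq> T) \<longleftrightarrow> settled T x y" if "{x, y} \<in> E'" for x y
  proof -
    have V: "x \<in> V" "y \<in> V" using that E'_subset edgeD[of x y] by auto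
    show ?thesis
      unfolding settled_def using T_subset settling_iff[OF V] by (auto simp: paths_def)
  qed
  have "{u, v} \<in> C \<longleftrightarrow> (\<exists>x y. {u, v} = {x, y} \<and> {x, y} \<in> E' \<and> \<not> settled T x y)"
    unfolding critical_def using * by blast
  also have "\<dots> \<longleftrightarrow> {u, v} \<in> E' \<and> \<not> settled T u v"
    using settled_commute by (auto simp: doubleton_eq_iff insert_commute)
  finally show ?thesis .
qed

lemma C_subset: "C \<subseteq> N"
proof
  fix e assume e: "e \<in> C"
  then have "e \<in> E'" by (auto simp: critical_def)
  then obtain u v where "e = {u, v}" by (rule E'_edgeE)
  then show "e \<in> N"
    using e self_settled[of u v T] by (auto simp: critical_iff nontrivial_edges_def)
qed

lemma N_weight: "e \<in> N \<Longrightarrow> 1 \<le> w e"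
  by (cases "w e = 0") (auto simp: nontrivial_edges_def trivial_edges_def)

lemma noncritical_removable: "removable (N - C)"
  unfolding removable_def
proof (intro conjI allI impI)
  fix u v assume *: "{u, v} \<in> N - C"
  then have "settled T u v" using N_subset by (auto simp: critical_iff)
  moreover have "T \<subseteq> E' - (N - C)" using T_subset by (auto simp: nontrivial_edges_def)
  ultimately show "settled (E' - (N - C)) u v" by (rule settled_mono)
qed auto

lemma removable_spanner:
  assumes "removable R"
  shows "is_spanner V E l \<alpha> (E' - R)"
proof (rule is_spannerI)
  show "settled (E' - R) x y" if "{x, y} \<in> E'" for x y
    using assms that self_settled[of x y "E' - R"] by (cases "{x, y} \<in> R") (auto simp: removable_def)
qed (use E'_subset in auto)

lemma removable_weight:
  assumes "removable R"
  shows "sum w (E - (E' - R)) = sum w (E - E') + sum w R"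
proof -
  have "R \<subseteq> E'" using assms N_subset by (auto simp: removable_def)
  then have "E - (E' - R) = (E - E') \<union> R" using E'_subset by auto
  moreover have "finite R" "(E - E') \<inter> R = {}"
    using \<open>R \<subseteq> E'\<close> E'_subset finite_E by (auto intro: finite_subset)
  ultimately show ?thesis using finite_E by (simp add: sum.union_disjoint)
qed

lemma removable_subset: "removable R \<Longrightarrow> R' \<subseteq> R \<Longrightarrow> removable R'"
  unfolding removable_def by (blast intro: settled_mono)

text \<open>Any \<open>k\<close> elements already weigh \<open>k\<close>: positive weights turn a
  demand on the weight into a bound on the number of removed edges.\<close>

lemma exists_small_subset:
  assumes "finite A" "\<And>a. a \<in> A \<Longrightarrow> 1 \<le> f a" "(k :: nat) \<le> sum f A"
  shows "\<exists>B\<subseteq>A. card B \<le> k \<and> k \<le> sum f B"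
proof (cases "card A \<le> k")
  case True
  then show ?thesis using assms by blast
next
  case False
  then obtain B where B: "B \<subseteq> A" "card B = k"
    by (metis nat_le_linear obtain_subset_with_card_n)
  have "card B \<le> sum f B"
    using sum_mono[of B "\<lambda>_. 1" f] B(1) assms(2) by auto
  then show ?thesis using B by blast
qed

lemma spanner_removable:
  assumes F: "is_spanner V E l \<alpha> F" and W: "W \<le> sum w (E - F)"
  shows "\<exists>R. removable R \<and> card R \<le> W \<and> W \<le> sum w (E - E') + sum w R"
proof -
  have FE: "F \<subseteq> E" using F by (simp add: is_spanner_def)
  \<comment> \<open>Restricting to \<open>N\<close> loses no weight: a removed edge outside
    \<open>N\<close> either does not settle itself, and is counted separately, or has weight 0,
    since mandatory edges must lie in \<open>F\<close>.\<close>
  define R where "R = N - F"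
  have rem: "removable R"
    unfolding removable_def
  proof (intro conjI allI impI)
    fix u v assume "{u, v} \<in> R"
    then have "u \<in> V" "v \<in> V" using edgeD[of u v] N_subset E'_subset by (auto simp: R_def)
    then have "settled (F \<inter> E') u v" using spanner_settled F by blast
    then show "settled (E' - R) u v" by (rule settled_mono) (auto simp: R_def)
  qed (auto simp: R_def)
  have mand: "e \<in> F" if m: "e \<in> mandatory E' l \<alpha>" for e
  proof (rule ccontr)
    assume e: "e \<notin> F"
    have "e \<in> E'" using m by (auto simp: mandatory_def)
    then obtain u v where uv: "e = {u, v}" "u \<in> V" "v \<in> V" by (rule E'_edgeE)
    obtain P where "P \<in> paths (F \<inter> E') u v" "q * path_len l P \<le> p * d u v"
      using spanner_settled[OF F uv(2,3)] by (auto simp: settled_def)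
    then have "P \<in> alternative_paths E' l \<alpha> u v"
      using e uv(1) by (auto simp: alternative_paths_def settling_iff[OF uv(2,3)] paths_def)
    then show False using m uv(1) mandatory_iff by blast
  qed
  have "sum w (E - F) \<le> sum w ((E - E') \<union> R \<union> {e \<in> E'. w e = 0})"
  proof (rule sum_mono2)
    show "E - F \<subseteq> (E - E') \<union> R \<union> {e \<in> E'. w e = 0}"
      using mand by (auto simp: R_def nontrivial_edges_def trivial_edges_def)
  qed (use finite_E E'_subset N_subset in \<open>auto simp: R_def intro: finite_subset\<close>)
  also have "\<dots> = sum w ((E - E') \<union> R)"
    using finite_E E'_subset N_subset finite_N
    by (intro sum.mono_neutral_right) (auto simp: R_def intro: finite_subset)
  also have "\<dots> = sum w (E - E') + sum w R"
    using finite_E N_subset finite_N by (intro sum.union_disjoint) (auto simp: R_def)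
  \<comment> \<open>Truncated subtraction: if the edges that do not settle themselves already weigh
    \<open>W\<close>, no further edge has to be removed.\<close>
  finally have "W - sum w (E - E') \<le> sum w R" using W by simp
  then obtain R' where "R' \<subseteq> R" "card R' \<le> W - sum w (E - E')" "W - sum w (E - E') \<le> sum w R'"
    using exists_small_subset[of R w "W - sum w (E - E')"] finite_N N_weight unfolding R_def
    by (metis DiffD1 finite_Diff)
  then show ?thesis using removable_subset[OF rem] by (intro exI[of _ R']) auto
qed

text \<open>The lower bound holds because an alternative path without nontrivial edges would settle
  the pair by trivial edges alone, contradicting criticality.\<close>

lemma critical_alternative:
  assumes "{u, v} \<in> C"
  obtains A where "tightest_alternative E' w l \<alpha> u v A" "1 \<le> card (edges_of A \<inter> N)"
    "card (edges_of A \<inter> N) \<le> \<tau>"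
proof -
  have uv: "{u, v} \<in> E'" "{u, v} \<in> N" using assms C_subset N_subset by auto
  have V: "u \<in> V" "v \<in> V" using uv(1) E'_subset edgeD by auto
  have "{u, v} \<notin> mandatory E' l \<alpha>" using uv(2) by (auto simp: nontrivial_edges_def trivial_edges_def)
  then obtain A0 where "A0 \<in> alternative_paths E' l \<alpha> u v" using uv(1) mandatory_iff by auto
  from ex_has_least_nat[of "\<lambda>A. A \<in> alternative_paths E' l \<alpha> u v", OF this,
      of "\<lambda>A. card (edges_of A \<inter> N)"]
  obtain A where A: "tightest_alternative E' w l \<alpha> u v A"
    unfolding tightest_alternative_def by blast
  have Ap: "A \<in> paths E' u v" "q * path_len l A \<le> p * d u v"
    using A by (auto simp: tightest_alternative_def alternative_paths_def settling_iff[OF V])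
  have "edges_of A \<inter> N \<noteq> {}"
  proof
    assume "edges_of A \<inter> N = {}"
    then have "A \<in> paths T u v" using Ap(1) by (auto simp: paths_def nontrivial_edges_def)
    then show False using assms Ap(2) by (auto simp: critical_iff settled_def)
  qed
  then have "1 \<le> card (edges_of A \<inter> N)"
    by (simp add: Suc_le_eq card_gt_0_iff)
  moreover have "card (edges_of A \<inter> N) \<le> \<tau>"
    unfolding tightness_def
  proof (rule Max_ge)
    have "{card (edges_of A \<inter> N) |u v A. {u, v} \<in> C \<and> tightest_alternative E' w l \<alpha> u v A} \<subseteq> {..card N}"
      by (auto intro: card_mono finite_N)
    then show "finite (insert 0 {card (edges_of A \<inter> N) |u v A. {u, v} \<in> C \<and> tightest_alternative E' w l \<alpha> u v A})"
      by (simp add: finite_subset)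
  qed (use assms A in blast)
  ultimately show thesis using that A by blast
qed

lemma tightness_pos: "C \<noteq> {} \<Longrightarrow> 1 \<le> \<tau>"
proof -
  assume "C \<noteq> {}"
  then obtain e where "e \<in> C" by blast
  moreover have "e \<in> E'" using calculation C_subset N_subset by blast
  ultimately obtain u v where "{u, v} \<in> C" by (metis E'_edgeE)
  then obtain A where "1 \<le> card (edges_of A \<inter> N)" "card (edges_of A \<inter> N) \<le> \<tau>"
    by (rule critical_alternative)
  then show ?thesis by (rule order_trans)
qed

text \<open>The tightness speaks of critical edges only, but a noncritical one has a settling path
  of trivial edges. So the outdegree bound holds on all of \<open>N\<close>, and the search need not
  single out the critical edges.\<close>

lemma nontrivial_alternative:
  assumes "e \<in> N"
  shows "\<exists>A. card (A \<inter> N) \<le> \<tau> \<and> e \<notin> A \<and> A \<subseteq> E' \<and> finite A \<and>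
    (\<forall>u v. e = {u, v} \<longrightarrow> settled A u v)"
proof -
  have "e \<in> E'" using assms N_subset by auto
  then obtain u v where uv: "e = {u, v}" "u \<in> V" "v \<in> V" by (rule E'_edgeE)
  have "\<exists>P\<in>paths E' u v. q * path_len l P \<le> p * d u v \<and> e \<notin> edges_of P \<and> card (edges_of P \<inter> N) \<le> \<tau>"
  proof (cases "e \<in> C")
    case True
    then obtain A where "tightest_alternative E' w l \<alpha> u v A" "card (edges_of A \<inter> N) \<le> \<tau>"
      using critical_alternative uv(1) by metis
    then show ?thesis
      using uv(1) by (auto simp: tightest_alternative_def alternative_paths_def settling_iff[OF uv(2,3)])
  next
    case False
    then obtain P where P: "P \<in> paths T u v" "q * path_len l P \<le> p * d u v"
      using uv(1) \<open>e \<in> E'\<close> by (auto simp: critical_iff settled_def)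
    moreover have "edges_of P \<inter> N = {}" using pathsD(1)[OF P(1)] by (auto simp: nontrivial_edges_def)
    ultimately show ?thesis
      using T_subset assms by (intro bexI[of _ P]) (auto simp: paths_def)
  qed
  then obtain P where P: "P \<in> paths E' u v" "q * path_len l P \<le> p * d u v" "e \<notin> edges_of P"
    "card (edges_of P \<inter> N) \<le> \<tau>" by blast
  have "settled (edges_of P) u v"
    using P unfolding settled_def by (intro bexI[of _ P]) (auto simp: paths_def)
  then have "\<forall>x y. e = {x, y} \<longrightarrow> settled (edges_of P) x y"
    using uv(1) settled_commute by (auto simp: doubleton_eq_iff)
  then show ?thesis using P(3,4) pathsD(1)[OF P(1)] by (intro exI[of _ "edges_of P"]) auto
qed

text \<open>Outdegrees are at most \<open>t\<close>, so by averaging some \<open>y\<close> also has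
  indegree at most \<open>t\<close>. Taking \<open>y\<close> and discarding it together with its in-
  and out-neighbours costs at most \<open>2 * t + 1\<close> vertices, whence the factor in the
  hypothesis on \<open>card S\<close>.\<close>

lemma independent_subset:
  assumes "finite S" and "\<And>x. x \<in> S \<Longrightarrow> card (g x \<inter> S) \<le> t" and "\<And>x. x \<in> S \<Longrightarrow> x \<notin> g x"
    and "k * (2 * t + 1) \<le> card S"
  shows "\<exists>R\<subseteq>S. card R = k \<and> (\<forall>x\<in>R. g x \<inter> R = {})"
  using assms
proof (induction k arbitrary: S)
  case (Suc k)
  have "(\<Sum>y\<in>S. card {x \<in> S. y \<in> g x}) = (\<Sum>x\<in>S. card (g x \<inter> S))"
  proof -
    have *: "g x \<inter> S = {y \<in> S. y \<in> g x}" for x by blast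
    show ?thesis
      unfolding * card_eq_sum
      by (rule sum.swap_restrict[OF Suc.prems(1) Suc.prems(1), of "\<lambda>_ _. 1" "\<lambda>y x. y \<in> g x"])
  qed
  also have "\<dots> \<le> card S * t" using sum_bounded_above[of S "\<lambda>x. card (g x \<inter> S)" t] Suc.prems(2) by simp
  finally have *: "(\<Sum>y\<in>S. card {x \<in> S. y \<in> g x}) \<le> card S * t" .
  have "\<exists>y\<in>S. card {x \<in> S. y \<in> g x} \<le> t"
  proof (rule ccontr)
    assume "\<not> ?thesis"
    then have "(\<Sum>y\<in>S. Suc t) \<le> (\<Sum>y\<in>S. card {x \<in> S. y \<in> g x})" by (intro sum_mono) force
    moreover have "0 < card S" using Suc.prems(4) by (cases "card S") auto
    ultimately show False using * by simp
  qed
  then obtain y where y: "y \<in> S" "card {x \<in> S. y \<in> g x} \<le> t" by blast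
  define D where "D = insert y ({x \<in> S. y \<in> g x} \<union> (g y \<inter> S))"
  have "card D \<le> Suc (card ({x \<in> S. y \<in> g x} \<union> (g y \<inter> S)))"
    unfolding D_def using Suc.prems(1) by (simp add: card_insert_if)
  also have "\<dots> \<le> Suc (card {x \<in> S. y \<in> g x} + card (g y \<inter> S))" using card_Un_le by auto
  also have "\<dots> \<le> 2 * t + 1" using y Suc.prems(2)[OF y(1)] by simp
  finally have "card D \<le> 2 * t + 1" .
  moreover have "D \<subseteq> S" using y by (auto simp: D_def)
  ultimately have "k * (2 * t + 1) \<le> card (S - D)"
    using Suc.prems(1,4) by (simp add: card_Diff_subset finite_subset)
  moreover have "card (g x \<inter> (S - D)) \<le> t" if "x \<in> S - D" for x
    using Suc.prems(1,2) that card_mono[of "g x \<inter> S" "g x \<inter> (S - D)"] by (force intro: order_trans)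
  ultimately obtain R where R: "R \<subseteq> S - D" "card R = k" "\<forall>x\<in>R. g x \<inter> R = {}"
    using Suc.IH[of "S - D"] Suc.prems by auto
  have "y \<notin> R" using R by (auto simp: D_def)
  then have "card (insert y R) = Suc k" using R Suc.prems(1) by (simp add: finite_subset)
  moreover have "g x \<inter> insert y R = {}" if "x \<in> insert y R" for x
    using that R y Suc.prems(3)[OF y(1)] by (auto simp: D_def)
  moreover have "insert y R \<subseteq> S" using R y by auto
  ultimately show ?case by blast
qed auto

text \<open>The paths assigned to the members of an independent set \<open>R\<close> may run through
  other edges of \<open>S\<close>, but they avoid \<open>R\<close>. Hence they all survive when
  \<open>R\<close> is removed as a whole.\<close>

lemma large_set_removable:
  assumes S: "S \<subseteq> N" and card: "k * (2 * \<tau> + 1) \<le> card S"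
  shows "\<exists>R\<subseteq>S. removable R \<and> card R = k"
proof -
  have "\<forall>e\<in>N. \<exists>A. card (A \<inter> N) \<le> \<tau> \<and> e \<notin> A \<and> A \<subseteq> E' \<and> finite A \<and>
      (\<forall>u v. e = {u, v} \<longrightarrow> settled A u v)"
    using nontrivial_alternative by blast
  from bchoice[OF this] obtain A where A: "\<forall>e\<in>N. card (A e \<inter> N) \<le> \<tau> \<and> e \<notin> A e \<and>
      A e \<subseteq> E' \<and> finite (A e) \<and> (\<forall>u v. e = {u, v} \<longrightarrow> settled (A e) u v)" ..
  have "card (A e \<inter> S) \<le> \<tau>" if "e \<in> S" for e
  proof -
    have "A e \<inter> S \<subseteq> A e \<inter> N" using S by blast
    then have "card (A e \<inter> S) \<le> card (A e \<inter> N)" using finite_N by (intro card_mono) auto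
    then show ?thesis using A that S by (meson order_trans subsetD)
  qed
  moreover have "finite S" using S finite_N by (rule finite_subset)
  ultimately obtain R where R: "R \<subseteq> S" "card R = k" "\<forall>x\<in>R. A x \<inter> R = {}"
    using independent_subset[of S A \<tau> k] card A S by blast
  have "removable R"
    unfolding removable_def
  proof (intro conjI allI impI)
    fix u v assume uv: "{u, v} \<in> R"
    then have uvN: "{u, v} \<in> N" using R S by auto
    then have "settled (A {u, v}) u v" using A by blast
    then show "settled (E' - R) u v"
      by (rule settled_mono) (use A uvN R(3) uv in blast)
  qed (use R S in auto)
  then show ?thesis using R by blast
qed

lemma card_le_weight: "R \<subseteq> N \<Longrightarrow> card R \<le> sum w R"
  using sum_mono[of R "\<lambda>_. 1" w] N_weight by auto

end

section \<open>Reasoning about word RAM programs\<close>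

lemma fits_mono: "fits B s e \<Longrightarrow> B \<le> B' \<Longrightarrow> fits B' s e"
  by (induction e) auto

lemma fits_val_less: "fits B s e \<Longrightarrow> val s e < B"
  by (cases e) auto

lemma exec_mono:
  assumes "exec B c s t s'" and "B \<le> B'"
  shows "exec B' c s t s'"
  using assms by (induction rule: exec.induct) (blast intro: exec.intros fits_mono)+

text \<open>Needed for \<open>Call\<close>: the cells copied back are bounded by the word bound of
  the subroutine's own run.\<close>

lemma exec_cells_less:
  assumes "exec B c s t s'" and "\<And>a i. s a i < B"
  shows "s' a0 i0 < B"
  using assms
proof (induction arbitrary: a0 i0 rule: exec.induct)
  case (Assign s i e a)
  then show ?case using fits_val_less[of B s e] by auto
next
  case (Call s k j p a t s' b)
  have "load (map (s a) [0..<val s k]) a' i' < B" for a' i'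
    using Call.prems by (auto simp: load_def intro: le_less_trans[OF le0])
  then have "s' 1 i' < B" for i' using Call.IH by blast
  then show ?case using Call.prems by auto
qed auto

text \<open>An assignment changes one cell and a \<open>Call\<close> is charged for every cell it
  copies. This gives a lower bound on the running time of any program that has to produce many
  nonzero outputs.\<close>

lemma exec_writes:
  assumes "exec B c s t s'"
  shows "\<exists>A. finite A \<and> card A \<le> t \<and> (\<forall>i. i \<notin> A \<longrightarrow> s' b i = s b i)"
  using assms
proof (induction rule: exec.induct)
  case (Skip s)
  show ?case by (intro exI[of _ "{}"]) simp
next
  case (Assign s i e a)
  show ?case by (intro exI[of _ "{val s i}"]) simp
next
  case (Seq c1 s t1 s' c2 t2 s'')
  then obtain A1 A2 where "finite A1" "card A1 \<le> t1" "\<forall>i. i \<notin> A1 \<longrightarrow> s' b i = s b i"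
    "finite A2" "card A2 \<le> t2" "\<forall>i. i \<notin> A2 \<longrightarrow> s'' b i = s' b i" by blast
  then show ?case
    using card_Un_le[of A1 A2] by (intro exI[of _ "A1 \<union> A2"]) simp
next
  case (WhileTrue s e c t1 s' t2 s'')
  then obtain A1 A2 where "finite A1" "card A1 \<le> t1" "\<forall>i. i \<notin> A1 \<longrightarrow> s' b i = s b i"
    "finite A2" "card A2 \<le> t2" "\<forall>i. i \<notin> A2 \<longrightarrow> s'' b i = s' b i" by blast
  then show ?case
    using card_Un_le[of A1 A2] by (intro exI[of _ "A1 \<union> A2"]) simp
next
  case (CondTrue s e c1 t s' c2)
  then show ?case by (meson trans_le_add2)
next
  case (CondFalse s e c2 t s' c1)
  then show ?case by (meson trans_le_add2)
next
  case (WhileFalse s e c)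
  show ?case by (intro exI[of _ "{}"]) simp
next
  case (Call s k j p a t s' b')
  show ?case by (intro exI[of _ "{..<val s j}"]) simp
qed

text \<open>An exponent: if all cells are at most \<open>L \<ge> 2\<close>, the value of
  \<open>e\<close> is at most \<open>L ^ deg e\<close>. A constant \<open>k\<close> has degree
  \<open>k\<close> because \<open>k \<le> 2 ^ k\<close>; the extra 1 at an operator pays for the
  factor 2 of a sum.\<close>

fun deg :: "expr \<Rightarrow> nat" where
  "deg (Const k) = k"
| "deg (Read a e) = Suc (deg e)"
| "deg (Op f e1 e2) = Suc (deg e1 + deg e2)"

lemma val_le_deg:
  assumes L: "2 \<le> L" and s: "\<And>a i. s a i \<le> L"
  shows "val s e \<le> L ^ deg e"
proof (induction e)
  case (Const k)
  have "k \<le> 2 ^ k" by (simp add: less_imp_le)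
  also have "\<dots> \<le> L ^ k" using L by (simp add: power_mono)
  finally show ?case by simp
next
  case (Read a e)
  have "s a (val s e) \<le> L ^ 1" using s by simp
  also have "\<dots> \<le> L ^ Suc (deg e)" using L by (intro power_increasing) auto
  finally show ?case by simp
next
  case (Op f e1 e2)
  let ?a = "L ^ deg e1" and ?b = "L ^ deg e2"
  have ab: "1 \<le> ?a" "1 \<le> ?b" using L by auto
  have "?a * ?b \<le> L ^ deg (Op f e1 e2)" using L by (simp add: power_add)
  moreover have "?a + ?b \<le> L ^ deg (Op f e1 e2)"
  proof -
    have "?b \<le> ?a * ?b" "?a \<le> ?a * ?b" using ab by simp_all
    then have "?a + ?b \<le> 2 * (?a * ?b)" by linarith
    also have "\<dots> \<le> L * (?a * ?b)" using L by simp
    finally show ?thesis by (simp add: power_add)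
  qed
  moreover have "val s e1 * val s e2 \<le> ?a * ?b" using Op by (intro mult_mono) auto
  moreover have "val s e1 div val s e2 \<le> ?a" using Op.IH(1) div_le_dividend order_trans by blast
  ultimately show ?case
    using Op ab by (cases f) (auto simp del: deg.simps)
qed

text \<open>Subexpressions have no larger degree, so the same power of \<open>L\<close> bounds all
  intermediate values and addresses.\<close>

lemma fits_deg:
  assumes L: "2 \<le> L" and s: "\<And>a i. s a i \<le> L" and "L ^ k < B" and "deg e \<le> k"
  shows "fits B s e"
  using assms(4)
proof (induction e)
  have *: "val s e < B" if "deg e \<le> k" for e :: expr
    using val_le_deg[of L s e, OF L s] power_increasing[OF that, of L] L \<open>L ^ k < B\<close> by linarith
  {
    case (Const c)
    then show ?case using *[of "Const c"] by simp
  next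
    case (Read a e)
    then show ?case using *[of "Read a e"] by simp
  next
    case (Op f e1 e2)
    then show ?case using *[of "Op f e1 e2"] by simp
  }
qed

section \<open>Program notation and postconditions with running times\<close>

abbreviation "Var x \<equiv> Read x (Const 0)"
abbreviation AddE (infixl "+:" 65) where "a +: b \<equiv> Op Plus a b"
abbreviation SubE (infixl "-:" 65) where "a -: b \<equiv> Op Minus a b"
abbreviation MulE (infixl "*:" 70) where "a *: b \<equiv> Op Times a b"
abbreviation LessE (infix "<:" 64) where "a <: b \<equiv> Op Less a b"
abbreviation SeqC (infixr ";;" 55) where "a ;; b \<equiv> Seq a b"
abbreviation AssignC ("_[_] ::= _" [65, 0, 61] 60) where "a[i] ::= e \<equiv> Assign a i e"
abbreviation SetC (infix ":==" 60) where "a :== e \<equiv> Assign a (Const 0) e"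

definition For :: "nat \<Rightarrow> expr \<Rightarrow> com \<Rightarrow> com" where
  "For x N c = (x :== Const 0 ;; While (Var x <: N) (c ;; x :== Var x +: Const 1))"

abbreviation upd :: "memory \<Rightarrow> nat \<Rightarrow> nat \<Rightarrow> nat \<Rightarrow> memory" where
  "upd s a i v \<equiv> s(a := (s a)(i := v))"

text \<open>Stored cells stay at most \<open>L\<close>, while values during the evaluation of an
  expression may reach \<open>L ^ 300\<close>; the exponent exceeds the degree of every expression
  that the programs use. Being polynomial in \<open>L\<close>, this costs only a constant factor in
  word length.\<close>

locale ram =
  fixes L B :: nat
  assumes L2: "2 \<le> L" and LB: "L ^ 300 < B"
begin

definition ok :: "memory \<Rightarrow> bool" where
  "ok s \<longleftrightarrow> (\<forall>a i. s a i \<le> L)"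

text \<open>Total correctness: the existence of a run includes that no value breaks the word bound.
  The running time is an argument of the postcondition, so that sequencing adds times.\<close>

definition wp :: "com \<Rightarrow> (nat \<Rightarrow> memory \<Rightarrow> bool) \<Rightarrow> memory \<Rightarrow> bool" where
  "wp c Q s \<longleftrightarrow> (\<exists>t s'. exec B c s t s' \<and> ok s' \<and> Q t s')"

lemma okD: "ok s \<Longrightarrow> s a i \<le> L"
  by (simp add: ok_def)

lemma ok_upd: "ok s \<Longrightarrow> v \<le> L \<Longrightarrow> ok (upd s a i v)"
  by (simp add: ok_def)

lemma ok_fits: "ok s \<Longrightarrow> deg e \<le> 300 \<Longrightarrow> fits B s e"
  using fits_deg[OF L2 _ LB] by (simp add: ok_def)

lemma wp_mono:
  assumes "wp c Q s" and "\<And>t s'. ok s' \<Longrightarrow> Q t s' \<Longrightarrow> Q' t s'"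
  shows "wp c Q' s"
  using assms unfolding wp_def by blast

lemma wp_Assign:
  assumes "ok s" "deg i \<le> 300" "deg e \<le> 300" "val s e \<le> L"
    and "Q (1 + cost i + cost e) (upd s a (val s i) (val s e))"
  shows "wp (Assign a i e) Q s"
  unfolding wp_def using assms exec.Assign[of B s i e a] ok_upd ok_fits by blast

lemma wp_Assign_val:
  assumes "ok s" "deg i \<le> 300" "deg e \<le> 300" "val s i = k" "val s e = v" "v \<le> L"
    and "ok (upd s a k v) \<Longrightarrow> Q (1 + cost i + cost e) (upd s a k v)"
  shows "wp (Assign a i e) Q s"
  using assms by (intro wp_Assign) (auto simp: ok_upd)

lemma wp_Seq:
  assumes "wp c1 (\<lambda>t1. wp c2 (\<lambda>t2. Q (t1 + t2))) s"
  shows "wp (Seq c1 c2) Q s"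
  using assms unfolding wp_def by (blast intro: exec.Seq)

lemma wp_While:
  assumes "I s" "ok s" "deg e \<le> 300"
    and step: "\<And>s. I s \<Longrightarrow> ok s \<Longrightarrow> val s e \<noteq> 0 \<Longrightarrow> wp c (\<lambda>t s'. t \<le> T \<and> I s' \<and> \<mu> s' < (\<mu> s :: nat)) s"
  shows "wp (While e c) (\<lambda>t s'. t \<le> (\<mu> s + 1) * (T + 1 + cost e) \<and> I s' \<and> val s' e = 0) s"
  using assms(1,2)
proof (induction "\<mu> s" arbitrary: s rule: less_induct)
  case less
  have fits: "fits B s e" using less.prems assms(3) by (intro ok_fits)
  show ?case
  proof (cases "val s e = 0")
    case True
    have "exec B (While e c) s (1 + cost e) s" using fits True by (rule exec.WhileFalse)
    then show ?thesis unfolding wp_def using True less.prems by fastforce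
  next
    case False
    then obtain t s' where 1: "exec B c s t s'" "ok s'" "t \<le> T" "I s'" "\<mu> s' < \<mu> s"
      using step less.prems unfolding wp_def by blast
    then obtain t' s'' where 2: "exec B (While e c) s' t' s''" "ok s''"
      "t' \<le> (\<mu> s' + 1) * (T + 1 + cost e)" "I s''" "val s'' e = 0"
      using less.hyps unfolding wp_def by blast
    have "exec B (While e c) s (1 + cost e + t + t') s''"
      using fits False 1(1) 2(1) by (rule exec.WhileTrue)
    moreover have "(\<mu> s' + 1) * (T + 1 + cost e) \<le> \<mu> s * (T + 1 + cost e)"
      using 1(5) by (intro mult_le_mono1) simp
    then have "1 + cost e + t + t' \<le> (\<mu> s + 1) * (T + 1 + cost e)"
      using 1(3) 2(3) by simp
    ultimately show ?thesis unfolding wp_def using 2 by blast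
  qed
qed

text \<open>The counter is itself a memory cell, so the invariant is required again after its
  increment. The limit \<open>N\<close> is evaluated anew in each round and must therefore keep its
  value \<open>k\<close>.\<close>

lemma wp_For:
  assumes "ok s" "deg N \<le> 200" "k \<le> L"
    and init: "I 0 (upd s x 0 0)"
    and N: "\<And>j s. I j s \<Longrightarrow> val s N = k"
    and step: "\<And>j s. j < k \<Longrightarrow> ok s \<Longrightarrow> I j s \<Longrightarrow> s x 0 = j \<Longrightarrow>
      wp c (\<lambda>t s'. t \<le> T \<and> s' x 0 = j \<and> I (Suc j) (upd s' x 0 (Suc j))) s"
    and post: "\<And>t s'. ok s' \<Longrightarrow> I k s' \<Longrightarrow> t \<le> (k + 1) * (T + cost N + 20) \<Longrightarrow> Q t s'"
  shows "wp (For x N c) Q s"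
proof -
  define J where "J s \<longleftrightarrow> s x 0 \<le> k \<and> I (s x 0) s" for s
  let ?s = "upd s x 0 0"
  have okj: "Suc j \<le> L" if "j < k" for j using that assms(3) by simp
  have "wp (While (Var x <: N) (c ;; x :== Var x +: Const 1))
      (\<lambda>t s'. t \<le> (k - ?s x 0 + 1) * (T + 6 + 1 + cost (Var x <: N)) \<and> J s' \<and> val s' (Var x <: N) = 0) ?s"
  proof (rule wp_While)
    show "J ?s" using init by (simp add: J_def)
    show "ok ?s" using assms(1) by (simp add: ok_upd)
    show "deg (Var x <: N) \<le> 300" using assms(2) by simp
    fix s' assume J: "J s'" and "ok s'" and nz: "val s' (Var x <: N) \<noteq> 0"
    have lt: "s' x 0 < k" using nz N J by (auto simp: J_def split: if_splits)
    have "wp c (\<lambda>t s''. t \<le> T \<and> s'' x 0 = s' x 0 \<and> I (Suc (s' x 0)) (upd s'' x 0 (Suc (s' x 0)))) s'"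
      using step lt \<open>ok s'\<close> J by (simp add: J_def)
    then show "wp (c ;; x :== Var x +: Const 1)
        (\<lambda>t s''. t \<le> T + 6 \<and> J s'' \<and> k - s'' x 0 < k - s' x 0) s'"
      by (intro wp_Seq, elim wp_mono) (use lt okj[OF lt] in \<open>auto intro!: wp_Assign simp: J_def diff_less_mono2\<close>)
  qed
  moreover have "I k s'" if "J s'" "val s' (Var x <: N) = 0" for s'
    using that N[of "s' x 0" s'] by (auto simp: J_def split: if_splits)
  ultimately show ?thesis
    unfolding For_def using assms(1)
    by (intro wp_Seq wp_Assign) (auto elim!: wp_mono intro!: post simp: algebra_simps)
qed

text \<open>The subroutine has a run within its own word bound \<open>B'\<close>. Because of
  \<open>B' \<le> L\<close> its outputs are admissible cells of the caller again, which the larger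
  bound \<open>B\<close> would not guarantee.\<close>

lemma wp_Call:
  assumes "ok s" "deg k \<le> 300" "deg j \<le> 300"
    and ex: "exec B' p (load (map (s a) [0..<val s k])) t s'" and B': "B' \<le> L"
    and le: "\<And>i. i < val s k \<Longrightarrow> s a i < B'" "0 < B'"
    and Q: "\<And>out. ok (s(b := out)) \<Longrightarrow> (\<And>i. i < val s j \<Longrightarrow> out i = s' 1 i) \<Longrightarrow>
      Q (1 + cost k + cost j + val s k + val s j + t) (s(b := out))"
  shows "wp (Call p a k b j) Q s"
proof -
  have "L \<le> L ^ 300" using L2 by (simp add: self_le_power)
  then have "B' \<le> B" using B' LB by linarith
  then have "exec B p (load (map (s a) [0..<val s k])) t s'" using exec_mono ex by blast
  then have "exec B (Call p a k b j) s (1 + cost k + cost j + val s k + val s j + t)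
      (s(b := (\<lambda>i. if i < val s j then s' 1 i else s b i)))"
    using assms by (intro exec.Call ok_fits)
  moreover have "s' 1 i < B'" for i
    using le by (intro exec_cells_less[OF ex]) (auto simp: load_def)
  then have "s' 1 i \<le> L" for i using B' by (meson less_imp_le order_trans)
  then have "ok (s(b := (\<lambda>i. if i < val s j then s' 1 i else s b i)))"
    using assms(1) by (simp add: ok_def)
  moreover from this have "Q (1 + cost k + cost j + val s k + val s j + t)
      (s(b := (\<lambda>i. if i < val s j then s' 1 i else s b i)))"
    by (rule Q) simp
  ultimately show ?thesis unfolding wp_def by blast
qed

end

section \<open>Instances and their encodings\<close>

lemma length_concat_blocks:
  assumes "\<And>x. length (f x) = k"
  shows "length (concat (map f xs)) = k * length xs"
  using assms by (induction xs) simp_all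

lemma nth_concat_blocks:
  assumes "\<And>x. length (f x) = k" and "i < length xs" and "j < k"
  shows "concat (map f xs) ! (k * i + j) = f (xs ! i) ! j"
  using assms(2)
proof (induction xs arbitrary: i)
  case (Cons x xs)
  then show ?case
    using assms(1,3) by (cases i) (auto simp: nth_append)
qed simp

lemma map_upt_eq_concat_blocks:
  assumes "\<And>x. length (f x) = k" and "\<And>i j. i < length xs \<Longrightarrow> j < k \<Longrightarrow> g (a + k * i + j) = f (xs ! i) ! j"
  shows "map g [a..<a + k * length xs] = concat (map f xs)"
proof (rule nth_equalityI)
  show "length (map g [a..<a + k * length xs]) = length (concat (map f xs))"
    by (simp add: length_concat_blocks[OF assms(1)])
  fix r assume "r < length (map g [a..<a + k * length xs])"
  then have r: "r < k * length xs" by simp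
  then have k: "0 < k" by (cases k) auto
  then have "r div k < length xs" "r mod k < k"
    using r by (simp_all add: div_less_iff_less_mult mult.commute)
  then show "map g [a..<a + k * length xs] ! r = concat (map f xs) ! r"
    using assms(2)[of "r div k" "r mod k"] nth_concat_blocks[OF assms(1), of "r div k" xs "r mod k"] r
    by (simp add: add.assoc)
qed

lemma sum_list_map_nth: "sum_list (map f xs) = (\<Sum>i<length xs. f (xs ! i))"
  by (simp add: sum_list_sum_nth lessThan_atLeast0)

lemma sum_list_concat: "sum_list (concat (map f xs)) = (\<Sum>i<length xs. sum_list (f (xs ! i)))"
proof -
  have "sum_list (concat (map f xs)) = sum_list (map (\<lambda>x. sum_list (f x)) xs)"
    by (induction xs) simp_all
  then show ?thesis by (simp add: sum_list_map_nth)
qed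

locale spanner_input =
  fixes I :: spanner_inst
  assumes instance_I: "I \<in> spanner_instances"
begin

abbreviation "n \<equiv> nodes I"
abbreviation "m \<equiv> num_edges I"
abbreviation "num \<equiv> stretch_num I"
abbreviation "den \<equiv> stretch_den I"
abbreviation "W \<equiv> removed_weight I"

definition eu :: "nat \<Rightarrow> nat" where "eu i = fst (edge_list I ! i)"
definition ev :: "nat \<Rightarrow> nat" where "ev i = snd (edge_list I ! i)"
definition e :: "nat \<Rightarrow> nat set" where "e i = {eu i, ev i}"

lemma e_eq: "e i = to_edge (edge_list I ! i)"
  by (simp add: e_def eu_def ev_def)

lemma valid: "valid_graph I"
  using instance_I by (simp add: spanner_instances_def)

sublocale stretched_graph "verts I" "edges I" "len I" "weight I" num den
proof
  have "0 < den" "1 \<le> real num / real den"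
    using instance_I by (auto simp: spanner_instances_def stretch_def)
  then show "den \<le> num" by (simp add: field_simps)
qed (use instance_I valid in \<open>auto simp: spanner_instances_def valid_graph_def\<close>)

lemma stretch_eq: "stretch I = \<alpha>"
  by (simp add: stretch_def)

lemma edges_eq: "edges I = e ` {..<m}"
proof -
  have "set (edge_list I) = (\<lambda>i. edge_list I ! i) ` {..<m}"
    unfolding set_conv_nth by blast
  then show ?thesis by (simp add: edges_def e_eq[abs_def] image_image)
qed

lemma inj_e: "inj_on e {..<m}"
  using valid by (auto simp: valid_graph_def distinct_conv_nth inj_on_def e_eq)

lemma e_in: "i < m \<Longrightarrow> e i \<in> edges I"
  by (simp add: edges_eq)

lemma endpoints: "i < m \<Longrightarrow> eu i < n" "i < m \<Longrightarrow> ev i < n" "i < m \<Longrightarrow> eu i \<noteq> ev i"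
  using edgeD[of "eu i" "ev i"] e_in[of i] by (auto simp: e_def verts_def)

lemma endpoints_verts: "i < m \<Longrightarrow> eu i \<in> verts I" "i < m \<Longrightarrow> ev i \<in> verts I"
  using endpoints by (auto simp: verts_def)

lemma sum_edges: "X \<subseteq> edges I \<Longrightarrow> sum f X = (\<Sum>i<m. of_bool (e i \<in> X) * (f (e i) :: nat))"
proof -
  assume X: "X \<subseteq> edges I"
  then have "X = e ` {i \<in> {..<m}. e i \<in> X}" by (auto simp: edges_eq)
  then have "sum f X = (\<Sum>i | i \<in> {..<m} \<and> e i \<in> X. f (e i))"
    using sum.reindex[of e "{i \<in> {..<m}. e i \<in> X}" f] inj_on_subset[OF inj_e]
    by (metis (no_types, lifting) comp_apply mem_Collect_eq subsetI sum.cong)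
  also have "\<dots> = (\<Sum>i<m. of_bool (e i \<in> X) * f (e i))"
    by (simp only: sum.inter_filter[OF finite_lessThan]) (intro sum.cong, auto)
  finally show ?thesis .
qed

section \<open>Variants of the input graph with blocked edges\<close>

definition S :: nat where "S = (\<Sum>i<m. len I (e i))"
text \<open>Distances are at most \<open>S\<close>, so one edge of this additional length already
  excludes settling, whatever the denominator: \<open>den * big > num * S\<close>.\<close>

definition big :: nat where "big = num * S + 1"

text \<open>Blocking edges by making them long, rather than deleting them, keeps the number of edges
  and connectedness; nothing is known about the running times on other graph sizes.\<close>

definition variant :: "nat set set \<Rightarrow> wgraph" where
  "variant X = \<lparr>nodes = n, edge_list = edge_list I,
     len = (\<lambda>x. len I x + of_bool (x \<in> X) * big)\<rparr>"

lemma variant_simps [simp]: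
  "nodes (variant X) = n" "edge_list (variant X) = edge_list I"
  "verts (variant X) = verts I" "edges (variant X) = edges I"
  "len (variant X) x = len I x + of_bool (x \<in> X) * big"
  by (simp_all add: variant_def verts_def edges_def)

lemma len_variant_empty [simp]: "len (variant {}) = len I"
  by (rule ext) simp

lemma valid_variant: "valid_graph (variant X)"
  using valid by (simp add: valid_graph_def trans_le_add1)

lemma S_eq: "S = sum (len I) (edges I)"
  by (auto simp: S_def sum_edges edges_eq intro!: sum.cong)

lemma d_le_S:
  assumes "u \<in> verts I" "v \<in> verts I"
  shows "d u v \<le> S"
proof -
  obtain P where "P \<in> paths E' u v" "path_len (len I) P = d u v"
    using shortest_pathE[OF assms] .
  then show ?thesis
    using path_len_mono[of P "edges I" "len I"] finite_E E'_subset S_eq pathsD(1)[of P E' u v] by auto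
qed

lemma path_len_variant:
  assumes "edges_of P \<inter> X = {}"
  shows "path_len (len (variant X)) P = path_len (len I) P"
  unfolding path_len_def using assms by (intro sum.cong) auto

lemma variant_settled:
  assumes uv: "u \<in> verts I" "v \<in> verts I"
  shows "den * gdist (edges I) (len (variant X)) u v \<le> num * d u v \<longleftrightarrow> settled (edges I - X) u v"
    (is "?L \<longleftrightarrow> ?R")
proof
  assume L: ?L
  obtain P where P: "P \<in> paths (edges I) u v"
    "path_len (len (variant X)) P = gdist (edges I) (len (variant X)) u v"
    using gdist_attained[OF paths_ne[OF uv]] .
  have "edges_of P \<inter> X = {}"
  proof (rule ccontr)
    assume "edges_of P \<inter> X \<noteq> {}"
    then obtain x where x: "x \<in> edges_of P" "x \<in> X" by blast
    have "len (variant X) x \<le> path_len (len (variant X)) P"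
      unfolding path_len_def using x by (intro member_le_sum) auto
    then have "big \<le> path_len (len (variant X)) P" using x by simp
    then have "num * S + 1 \<le> 1 * path_len (len (variant X)) P" by (simp add: big_def)
    also have "\<dots> \<le> den * path_len (len (variant X)) P" using q_pos by (intro mult_le_mono1) simp
    also have "\<dots> \<le> num * d u v" using L P by simp
    also have "\<dots> \<le> num * S" using d_le_S[OF uv] by simp
    finally show False by simp
  qed
  then show ?R
    using P L path_len_variant[of P X] unfolding settled_def
    by (intro bexI[of _ P]) (auto simp: paths_def)
next
  assume ?R
  then obtain P where P: "P \<in> paths (edges I - X) u v" "den * path_len (len I) P \<le> num * d u v"
    by (auto simp: settled_def)
  then have "edges_of P \<inter> X = {}" "P \<in> paths (edges I) u v" by (auto simp: paths_def)
  then have "gdist (edges I) (len (variant X)) u v \<le> path_len (len I) P"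
    using gdist_le path_len_variant by metis
  then show ?L using P(2) by (meson mult_le_mono2 order_trans)
qed

lemma two_shortest_gdist:
  assumes "two_shortest_paths F l u v P Q"
  shows "path_len l P = gdist F l u v"
proof (rule antisym)
  have "P \<in> paths F u v" using assms by (simp add: two_shortest_paths_def)
  then show "gdist F l u v \<le> path_len l P" by (rule gdist_le)
  obtain R where R: "R \<in> paths F u v" "path_len l R = gdist F l u v"
    using gdist_attained[of F u v l] \<open>P \<in> paths F u v\<close> by blast
  show "path_len l P \<le> gdist F l u v"
  proof (cases "R \<in> {P, Q}")
    case True
    then show ?thesis using assms R by (auto simp: two_shortest_paths_def)
  next
    case False
    then have "path_len l P \<le> path_len l Q" "path_len l Q \<le> path_len l R"
      using assms R(1) by (auto simp: two_shortest_paths_def)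
    then show ?thesis using R(2) by simp
  qed
qed

lemma apsp2_gdist:
  assumes "apsp2_answer (variant X) out" "u \<in> verts I" "v \<in> verts I" "u \<noteq> v"
  shows "out (2 * (u * n + v)) = gdist (edges I) (len (variant X)) u v"
proof -
  have "(\<exists>P Q. two_shortest_paths (edges I) (len (variant X)) u v P Q \<and>
          out (2 * (u * n + v)) = path_len (len (variant X)) P) \<or>
        (\<exists>P. paths (edges I) u v = {P} \<and> out (2 * (u * n + v)) = path_len (len (variant X)) P)"
    using assms by (simp add: apsp2_answer_def Let_def) blast
  moreover have ?thesis
    if "paths (edges I) u v = {P} \<and> out (2 * (u * n + v)) = path_len (len (variant X)) P" for P
    using that gdist_attained[of "edges I" u v "len (variant X)"] by (metis insert_not_empty singletonD)
  ultimately show ?thesis using two_shortest_gdist by metis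
qed

text \<open>Positive lengths separate a true second length from the entry 0 for a missing second
  path, and they force an all-pairs program to write nonzero cells.\<close>

lemma path_len_pos:
  assumes "P \<in> paths (edges I) u v" "u \<noteq> v"
  shows "0 < path_len (len I) P"
proof -
  obtain x y zs where P: "P = x # y # zs"
    using assms by (cases P rule: remdups_adj.cases) (auto simp: paths_def)
  then have "{x, y} \<in> edges I" using pathsD(1)[OF assms(1)] by auto
  then show ?thesis
    using P pathsD(2)[OF assms(1)] path_len_Cons[of x y zs "len I"] len_pos[of "{x, y}"] by simp
qed

text \<open>The second entry of the table is the length of a shortest path other than the edge itself,
  unless the edge is strictly longer than the distance of its endpoints.\<close>

lemma apsp2_mandatory:
  assumes out: "apsp2_answer (variant {}) out" and uv: "{u, v} \<in> E'"
  defines "d2 \<equiv> out (2 * (u * n + v) + 1)"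
  shows "{u, v} \<in> mandatory E' (len I) \<alpha> \<longleftrightarrow>
    len I {u, v} \<le> d u v \<and> (d2 = 0 \<or> num * d u v < den * d2)"
proof -
  have E: "{u, v} \<in> edges I" using uv E'_subset by auto
  have V: "u \<in> verts I" "v \<in> verts I" "u \<noteq> v" using edgeD[OF E] by auto
  have uvp: "[u, v] \<in> paths (edges I) u v" using E V by (intro paths_edge)
  have settle: "den * d u v \<le> num * d u v" using q_le_p by simp
  define Alt where "Alt \<longleftrightarrow> (\<exists>P\<in>paths (edges I) u v. P \<noteq> [u, v] \<and> den * path_len (len I) P \<le> num * d u v)"
  have mand: "{u, v} \<in> mandatory E' (len I) \<alpha> \<longleftrightarrow> \<not> Alt"
    using mandatory_iff[of u v] alternative_iff[OF uv] uv unfolding Alt_def by blast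
  have "(\<exists>P Q. two_shortest_paths (edges I) (len I) u v P Q \<and> d2 = path_len (len I) Q) \<or>
        (\<exists>P. paths (edges I) u v = {P} \<and> d2 = 0)"
    using out V unfolding apsp2_answer_def Let_def d2_def len_variant_empty variant_simps by blast
  then show ?thesis
  proof (elim disjE exE conjE)
    fix P assume P: "paths (edges I) u v = {P}" "d2 = 0"
    then have "P = [u, v]" using uvp by auto
    moreover obtain Q where "Q \<in> paths (edges I) u v" "path_len (len I) Q = d u v"
      using gdist_attained[OF paths_ne[OF V(1,2)]] .
    ultimately have "len I {u, v} = d u v" using P by auto
    moreover have "\<not> Alt" using P(1) \<open>P = [u, v]\<close> by (auto simp: Alt_def)
    ultimately show ?thesis using mand P(2) by simp
  next
    fix P Q assume PQ: "two_shortest_paths (edges I) (len I) u v P Q" and d2: "d2 = path_len (len I) Q"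
    have P: "P \<in> paths (edges I) u v" "Q \<in> paths (edges I) u v" "P \<noteq> Q"
      and min: "\<And>R. R \<in> paths (edges I) u v \<Longrightarrow> R \<noteq> P \<Longrightarrow> R \<noteq> Q \<Longrightarrow> path_len (len I) Q \<le> path_len (len I) R"
      using PQ by (auto simp: two_shortest_paths_def)
    have lenP: "path_len (len I) P = d u v" using two_shortest_gdist[OF PQ] .
    have "d2 \<noteq> 0" using path_len_pos[OF P(2) V(3)] d2 by simp
    show ?thesis
    proof (cases "P = [u, v]")
      case True
      \<comment> \<open>Here the shortest path is the edge itself, so \<open>Q\<close> is a shortest
        alternative and decides alone.\<close>
      have "den * path_len (len I) Q \<le> num * d u v" if A: Alt
      proof -
        obtain R where "R \<in> paths (edges I) u v" "R \<noteq> [u, v]" "den * path_len (len I) R \<le> num * d u v"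
          using A by (auto simp: Alt_def)
        then show ?thesis using min[of R] True by (metis mult_le_mono2 order_trans)
      qed
      then have "Alt \<longleftrightarrow> den * d2 \<le> num * d u v"
        using P True d2 unfolding Alt_def by metis
      then show ?thesis using mand True lenP \<open>d2 \<noteq> 0\<close> by auto
    next
      case False
      \<comment> \<open>A shortest path other than the edge is an alternative. If the edge is a
        shortest path too, it competes for the second place, so the second length must pass the
        settling test.\<close>
      then have Alt using P(1) lenP settle unfolding Alt_def by auto
      moreover have "den * d2 \<le> num * d u v" if "len I {u, v} \<le> d u v"
      proof -
        have "d2 \<le> len I {u, v}"
          using min[OF uvp] False d2 by (cases "Q = [u, v]") auto
        then show ?thesis using that settle by (meson le_trans mult_le_mono2)
      qed
      ultimately show ?thesis using mand \<open>d2 \<noteq> 0\<close> by auto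
    qed
  qed
qed

section \<open>Layout of the input and sizes of the encodings\<close>

abbreviation "inp \<equiv> load (encode_spanner I) 0"

lemma length_encode: "length (encode_spanner I) = 5 + 4 * m"
  unfolding encode_spanner_def by (simp add: length_concat_blocks[where k = 4])

lemma inp_header: "inp 0 = n" "inp (Suc 0) = m" "inp 2 = num" "inp 3 = den" "inp 4 = W"
  by (simp_all add: load_def encode_spanner_def)

lemma inp_edge:
  assumes "i < m"
  shows "inp (5 + 4 * i) = eu i" "inp (6 + 4 * i) = ev i" "inp (7 + 4 * i) = weight I (e i)"
    "inp (8 + 4 * i) = len I (e i)"
proof -
  have *: "inp (5 + (4 * i + j)) = [eu i, ev i, weight I (e i), len I (e i)] ! j" if "j < 4" for j
  proof -
    have "4 * i + j < 4 * m" using assms that by linarith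
    moreover have "encode_spanner I ! (5 + (4 * i + j)) =
        concat (map (\<lambda>e. [fst e, snd e, weight I (to_edge e), len I (to_edge e)]) (edge_list I)) ! (4 * i + j)"
      unfolding encode_spanner_def by (subst nth_append) simp
    ultimately show ?thesis
      using nth_concat_blocks[of "\<lambda>e. [fst e, snd e, weight I (to_edge e), len I (to_edge e)]" 4 i "edge_list I" j]
        assms that by (simp add: load_def length_encode eu_def ev_def e_def)
  qed
  show "inp (5 + 4 * i) = eu i" using *[of 0] by simp
  show "inp (6 + 4 * i) = ev i" using *[of 1] by (simp add: algebra_simps)
  show "inp (7 + 4 * i) = weight I (e i)" using *[of 2] by (simp add: algebra_simps)
  show "inp (8 + 4 * i) = len I (e i)" using *[of 3] by (simp add: algebra_simps eval_nat_numeral)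
qed

definition M :: nat where "M = magnitude (encode_spanner I)"

lemma M_eq: "M = 7 + 4 * m + n + m + num + den + W + (\<Sum>i<m. eu i + ev i) + (\<Sum>i<m. weight I (e i)) + S"
proof -
  have "sum_list (encode_spanner I) = n + m + num + den + W +
      (\<Sum>i<m. eu i + ev i + weight I (e i) + len I (e i))"
    unfolding encode_spanner_def by (simp add: sum_list_concat eu_def ev_def e_def add.assoc)
  then show ?thesis
    unfolding M_def magnitude_def length_encode S_def by (simp add: sum.distrib)
qed

lemma M_ge: "7 \<le> M" "n \<le> M" "m \<le> M" "num \<le> M" "den \<le> M" "W \<le> M" "S \<le> M"
    "(\<Sum>i<m. weight I (e i)) \<le> M"
  by (simp_all add: M_eq)

lemma big_le: "big \<le> M ^ 2 + 1"
  using M_ge mult_mono[of num M S M] by (simp add: big_def power2_eq_square)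

lemma encode_variant:
  "encode_graph (variant X) = [n, m] @
     concat (map (\<lambda>x. [fst x, snd x, len I (to_edge x) + of_bool (to_edge x \<in> X) * big]) (edge_list I))"
  by (simp add: encode_graph_def)

lemma length_encode_variant: "length (encode_graph (variant X)) = 2 + 3 * m"
  by (simp add: encode_variant length_concat_blocks[where k = 3])

text \<open>The blocked lengths dominate with at most \<open>m * big\<close>, of order
  \<open>M ^ 3\<close>; the fourth power absorbs the constants. The summand \<open>2 + n + n\<close>
  leaves room for the two endpoints of a single-pair query.\<close>

lemma magnitude_variant: "magnitude (encode_graph (variant X)) + 2 + n + n \<le> M ^ 4"
proof -
  have "sum_list (encode_graph (variant X)) =
      n + m + ((\<Sum>i<m. eu i + ev i) + S + (\<Sum>i<m. of_bool (e i \<in> X) * big))"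
    unfolding encode_variant
    by (simp add: sum_list_concat sum.distrib S_def eu_def ev_def e_def del: variant_simps)
  also have "(\<Sum>i<m. of_bool (e i \<in> X) * big) \<le> (\<Sum>i<m. big)" by (intro sum_mono) auto
  also have "(\<Sum>i<m. big) = m * big" by simp
  also have "\<dots> \<le> M * (M ^ 2 + 1)" using M_ge(3) big_le by (rule mult_mono) auto
  finally have "magnitude (encode_graph (variant X)) + 2 + n + n \<le> 4 * M + M * (M ^ 2 + 1)"
    unfolding magnitude_def length_encode_variant using M_eq by linarith
  also have "\<dots> = M * (5 + M * M)" by (simp add: power2_eq_square algebra_simps)
  also have "\<dots> \<le> M * (M * (M * M))"
  proof -
    have "7 * (M * M) \<le> M * (M * M)" "49 \<le> M * M" using M_ge(1) mult_mono[of 7 M 7 M] by simp_all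
    then have "5 + M * M \<le> M * (M * M)" by linarith
    then show ?thesis by simp
  qed
  also have "\<dots> = M ^ 4" by (simp add: eval_nat_numeral)
  finally show ?thesis .
qed

lemma magnitude_spsp:
  assumes "u < n" "v < n"
  shows "magnitude (encode_spsp (variant X, u, v)) \<le> M ^ 4"
  using magnitude_variant[of X] assms by (simp add: encode_spsp_def magnitude_def)

text \<open>By connectedness every node is an endpoint, unless there is at most one. As
  \<open>n\<close> is encoded in binary, the FPT bound can afford polynomials in \<open>n\<close>
  only because the number of listed edges controls it.\<close>

lemma n_le: "n \<le> 2 * m + 1"
proof (cases "n \<le> 1")
  case False
  have "{..<n} \<subseteq> eu ` {..<m} \<union> ev ` {..<m}"
  proof
    fix v assume v: "v \<in> {..<n}"
    define u :: nat where "u = (if v = 0 then 1 else 0)"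
    have u: "u < n" "u \<noteq> v" using False by (auto simp: u_def)
    obtain P where P: "P \<in> paths (edges I) v u"
      using paths_ne[of v u] u v by (auto simp: verts_def)
    then obtain x y zs where xy: "P = x # y # zs"
      using u by (cases P rule: remdups_adj.cases) (auto simp: paths_def)
    then have "{v, y} \<in> e ` {..<m}" using P edges_eq by (auto simp: paths_def)
    then obtain i where "i < m" "{v, y} = {eu i, ev i}" by (auto simp: e_def)
    then show "v \<in> eu ` {..<m} \<union> ev ` {..<m}" by (auto simp: doubleton_eq_iff)
  qed
  then have "card {..<n} \<le> card (eu ` {..<m} \<union> ev ` {..<m})" by (intro card_mono) auto
  also have "\<dots> \<le> card (eu ` {..<m}) + card (ev ` {..<m})" by (rule card_Un_le)
  also have "\<dots> \<le> m + m" using card_image_le[of "{..<m}" eu] card_image_le[of "{..<m}" ev] by simp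
  finally show ?thesis by simp
qed simp

end

section \<open>The program\<close>

text \<open>
  Memory layout. Arrays 2 and 3 hold the graphs passed to the two subroutines, 4 and 5 the resulting
  all-pairs tables, and 13 the result of a single-pair query. Arrays 6 to 9 hold flags for the edges:
  to be removed or blocked (6), not settling themselves (7), nontrivial (8), critical (9). Array 10
  holds the distances of the endpoints, 11 the indices of the nontrivial edges, and 12 the current
  choice among the first \<open>k\<close> of them, as the digits of a number in base \<open>k\<close>.

  Scalars are stored in cell 0 of an array: loop counters (20, 27), the length added to blocked edges
  (21), the number of nontrivial edges (22), the removed weight (23), whether the flags in array 6
  form a solution (24), \<open>k\<close> (25), whether the choices for \<open>k\<close> are not yet exhausted (26), the number
  of critical edges (28), and the total length (29).
\<close>

definition edge_entry :: "nat \<Rightarrow> expr \<Rightarrow> expr" where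
  "edge_entry r i = Read 0 (Const r +: Const 4 *: i)"

definition table_entry :: "nat \<Rightarrow> nat \<Rightarrow> expr \<Rightarrow> expr" where
  "table_entry a r i =
     Read a (Const 2 *: (edge_entry 5 i *: Var 0 +: edge_entry 6 i) +: Const r)"

abbreviation "NodesE \<equiv> Read 0 (Const 0)"
abbreviation "EdgesE \<equiv> Read 0 (Const 1)"
abbreviation "NumE \<equiv> Read 0 (Const 2)"
abbreviation "DenE \<equiv> Read 0 (Const 3)"
abbreviation "TargetE \<equiv> Read 0 (Const 4)"
abbreviation "NotE b \<equiv> Const 1 -: b"

lemma val_edge_entry [simp]: "val s (edge_entry r i) = s 0 (r + 4 * val s i)"
  by (simp add: edge_entry_def)

lemma deg_edge_entry [simp]: "deg (edge_entry r i) = r + deg i + 7"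
  by (simp add: edge_entry_def)

lemma cost_edge_entry [simp]: "cost (edge_entry r i) = cost i + 5"
  by (simp add: edge_entry_def)

lemma val_table_entry [simp]: "val s (table_entry a r i) =
    s a (2 * (s 0 (5 + 4 * val s i) * s 0 0 + s 0 (6 + 4 * val s i)) + r)"
  by (simp add: table_entry_def)

lemma deg_table_entry [simp]: "deg (table_entry a r i) = 2 * deg i + r + 33"
  by (simp add: table_entry_def)

lemma cost_table_entry [simp]: "cost (table_entry a r i) = 2 * cost i + 19"
  by (simp add: table_entry_def)

definition init :: com where
  "init = For 20 EdgesE (29 :== Var 29 +: edge_entry 8 (Var 20)) ;; 21 :== NumE *: Var 29 +: Const 1"

text \<open>The offset \<open>r\<close> is 0 for all-pairs input and 2 for single-pair input, whose
  two leading cells hold the endpoints: the graph is written once per choice, and a query changes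
  only those two cells.\<close>

definition build :: "nat \<Rightarrow> nat \<Rightarrow> com" where
  "build r a =
     a[Const r] ::= NodesE ;; a[Const (Suc r)] ::= EdgesE ;;
     For 20 EdgesE
      (a[Const (r + 2) +: Const 3 *: Var 20] ::= edge_entry 5 (Var 20) ;;
       a[Const (r + 3) +: Const 3 *: Var 20] ::= edge_entry 6 (Var 20) ;;
       a[Const (r + 4) +: Const 3 *: Var 20] ::= edge_entry 8 (Var 20) +: Read 6 (Var 20) *: Var 21)"

definition apsp :: "com \<Rightarrow> nat \<Rightarrow> com" where
  "apsp p b = build 0 2 ;; Call p 2 (Const 2 +: Const 3 *: EdgesE) b (Const 2 *: (NodesE *: NodesE))"

lemma all_less_Suc: "(\<forall>i<Suc j. P i) \<longleftrightarrow> (\<forall>i<j. P i) \<and> P j"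
  by (auto simp: less_Suc_eq)

definition same :: "nat set \<Rightarrow> memory \<Rightarrow> memory \<Rightarrow> bool" where
  "same X s s' \<longleftrightarrow> (\<forall>a. a \<notin> X \<longrightarrow> s' a = s a)"

lemma same_refl [simp]: "same X s s"
  by (simp add: same_def)

lemma same_upd [simp]: "b \<in> X \<Longrightarrow> same X s (s'(b := f)) \<longleftrightarrow> same X s s'"
  by (auto simp: same_def)

text \<open>\<open>L\<close> bounds the cells of the main program and is also the word bound for the
  subroutines. One pair \<open>t1\<close>, \<open>t2\<close> serves all \<open>X\<close>, since the
  variants share \<open>n\<close> and \<open>m\<close>; both times include reading the
  input.\<close>

locale spanner_program = spanner_input I + ram L B for I L B +
  fixes p1 p2 :: com and t1 t2 :: nat
  assumes M4L: "M ^ 4 \<le> L"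
    and spsp_run: "u \<in> verts I \<Longrightarrow> v \<in> verts I \<Longrightarrow>
      \<exists>t s. exec L p1 (load (encode_spsp (variant X, u, v))) t s \<and> 4 + 3 * m + t \<le> t1 \<and>
        spsp_answer (variant X, u, v) (s 1)"
    and apsp_run: "\<exists>t s. exec L p2 (load (encode_graph (variant X))) t s \<and> 2 + 3 * m + t \<le> t2 \<and>
        apsp2_answer (variant X) (s 1)"
begin

lemma M_power_le: "k \<le> 4 \<Longrightarrow> M ^ k \<le> L"
  using order_trans[OF power_increasing[of k 4 M] M4L] M_ge(1) by simp

lemma le_L: "x \<le> M \<Longrightarrow> x \<le> L"
  using M_power_le[of 1] by simp

lemma small_le_L: "x \<le> M ^ 2 + 1 + M \<Longrightarrow> x \<le> L"
proof -
  assume "x \<le> M ^ 2 + 1 + M"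
  also have "\<dots> \<le> M ^ 3"
  proof -
    have "7 * (M * M) \<le> M * (M * M)" "7 * M \<le> M * M" using M_ge(1) by simp_all
    then have "M * M + 1 + M \<le> M * (M * M)" using M_ge(1) by linarith
    then show ?thesis by (simp add: eval_nat_numeral)
  qed
  finally show ?thesis using M_power_le[of 3] by simp
qed

lemma bool_le_L [simp]: "of_bool b \<le> L" "Suc 0 \<le> L"
  using L2 by (cases b, auto)

lemma inp_le_L [simp]: "n \<le> L" "m \<le> L" "num \<le> L" "den \<le> L" "W \<le> L" "S \<le> L"
  using M_ge by (auto intro: le_L)

lemma wp_init:
  assumes "ok s" "s 0 = inp" "s 29 0 = 0"
    and Q: "\<And>t s'. ok s' \<Longrightarrow> same {20, 21, 29} s s' \<Longrightarrow> s' 21 0 = big \<Longrightarrow> t \<le> 100 * (m + 1) \<Longrightarrow> Q t s'"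
  shows "wp init Q s"
  unfolding init_def
proof (intro wp_Seq, rule wp_For[where k = m and T = 20 and
    I = "\<lambda>j s'. same {20, 29} s s' \<and> s' 29 0 = (\<Sum>i<j. len I (e i))"])
  show "same {20, 29} s (upd s 20 0 0) \<and> upd s 20 0 0 29 0 = (\<Sum>i<0. len I (e i))"
    using assms by simp
next
  fix j s' assume "same {20, 29} s s' \<and> s' 29 0 = (\<Sum>i<j. len I (e i))"
  then show "val s' EdgesE = m" using assms(2) by (simp add: inp_header same_def)
next
  fix j s' assume j: "j < m" and ok: "ok s'" and s': "s' 20 0 = j"
    and I: "same {20, 29} s s' \<and> s' 29 0 = (\<Sum>i<j. len I (e i))"
  have "(\<Sum>i<Suc j. len I (e i)) \<le> S" unfolding S_def using j by (intro sum_mono2) auto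
  then have "(\<Sum>i<Suc j. len I (e i)) \<le> L" using M_ge by (intro le_L) linarith
  moreover have "s' 0 = inp" using I assms(2) by (simp add: same_def)
  ultimately show "wp (29 :== Var 29 +: edge_entry 8 (Var 20))
      (\<lambda>t s'. t \<le> 20 \<and> s' 20 0 = j \<and> same {20, 29} s (upd s' 20 0 (Suc j)) \<and>
        upd s' 20 0 (Suc j) 29 0 = (\<Sum>i<Suc j. len I (e i))) s'"
    using I j s' by (intro wp_Assign) (simp_all add: ok inp_edge)
next
  fix t s' assume ok: "ok s'" and I: "same {20, 29} s s' \<and> s' 29 0 = (\<Sum>i<m. len I (e i))"
    and t: "t \<le> (m + 1) * (20 + cost EdgesE + 20)"
  have s': "s' 0 = inp" "s' 29 0 = S" using I assms(2) by (simp_all add: same_def S_def)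
  have "same {20, 21, 29} s s'" using I by (auto simp: same_def)
  moreover have "big \<le> L" using big_le by (intro small_le_L) simp
  ultimately show "wp (21 :== NumE *: Var 29 +: Const 1) (\<lambda>t2. Q (t + t2)) s'"
    using t by (intro wp_Assign Q) (simp_all add: ok s' inp_header big_def ok_upd)
qed (use assms(1) in simp_all)

lemma wp_build:
  assumes "ok s" "s 0 = inp" "s 21 0 = big" "\<And>i. i < m \<Longrightarrow> s 6 i = of_bool (e i \<in> X)"
    and r: "r \<le> 2" and a: "a \<notin> {0, 6, 20, 21}"
    and Q: "\<And>t s'. ok s' \<Longrightarrow> same {a, 20} s s' \<Longrightarrow>
      map (s' a) [r..<r + 2 + 3 * m] = encode_graph (variant X) \<Longrightarrow> t \<le> 200 * (m + 1) \<Longrightarrow> Q t s'"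
  shows "wp (build r a) Q s"
  unfolding build_def
proof (intro wp_Seq wp_Assign)
  let ?s = "upd (upd s a (val s (Const r)) (val s NodesE)) a (val (upd s a (val s (Const r)) (val s NodesE)) (Const (Suc r)))
     (val (upd s a (val s (Const r)) (val s NodesE)) EdgesE)"
  define A where "A j s' \<longleftrightarrow> (\<forall>i<j. s' a (r + 2 + 3 * i) = eu i \<and> s' a (r + 3 + 3 * i) = ev i \<and>
    s' a (r + 4 + 3 * i) = len I (e i) + of_bool (e i \<in> X) * big)" for j and s' :: memory
  let ?I = "\<lambda>j s'. same {a, 20} s s' \<and> s' a r = n \<and> s' a (Suc r) = m \<and> A j s'"
  show "wp (For 20 EdgesE
      (a[Const (r + 2) +: Const 3 *: Var 20] ::= edge_entry 5 (Var 20) ;;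
       a[Const (r + 3) +: Const 3 *: Var 20] ::= edge_entry 6 (Var 20) ;;
       a[Const (r + 4) +: Const 3 *: Var 20] ::= edge_entry 8 (Var 20) +: Read 6 (Var 20) *: Var 21))
     (\<lambda>t2a. Q (1 + cost (Const r) + cost NodesE + (1 + cost (Const (Suc r)) + cost EdgesE + t2a))) ?s"
  proof (rule wp_For[where k = m and T = 100 and I = ?I])
    show "ok ?s" using assms(1,2) a by (simp add: ok_def inp_header)
    show "?I 0 (upd ?s 20 0 0)" using assms(2) a by (simp add: inp_header A_def)
    show "val s' EdgesE = m" if "?I j s'" for j s'
      using that a assms(2) by (simp add: inp_header same_def)
    show "deg EdgesE \<le> 200" "m \<le> L" by simp_all
    show "Q (1 + cost (Const r) + cost NodesE + (1 + cost (Const (Suc r)) + cost EdgesE + t)) s'"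
      if ok: "ok s'" and I: "?I m s'" and t: "t \<le> (m + 1) * (100 + cost EdgesE + 20)" for t s'
    proof (rule Q[OF ok])
      have "map (s' a) [r + 2..<(r + 2) + 3 * length (edge_list I)] =
        concat (map (\<lambda>x. [fst x, snd x, len I (to_edge x) + of_bool (to_edge x \<in> X) * big]) (edge_list I))"
      proof (rule map_upt_eq_concat_blocks)
        fix i j :: nat assume "i < m" "j < 3"
        then consider "j = 0" | "j = 1" | "j = 2" by linarith
        then show "s' a (r + 2 + 3 * i + j) = [fst (edge_list I ! i), snd (edge_list I ! i),
          len I (to_edge (edge_list I ! i)) + of_bool (to_edge (edge_list I ! i) \<in> X) * big] ! j"
          using I \<open>i < m\<close> by cases (auto simp: A_def eu_def ev_def e_def eval_nat_numeral)
      qed simp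
      moreover have "[r..<r + 2 + 3 * m] = r # Suc r # [r + 2..<r + 2 + 3 * m]"
        by (subst upt_conv_Cons, simp, subst upt_conv_Cons, simp_all)
      ultimately show "map (s' a) [r..<r + 2 + 3 * m] = encode_graph (variant X)"
        using I by (simp only: encode_variant list.map append.simps)
    qed (use I t in simp_all)
    fix j s' assume j: "j < m" and ok: "ok s'" and s'20: "s' 20 0 = j" and I: "?I j s'"
    have s': "s' 0 = inp" "s' 21 0 = big" "s' 6 j = of_bool (e j \<in> X)"
      using I a assms(2-4) j by (simp_all add: same_def)
    have ln: "len I (e j) \<le> S" unfolding S_def using j by (intro member_le_sum) auto
    have le1: "len I (e j) + of_bool (e j \<in> X) * big \<le> L"
      using ln M_ge big_le by (intro small_le_L) (auto simp: of_bool_def)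
    have le2: "eu j \<le> L" "ev j \<le> L"
      using endpoints[OF j] M_ge(2) by (auto intro!: le_L)
    \<comment> \<open>The three fields of a block lie in different residue classes modulo 3, so
      writing one of them never hits another field of any block.\<close>
    have ne: "Suc (3 * i) \<noteq> 3 * j" "Suc (Suc (3 * i)) \<noteq> 3 * j" "3 * j \<noteq> Suc (3 * i)"
      "3 * j \<noteq> Suc (Suc (3 * i))" for i j :: nat by presburger+
    show "wp (a[Const (r + 2) +: Const 3 *: Var 20] ::= edge_entry 5 (Var 20) ;;
       a[Const (r + 3) +: Const 3 *: Var 20] ::= edge_entry 6 (Var 20) ;;
       a[Const (r + 4) +: Const 3 *: Var 20] ::= edge_entry 8 (Var 20) +: Read 6 (Var 20) *: Var 21)
      (\<lambda>t s'. t \<le> 100 \<and> s' 20 0 = j \<and> ?I (Suc j) (upd s' 20 0 (Suc j))) s'"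
      using r a ok I s' s'20 le1 le2 inp_edge[OF j]
      by (intro wp_Seq wp_Assign) (simp_all add: ok_def A_def all_less_Suc ne)
  qed
qed (use assms(1,2) a r in \<open>simp_all add: inp_header ok_upd\<close>)

end

text \<open>The index written to array 11 is overwritten by the next one unless the counter is increased.\<close>

definition classify :: com where
  "classify = For 20 EdgesE
     (10[Var 20] ::= table_entry 4 0 (Var 20) ;;
      7[Var 20] ::= (NumE *: Read 10 (Var 20) <: DenE *: edge_entry 8 (Var 20)) ;;
      8[Var 20] ::= NotE (Read 7 (Var 20)) *: (Const 0 <: edge_entry 7 (Var 20)) *:
        NotE (NotE (Read 10 (Var 20) <: edge_entry 8 (Var 20)) *:
          NotE ((Const 0 <: table_entry 4 1 (Var 20)) *:
            NotE (NumE *: Read 10 (Var 20) <: DenE *: table_entry 4 1 (Var 20)))) ;;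
      6[Var 20] ::= Read 7 (Var 20) +: Read 8 (Var 20) ;;
      11[Var 22] ::= Var 20 ;;
      22 :== Var 22 +: Read 8 (Var 20))"

definition mark_critical :: com where
  "mark_critical = For 20 EdgesE
     (9[Var 20] ::= Read 8 (Var 20) *: (NumE *: Read 10 (Var 20) <: DenE *: table_entry 5 0 (Var 20)) ;;
      28 :== Var 28 +: Read 9 (Var 20) ;;
      6[Var 20] ::= Read 6 (Var 20) -: Read 9 (Var 20) ;;
      23 :== Var 23 +: Read 6 (Var 20) *: edge_entry 7 (Var 20))"

lemma bij_betw_extend:
  assumes "bij_betw f {..<c :: nat} A" "x \<notin> A"
  shows "bij_betw (f(c := x)) {..<Suc c} (insert x A)"
proof -
  have "bij_betw (f(c := x)) {..<c} A"
    using assms(1) by (rule bij_betw_cong[THEN iffD1, rotated]) auto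
  then show ?thesis
    using notIn_Un_bij_betw[of c "{..<c}" "f(c := x)" A] assms(2) by (simp add: lessThan_Suc)
qed

context spanner_program
begin

text \<open>Copying a table takes \<open>2 * n * n\<close> steps, for which the unknown running time
  must pay. It does: the \<open>n * n - n\<close> distances between distinct nodes are positive, the
  output array starts with zeros, and changing that many cells takes as many steps.\<close>

lemma sq_nodes_le: "n * n \<le> 2 * t2 + 1"
proof -
  obtain t s where run: "exec L p2 (load (encode_graph (variant {}))) t s" "2 + 3 * m + t \<le> t2"
    "apsp2_answer (variant {}) (s 1)" using apsp_run by blast
  obtain A where A: "finite A" "card A \<le> t" "\<And>i. i \<notin> A \<Longrightarrow> s 1 i = 0"
    using exec_writes[OF run(1), of 1] by (auto simp: load_def)
  define D where "D = {..<n} \<times> {..<n} - (\<lambda>u. (u, u)) ` {..<n}"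
  have "(\<lambda>(u, v). 2 * (u * n + v)) ` D \<subseteq> A"
  proof (rule subsetI, rule ccontr)
    fix x assume "x \<in> (\<lambda>(u, v). 2 * (u * n + v)) ` D" and "x \<notin> A"
    then obtain u v where uv: "u < n" "v < n" "u \<noteq> v" and nA: "2 * (u * n + v) \<notin> A"
      by (auto simp: D_def)
    then have "s 1 (2 * (u * n + v)) = gdist (edges I) (len (variant {})) u v"
      using apsp2_gdist[OF run(3)] uv by (simp add: verts_def)
    moreover obtain P where "P \<in> paths (edges I) u v" "path_len (len I) P = d u v"
      using gdist_attained[OF paths_ne[of u v]] uv by (auto simp: verts_def)
    ultimately show False
      using A(3)[OF nA] path_len_pos[of P u v] uv(3) by simp
  qed
  moreover have "inj_on (\<lambda>(u, v). 2 * (u * n + v)) D"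
  proof (rule inj_onI)
    fix x y assume xy: "x \<in> D" "y \<in> D" "(\<lambda>(u, v). 2 * (u * n + v)) x = (\<lambda>(u, v). 2 * (u * n + v)) y"
    obtain u v u' v' where [simp]: "x = (u, v)" "y = (u', v')" by (metis surj_pair)
    have *: "u * n + v = u' * n + v'" "v < n" "v' < n" using xy by (auto simp: D_def)
    then have "(u * n + v) div n = (u' * n + v') div n" "(u * n + v) mod n = (u' * n + v') mod n" by simp_all
    then show "x = y" using *(2,3) by simp
  qed
  ultimately have "card D \<le> card A" using A(1) by (metis card_image card_mono)
  moreover have "card D = n * n - n"
    unfolding D_def by (subst card_Diff_subset) (auto simp: card_image inj_on_def card_cartesian_product)
  ultimately have *: "n * n - n \<le> t2" using A(2) run(2) by linarith
  show ?thesis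
  proof (cases "2 \<le> n")
    case True
    then have "2 * n \<le> n * n" by simp
    then show ?thesis using * by linarith
  next
    case False
    then have "n = 0 \<or> n = 1" by linarith
    then show ?thesis by auto
  qed
qed

lemma magnitude_gt: "x \<in> set xs \<Longrightarrow> x < magnitude xs"
  using member_le_sum_list[of x xs] by (simp add: magnitude_def)

lemma m_le_t2: "m + 1 \<le> t2"
  using apsp_run[of "{}"] by force

lemma wp_apsp:
  assumes "ok s" "s 0 = inp" "s 21 0 = big" "\<And>i. i < m \<Longrightarrow> s 6 i = of_bool (e i \<in> X)"
    and Q: "\<And>t s'. ok s' \<Longrightarrow> same {2, 20, b} s s' \<Longrightarrow> apsp2_answer (variant X) (s' b) \<Longrightarrow>
      t \<le> 300 * t2 \<Longrightarrow> Q t s'"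
  shows "wp (apsp p2 b) Q s"
  unfolding apsp_def
proof (rule wp_Seq, rule wp_build[OF assms(1-4)])
  show "0 \<le> (2 :: nat)" "(2 :: nat) \<notin> {0, 6, 20, 21}" by simp_all
  fix t s' assume ok: "ok s'" and same: "same {2, 20} s s'"
    and arr: "map (s' 2) [0..<0 + 2 + 3 * m] = encode_graph (variant X)" and t: "t \<le> 200 * (m + 1)"
  have s'0: "s' 0 = inp" using same assms(2) by (simp add: same_def)
  obtain tr sr where run: "exec L p2 (load (encode_graph (variant X))) tr sr" "2 + 3 * m + tr \<le> t2"
    "apsp2_answer (variant X) (sr 1)" using apsp_run by blast
  have k: "val s' (Const 2 +: Const 3 *: EdgesE) = 0 + 2 + 3 * m" by (simp add: s'0 inp_header)
  show "wp (Call p2 2 (Const 2 +: Const 3 *: EdgesE) b (Const 2 *: (NodesE *: NodesE))) (\<lambda>t2. Q (t + t2)) s'"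
  proof (rule wp_Call[where B' = L])
    show "exec L p2 (load (map (s' 2) [0..<val s' (Const 2 +: Const 3 *: EdgesE)])) tr sr"
      unfolding k arr by (rule run)
    show "s' 2 i < L" if "i < val s' (Const 2 +: Const 3 *: EdgesE)" for i
    proof -
      have "i \<in> {0..<0 + 2 + 3 * m}" using that unfolding k by simp
      then have "s' 2 i \<in> set (map (s' 2) [0..<0 + 2 + 3 * m])" by (simp only: set_map set_upt imageI)
      then have "s' 2 i < magnitude (encode_graph (variant X))" unfolding arr by (rule magnitude_gt)
      then show ?thesis using magnitude_variant[of X] M4L by linarith
    qed
    fix out assume ok_out: "ok (s'(b := out))"
      and "\<And>i. i < val s' (Const 2 *: (NodesE *: NodesE)) \<Longrightarrow> out i = sr 1 i"
    then have out: "out i = sr 1 i" if "i < 2 * (n * n)" for i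
      using that by (simp add: s'0 inp_header)
    have lt: "2 * (u * n + v) + 1 < 2 * (n * n)" if "u < n" "v < n" for u v
    proof -
      have "Suc u * n \<le> n * n" using that by (intro mult_le_mono1) simp
      then show ?thesis using that by simp
    qed
    then have *: "out (2 * (u * n + v)) = sr 1 (2 * (u * n + v))"
      "out (2 * (u * n + v) + 1) = sr 1 (2 * (u * n + v) + 1)" if "u \<in> {..<n}" "v \<in> {..<n}" for u v
      using lt[of u v] that by (simp only: lessThan_iff; intro out; linarith)+
    \<comment> \<open>The answer predicate reads only cells below \<open>2 * (n * n)\<close>, all of
      which have been copied.\<close>
    have "apsp2_answer (variant X) out"
      using run(3) unfolding apsp2_answer_def variant_simps verts_def Let_def
      by (simp only: * cong: ball_cong)
    then have "apsp2_answer (variant X) ((s'(b := out)) b)" by simp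
    moreover have "same {2, 20, b} s (s'(b := out))" using same by (auto simp: same_def)
    ultimately show "Q (t + (1 + cost (Const 2 +: Const 3 *: EdgesE) + cost (Const 2 *: (NodesE *: NodesE)) +
        val s' (Const 2 +: Const 3 *: EdgesE) + val s' (Const 2 *: (NodesE *: NodesE)) + tr)) (s'(b := out))"
      using t run(2) sq_nodes_le m_le_t2 by (intro Q ok_out) (simp_all add: s'0 inp_header)
  qed (use ok L2 in simp_all)
qed

definition flagged :: "nat set set \<Rightarrow> memory \<Rightarrow> bool" where
  "flagged X s \<longleftrightarrow> (\<forall>i<m. s 6 i = of_bool (e i \<in> X))"

definition tables :: "memory \<Rightarrow> bool" where
  "tables s \<longleftrightarrow> s 0 = inp \<and> s 21 0 = big \<and> (\<forall>i<m. s 7 i = of_bool (e i \<notin> E')) \<and>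
     (\<forall>i<m. s 8 i = of_bool (e i \<in> N)) \<and> (\<forall>i<m. s 10 i = d (eu i) (ev i)) \<and>
     bij_betw (s 11) {..<s 22 0} {i. i < m \<and> e i \<in> N} \<and> s 22 0 \<le> m"

lemma dist_le_L: "i < m \<Longrightarrow> d (eu i) (ev i) \<le> L"
  using d_le_S[of "eu i" "ev i"] endpoints_verts[of i] inp_le_L(6) by linarith

lemma wp_classify:
  assumes "ok s" "s 0 = inp" "s 21 0 = big" "s 22 0 = 0" "apsp2_answer (variant {}) (s 4)"
    and Q: "\<And>t s'. ok s' \<Longrightarrow> same {6, 7, 8, 10, 11, 20, 22} s s' \<Longrightarrow> tables s' \<Longrightarrow>
      flagged ((edges I - E') \<union> N) s' \<Longrightarrow> t \<le> 1000 * (m + 1) \<Longrightarrow> Q t s'"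
  shows "wp classify Q s"
  unfolding classify_def
proof (rule wp_For[where k = m and T = 900 and I = "\<lambda>j s'. same {6, 7, 8, 10, 11, 20, 22} s s' \<and>
    (\<forall>i<j. s' 7 i = of_bool (e i \<notin> E')) \<and> (\<forall>i<j. s' 8 i = of_bool (e i \<in> N)) \<and>
    (\<forall>i<j. s' 10 i = d (eu i) (ev i)) \<and> (\<forall>i<j. s' 6 i = of_bool (e i \<in> (edges I - E') \<union> N)) \<and>
    bij_betw (s' 11) {..<s' 22 0} {i. i < j \<and> e i \<in> N} \<and> s' 22 0 \<le> j"], goal_cases)
  case 4
  then show ?case using assms by (simp add: bij_betw_def)
next
  case (5 j s')
  then show ?case using assms(2) by (simp add: inp_header same_def)
next
  case (6 j s')
  then have j: "j < m" and ok: "ok s'" and s'20: "s' 20 0 = j" by auto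
  have s': "s' 0 = inp" "s' 4 = s 4" using 6 assms(2) by (simp_all add: same_def)
  define d1 d2 where "d1 = d (eu j) (ev j)" and "d2 = s 4 (Suc (2 * (eu j * n + ev j)))"
  have d1: "s 4 (2 * (eu j * n + ev j)) = d1"
    using apsp2_gdist[OF assms(5), of "eu j" "ev j"] endpoints_verts[OF j] endpoints(3)[OF j]
    by (simp add: d1_def)
  have ns_iff: "num * d1 < den * len I (e j) \<longleftrightarrow> e j \<notin> E'"
    using self_settling_iff[of "eu j" "ev j"] e_in[OF j] by (auto simp: e_def d1_def)
  \<comment> \<open>The negated part is the test for mandatory edges from
    \<open>apsp2_mandatory\<close>. The program evaluates it by nested \<open>NotE\<close>, with
    multiplication as conjunction.\<close>
  have nt_iff: "e j \<in> N \<longleftrightarrow> e j \<in> E' \<and> weight I (e j) \<noteq> 0 \<and>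
      \<not> (len I (e j) \<le> d1 \<and> (d2 = 0 \<or> num * d1 < den * d2))"
    using apsp2_mandatory[OF assms(5), of "eu j" "ev j"]
    by (auto simp: nontrivial_edges_def trivial_edges_def e_def d1_def d2_def)
  have bij: "bij_betw (s' 11) {..<s' 22 0} {i. i < j \<and> e i \<in> N}" "s' 22 0 \<le> j"
    using 6 by blast+
  have ext: "{i. i < Suc j \<and> e i \<in> N} = (if e j \<in> N then insert j {i. i < j \<and> e i \<in> N} else {i. i < j \<and> e i \<in> N})"
    by (auto simp: less_Suc_eq)
  have bij': "bij_betw ((s' 11)(s' 22 0 := j)) {..<s' 22 0 + of_bool (e j \<in> N)} {i. i < Suc j \<and> e i \<in> N}"
    using bij_betw_extend[OF bij(1), of j] bij_betw_cong[of "{..<s' 22 0}" "s' 11" "(s' 11)(s' 22 0 := j)"] bij(1)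
    by (auto simp: ext)
  have le: "Suc (s' 22 0) \<le> L" "j \<le> L" "d1 \<le> L"
    using bij(2) j inp_le_L(2) dist_le_L[OF j] unfolding d1_def by linarith+
  have D: "s 4 (2 * (eu j * n) + 2 * ev j) = d1" "s 4 (Suc (2 * (eu j * n) + 2 * ev j)) = d2"
    using d1 by (simp_all add: d2_def)
  note F = s' s'20 inp_header inp_edge[OF j] le D
  have v8: "val s8 (NotE (Read 7 (Var 20)) *: (Const 0 <: edge_entry 7 (Var 20)) *:
        NotE (NotE (Read 10 (Var 20) <: edge_entry 8 (Var 20)) *:
          NotE ((Const 0 <: table_entry 4 1 (Var 20)) *:
            NotE (NumE *: Read 10 (Var 20) <: DenE *: table_entry 4 1 (Var 20))))) = of_bool (e j \<in> N)"
    if "s8 0 = inp" "s8 4 = s 4" "s8 7 j = of_bool (e j \<notin> E')" "s8 20 0 = j" "s8 10 j = d1" for s8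
    using that by (simp add: inp_header inp_edge[OF j] nt_iff D)
  have v6: "val s6 (Read 7 (Var 20) +: Read 8 (Var 20)) = of_bool (e j \<in> (edges I - E') \<union> N)"
    if "s6 7 j = of_bool (e j \<notin> E')" "s6 8 j = of_bool (e j \<in> N)" "s6 20 0 = j" for s6
    using that e_in[OF j] N_subset by (auto simp: of_bool_def)
  have le6: "s' 22 0 + of_bool (e j \<in> N) \<le> L"
    using le(1) by (simp add: of_bool_def)
  show ?case
    apply (rule wp_Seq, rule wp_Assign_val[where k = j and v = d1], (simp add: F ok; fail)+)
    apply (rule wp_Seq, rule wp_Assign_val[where k = j and v = "of_bool (e j \<notin> E')"], (simp add: F ns_iff; fail)+)
    apply (rule wp_Seq, rule wp_Assign_val[where k = j and v = "of_bool (e j \<in> N)"], (simp add: F; fail)+,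
      rule v8, (simp add: F; fail)+)
    apply (rule wp_Seq, rule wp_Assign_val[where k = j and v = "of_bool (e j \<in> (edges I - E') \<union> N)"], (simp add: F; fail)+,
      rule v6, (simp add: F; fail)+)
    apply (rule wp_Seq, rule wp_Assign_val[where k = "s' 22 0" and v = j], (simp add: F; fail)+)
    apply (rule wp_Assign_val[where k = 0 and v = "s' 22 0 + of_bool (e j \<in> N)"], (simp add: F; fail)+, rule le6)
    using 6 bij' bij(2) by (simp add: F all_less_Suc d1_def)
next
  case (7 t s')
  show ?case
  proof (rule Q)
    show "tables s'" unfolding tables_def using 7 assms(2,3) by (simp add: same_def)
    show "flagged ((edges I - E') \<union> N) s'" unfolding flagged_def using 7 by blast
  qed (use 7 in simp_all)
qed (use assms(1) in simp_all)

lemma wp_mark_critical: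
  assumes "ok s" "tables s" "flagged ((edges I - E') \<union> N) s" "s 23 0 = 0" "s 28 0 = 0"
    "apsp2_answer (variant ((edges I - E') \<union> N)) (s 5)"
    and Q: "\<And>t s'. ok s' \<Longrightarrow> same {6, 9, 20, 23, 28} s s' \<Longrightarrow> tables s' \<Longrightarrow>
      flagged ((edges I - E') \<union> (N - C)) s' \<Longrightarrow> s' 23 0 = sum (weight I) ((edges I - E') \<union> (N - C)) \<Longrightarrow>
      (s' 28 0 = 0 \<longleftrightarrow> C = {}) \<Longrightarrow> t \<le> 1000 * (m + 1) \<Longrightarrow> Q t s'"
  shows "wp mark_critical Q s"
  unfolding mark_critical_def
proof -
  define X where "X = (edges I - E') \<union> (N - C)"
  define Y where "Y = (edges I - E') \<union> N"
  have s: "s 0 = inp" "\<And>i. i < m \<Longrightarrow> s 8 i = of_bool (e i \<in> N)" "\<And>i. i < m \<Longrightarrow> s 10 i = d (eu i) (ev i)"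
    using assms(2) by (auto simp: tables_def)
  \<comment> \<open>Array 6 is overwritten in place: entries below \<open>j\<close> already describe
    \<open>X\<close>, the remaining ones still \<open>Y\<close>.\<close>
  let ?I = "\<lambda>j s'. same {6, 9, 20, 23, 28} s s' \<and> (\<forall>i<j. s' 6 i = of_bool (e i \<in> X)) \<and>
    (\<forall>i. j \<le> i \<longrightarrow> i < m \<longrightarrow> s' 6 i = of_bool (e i \<in> Y)) \<and>
    s' 23 0 = (\<Sum>i<j. of_bool (e i \<in> X) * weight I (e i)) \<and>
    s' 28 0 = (\<Sum>i<j. of_bool (e i \<in> C))"
  show "wp (For 20 EdgesE
     (9[Var 20] ::= Read 8 (Var 20) *: (NumE *: Read 10 (Var 20) <: DenE *: table_entry 5 0 (Var 20)) ;;
      28 :== Var 28 +: Read 9 (Var 20) ;;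
      6[Var 20] ::= Read 6 (Var 20) -: Read 9 (Var 20) ;;
      23 :== Var 23 +: Read 6 (Var 20) *: edge_entry 7 (Var 20))) Q s"
  proof (rule wp_For[where k = m and T = 900 and I = ?I], goal_cases)
    case 4
    then show ?case using assms(3-5) by (simp add: flagged_def Y_def)
  next
    case (5 j s')
    then show ?case using s(1) by (simp add: inp_header same_def)
  next
    case (6 j s')
    then have j: "j < m" and ok: "ok s'" and s'20: "s' 20 0 = j" by auto
    define d1 where "d1 = d (eu j) (ev j)"
    have s': "s' 0 = inp" "s' 5 = s 5" "s' 10 j = d1" "s' 8 j = of_bool (e j \<in> N)"
      using 6 s by (simp_all add: same_def d1_def)
    have s'6: "s' 6 j = of_bool (e j \<in> Y)" using 6 by simp
    define d2 where "d2 = gdist (edges I) (len (variant Y)) (eu j) (ev j)"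
    have D: "s 5 (2 * (eu j * n) + 2 * ev j) = d2"
      using apsp2_gdist[OF assms(6), of "eu j" "ev j"] endpoints_verts[OF j] endpoints(3)[OF j]
      by (simp add: d2_def Y_def)
    have "edges I - Y = T"
      using T_subset E'_subset by (auto simp: Y_def nontrivial_edges_def)
    then have "den * d2 \<le> num * d1 \<longleftrightarrow> settled T (eu j) (ev j)"
      using variant_settled[OF endpoints_verts[OF j], of Y] by (simp add: d1_def d2_def)
    moreover have "e j \<in> C \<longleftrightarrow> e j \<in> N \<and> \<not> settled T (eu j) (ev j)"
      using critical_iff[of "eu j" "ev j"] C_subset N_subset by (auto simp: e_def)
    ultimately have cr_iff: "e j \<in> C \<longleftrightarrow> e j \<in> N \<and> num * d1 < den * d2" by auto
    note F = s' s'20 inp_header inp_edge[OF j] D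
    have "(\<Sum>i<Suc j. of_bool (e i \<in> C)) \<le> Suc j"
      using sum_bounded_above[of "{..<Suc j}" "\<lambda>i. of_bool (e i \<in> C) :: nat" 1] by simp
    then have "s' 28 0 + of_bool (e j \<in> C) \<le> Suc j" using 6 by simp
    then have le28: "s' 28 0 + of_bool (e j \<in> C) \<le> L" using j inp_le_L(2) by linarith
    have "(\<Sum>i<Suc j. of_bool (e i \<in> X) * weight I (e i)) \<le> (\<Sum>i<Suc j. weight I (e i))"
      by (intro sum_mono) simp
    also have "\<dots> \<le> (\<Sum>i<m. weight I (e i))" using j by (intro sum_mono2) auto
    also have "\<dots> \<le> L" using M_ge(8) by (rule le_L)
    finally have le23: "s' 23 0 + of_bool (e j \<in> X) * weight I (e j) \<le> L"
      using 6 by simp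
    have v6: "of_bool (e j \<in> Y) - of_bool (e j \<in> C) = (of_bool (e j \<in> X) :: nat)"
      using C_subset N_subset by (auto simp: X_def Y_def of_bool_def)
    show ?case
      apply (rule wp_Seq, rule wp_Assign_val[where k = j and v = "of_bool (e j \<in> C)"],
        (simp add: F ok cr_iff; fail)+)
      apply (rule wp_Seq, rule wp_Assign_val[where k = 0 and v = "s' 28 0 + of_bool (e j \<in> C)"],
        (simp add: F; fail)+, rule le28)
      apply (rule wp_Seq, rule wp_Assign_val[where k = j and v = "of_bool (e j \<in> X)"],
        (simp add: F s'6 v6; fail)+)
      apply (rule wp_Assign_val[where k = 0 and v = "s' 23 0 + of_bool (e j \<in> X) * weight I (e j)"],
        (simp add: F del: of_bool_eq; fail)+, rule le23)
      using 6 by (simp add: F all_less_Suc)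
  next
    case (7 t s')
    have same: "same {6, 9, 20, 23, 28} s s'" using 7 by blast
    have X: "X \<subseteq> edges I" using N_subset E'_subset by (auto simp: X_def)
    show ?case
    proof (rule Q)
      show "tables s'" using assms(2) same by (simp add: tables_def same_def)
      show "flagged ((edges I - E') \<union> (N - C)) s'" using 7 by (simp add: flagged_def X_def)
      show "s' 23 0 = sum (weight I) ((edges I - E') \<union> (N - C))"
        using 7 sum_edges[OF X] by (simp add: X_def)
      have "s' 28 0 = (\<Sum>i<m. of_bool (e i \<in> C))" using 7 by blast
      then have "s' 28 0 = 0 \<longleftrightarrow> (\<forall>i<m. e i \<notin> C)" by auto
      also have "\<dots> \<longleftrightarrow> C = {}"
      proof -
        have "C \<subseteq> e ` {..<m}" using C_subset N_subset E'_subset edges_eq by (metis subset_trans)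
        then show ?thesis by auto
      qed
      finally show "s' 28 0 = 0 \<longleftrightarrow> C = {}" .
    qed (use 7 in simp_all)
  qed (use assms(1) in simp_all)
qed

end

section \<open>Checking one choice of edges\<close>

definition set_flags :: com where
  "set_flags = For 20 EdgesE (6[Var 20] ::= Read 7 (Var 20)) ;;
     For 20 TargetE (6[Read 11 (Read 12 (Var 20))] ::= Const 1)"

definition weigh :: com where
  "weigh = 23 :== Const 0 ;;
     For 20 EdgesE (23 :== Var 23 +: Read 6 (Var 20) *: edge_entry 7 (Var 20)) ;;
     24 :== NotE (Var 23 <: TargetE)"

definition query :: "com \<Rightarrow> com" where
  "query p = 3[Const 0] ::= edge_entry 5 (Read 11 (Read 12 (Var 27))) ;;
     3[Const 1] ::= edge_entry 6 (Read 11 (Read 12 (Var 27))) ;;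
     Call p 3 (Const 4 +: Const 3 *: EdgesE) 13 (Const 1) ;;
     24 :== Var 24 *: NotE (NumE *: Read 10 (Read 11 (Read 12 (Var 27))) <: DenE *: Var 13)"

definition check :: "com \<Rightarrow> com" where
  "check p = set_flags ;; weigh ;; build 2 3 ;; For 27 TargetE (query p)"

text \<open>Surplus indices repeat one element of \<open>R\<close>, which is why \<open>R\<close>
  must not be empty.\<close>

lemma exists_image_lessThan:
  assumes "finite R" "R \<noteq> {}" "card R \<le> k"
  shows "\<exists>g. g ` {..<k} = R"
proof -
  obtain h where h: "bij_betw h {0..<card R} R" using ex_bij_betw_nat_finite[OF assms(1)] by blast
  have pos: "0 < card R" using assms by (simp add: card_gt_0_iff)
  define g where "g j = (if j < card R then h j else h 0)" for j
  have R: "h ` {0..<card R} = R" using h by (simp add: bij_betw_def)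
  have "g ` {..<k} \<subseteq> R"
  proof
    fix x assume "x \<in> g ` {..<k}"
    then obtain j where "x = g j" by blast
    then show "x \<in> R" using pos R by (cases "j < card R") (auto simp: g_def)
  qed
  moreover have "R \<subseteq> g ` {..<k}"
  proof
    fix x assume "x \<in> R"
    then have "x \<in> h ` {0..<card R}" using R by simp
    then obtain j where "j < card R" "x = h j" by auto
    then show "x \<in> g ` {..<k}" using assms(3) by (intro image_eqI[of _ _ j]) (auto simp: g_def)
  qed
  ultimately show ?thesis by blast
qed

context spanner_input
begin

text \<open>A solution is represented by the nontrivial edges it removes; edges that do not settle
  themselves always go and their weight counts. The size of \<open>R\<close> is left open, and
  \<open>solution_good\<close> supplies a set of at most \<open>W\<close> edges.\<close>

definition good :: "nat set set \<Rightarrow> bool" where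
  "good R \<longleftrightarrow> removable R \<and> W \<le> sum (weight I) (edges I - E') + sum (weight I) R"

lemma good_is_solution: "good R \<Longrightarrow> is_solution I (E' - R)"
  using removable_spanner[of R] removable_weight[of R] by (simp add: good_def is_solution_def stretch_eq)

lemma solution_good:
  assumes "has_solution I"
  shows "\<exists>R. good R \<and> card R \<le> W"
  using assms spanner_removable by (fastforce simp: has_solution_def is_solution_def stretch_eq good_def)

text \<open>\<open>f\<close> selects positions in the enumeration \<open>nl\<close> of the
  nontrivial edges. Positions may coincide, so \<open>W\<close> of them describe every nonempty set
  of at most \<open>W\<close> edges.\<close>

definition pick :: "(nat \<Rightarrow> nat) \<Rightarrow> (nat \<Rightarrow> nat) \<Rightarrow> nat set set" where
  "pick nl f = (\<lambda>j. e (nl (f j))) ` {..<W}"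

context
  fixes nl :: "nat \<Rightarrow> nat" and c :: nat
  assumes nl: "bij_betw nl {..<c} {i. i < m \<and> e i \<in> N}"
begin

lemma bij_enum: "bij_betw (\<lambda>i. e (nl i)) {..<c} N"
proof -
  have "N \<subseteq> e ` {..<m}" using N_subset E'_subset edges_eq by (metis subset_trans)
  then have "e ` {i. i < m \<and> e i \<in> N} = N" by auto
  then have "bij_betw e {i. i < m \<and> e i \<in> N} N"
    using inj_on_subset[OF inj_e, of "{i. i < m \<and> e i \<in> N}"] by (auto simp: bij_betw_def)
  then show ?thesis using bij_betw_trans[OF nl] by (simp add: o_def)
qed

lemma exists_pick:
  assumes "finite R" "R \<noteq> {}" "card R \<le> W" "R \<subseteq> (\<lambda>i. e (nl i)) ` {..<k}"
  shows "\<exists>f. (\<forall>j<W. f j < k) \<and> pick nl f = R"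
proof -
  obtain g where g: "g ` {..<W} = R" using exists_image_lessThan[OF assms(1-3)] by blast
  have "\<forall>j\<in>{..<W}. \<exists>i. i < k \<and> e (nl i) = g j"
  proof
    fix j assume "j \<in> {..<W}"
    then have "g j \<in> (\<lambda>i. e (nl i)) ` {..<k}" using g assms(4) by blast
    then show "\<exists>i. i < k \<and> e (nl i) = g j" by force
  qed
  from bchoice[OF this] obtain f where f: "\<forall>j\<in>{..<W}. f j < k \<and> e (nl (f j)) = g j" ..
  then have "pick nl f = R" unfolding pick_def g[symmetric] by (intro image_cong) auto
  then show ?thesis using f by blast
qed

text \<open>This limits the search by the tightness although the program never computes it: among so
  many edges \<open>W\<close> can be removed together, and nontrivial edges weigh at least 1
  each.\<close>

lemma many_nontrivial_pick:
  assumes "0 < W" "W * (2 * \<tau> + 1) \<le> k" "k \<le> c"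
  shows "\<exists>f. (\<forall>j<W. f j < k) \<and> good (pick nl f)"
proof -
  let ?S = "(\<lambda>i. e (nl i)) ` {..<k}"
  have "inj_on (\<lambda>i. e (nl i)) {..<k}"
    using bij_enum assms(3) by (auto simp: bij_betw_def intro: inj_on_subset)
  then have "card ?S = k" by (simp add: card_image)
  moreover have "?S \<subseteq> N" using bij_enum assms(3) by (auto simp: bij_betw_def)
  ultimately have "\<exists>R\<subseteq>?S. removable R \<and> card R = W"
    using assms(2) by (intro large_set_removable) simp_all
  then obtain R where R: "R \<subseteq> ?S" "removable R" "card R = W" by blast
  then have "good R" using card_le_weight[of R] by (simp add: good_def removable_def)
  moreover have "finite R" "R \<noteq> {}" using R assms(1) finite_subset[OF R(1)] by auto
  ultimately obtain f where "\<forall>j<W. f j < k" "pick nl f = R"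
    using exists_pick[of R k] R by auto
  with \<open>good R\<close> show ?thesis by blast
qed

text \<open>If \<open>k\<close> reaches the number \<open>c\<close> of all nontrivial edges without
  success, every solution is excluded. The bound on the weight makes the removed set nonempty, as
  \<open>W\<close> positions cannot describe the empty set when \<open>W\<close> is
  positive.\<close>

lemma solution_pick:
  assumes "has_solution I" "sum (weight I) (edges I - E') < W"
  shows "\<exists>f. (\<forall>j<W. f j < c) \<and> good (pick nl f)"
proof -
  obtain R where R: "good R" "card R \<le> W" using solution_good[OF assms(1)] by blast
  then have "R \<noteq> {}" using assms(2) by (auto simp: good_def)
  moreover have "R \<subseteq> N" using R(1) by (simp add: good_def removable_def)
  moreover have "(\<lambda>i. e (nl i)) ` {..<c} = N" using bij_enum by (simp add: bij_betw_def)
  moreover have "finite R" using \<open>R \<subseteq> N\<close> finite_N by (rule finite_subset)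
  ultimately obtain f where "\<forall>j<W. f j < c" "pick nl f = R"
    using exists_pick[of R c] R by auto
  with R(1) show ?thesis by blast
qed

end

end

context spanner_program
begin

lemma m_le_t1: "m + 1 \<le> t1"
proof -
  obtain v where "v \<in> verts I" using conn by (auto simp: connected_graph_def)
  then show ?thesis using spsp_run[of v v "{}"] by force
qed

lemma wp_set_flags:
  assumes "ok s" "tables s" "\<And>j. j < W \<Longrightarrow> s 12 j < s 22 0"
    and Q: "\<And>t s'. ok s' \<Longrightarrow> same {6, 20} s s' \<Longrightarrow> flagged ((edges I - E') \<union> pick (s 11) (s 12)) s' \<Longrightarrow>
      t \<le> 100 * (m + 1) + 100 * (W + 1) \<Longrightarrow> Q t s'"
  shows "wp set_flags Q s"
  unfolding set_flags_def
proof (rule wp_Seq, rule wp_For[where k = m and T = 20 and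
      I = "\<lambda>j s'. same {6, 20} s s' \<and> (\<forall>i<j. s' 6 i = of_bool (e i \<in> edges I - E'))"], goal_cases)
  case (5 j s')
  then show ?case using assms(2) by (simp add: inp_header same_def tables_def)
next
  case (6 j s')
  have F: "s' 0 = inp" "s' 7 j = of_bool (e j \<notin> E')" "s' 20 0 = j"
    using 6 assms(2) by (simp_all add: same_def tables_def)
  show ?case
    apply (rule wp_Assign_val[where k = j and v = "of_bool (e j \<notin> E')"], (simp add: F 6; fail)+)
    using 6 e_in[OF 6(1)] by (simp add: F all_less_Suc)
next
  case (7 t s1)
  note same1 = 7(2)[THEN conjunct1]
  have s1: "s1 0 = inp" "s1 11 = s 11" "s1 12 = s 12"
    using same1 assms(2) by (simp_all add: same_def tables_def)
  have nl: "s 11 (s 12 j) < m" if "j < W" for j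
    using assms(2,3) that by (auto simp: tables_def bij_betw_def)
  show ?case
  proof (rule wp_For[where k = W and T = 20 and I = "\<lambda>j s'. same {6, 20} s s' \<and>
      flagged ((edges I - E') \<union> (\<lambda>j. e (s 11 (s 12 j))) ` {..<j}) s'"], goal_cases)
    case 4
    then show ?case using 7 by (simp add: flagged_def)
  next
    case (5 j s')
    then show ?case using s1 assms(2) by (simp add: inp_header same_def tables_def)
  next
    case (6 j s')
    have F: "s' 0 = inp" "s' 11 = s 11" "s' 12 = s 12" "s' 20 0 = j"
      using 6 assms(2) by (simp_all add: same_def tables_def)
    have "flagged ((edges I - E') \<union> (\<lambda>j. e (s 11 (s 12 j))) ` {..<Suc j})
        (s'(6 := (s' 6)(s 11 (s 12 j) := 1), 20 := f))" for f
      unfolding flagged_def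
    proof (intro allI impI)
      fix i assume i: "i < m"
      have "e i = e (s 11 (s 12 j)) \<longleftrightarrow> i = s 11 (s 12 j)"
        using inj_e i nl[OF 6(1)] by (auto simp: inj_on_def)
      then show "(s'(6 := (s' 6)(s 11 (s 12 j) := 1), 20 := f)) 6 i =
          of_bool (e i \<in> (edges I - E') \<union> (\<lambda>j. e (s 11 (s 12 j))) ` {..<Suc j})"
        using 6 i by (auto simp: flagged_def lessThan_Suc)
    qed
    then have fl: "flagged ((edges I - E') \<union> (\<lambda>j. e (s 11 (s 12 j))) ` {..<Suc j})
        (upd (upd s' 6 (s 11 (s 12 j)) 1) 20 0 (Suc j))" by simp
    show ?case
      apply (rule wp_Assign_val[where k = "s 11 (s 12 j)" and v = 1], (simp add: F 6; fail)+)
      using 6 fl by (intro conjI) simp_all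
  next
    case (7 t' s')
    then show ?case using \<open>t \<le> _\<close> s1(1) by (intro Q) (simp_all add: pick_def)
  qed (use 7 in simp_all)
qed (use assms in simp_all)

lemma wp_weigh:
  assumes "ok s" "s 0 = inp" "flagged X s" "X \<subseteq> edges I"
    and Q: "\<And>t s'. ok s' \<Longrightarrow> same {20, 23, 24} s s' \<Longrightarrow> s' 24 0 = of_bool (W \<le> sum (weight I) X) \<Longrightarrow>
      t \<le> 100 * (m + 1) \<Longrightarrow> Q t s'"
  shows "wp weigh Q s"
  unfolding weigh_def
proof (rule wp_Seq, rule wp_Assign_val[where k = 0 and v = 0], goal_cases)
  case 7
  show ?case
  proof (rule wp_Seq, rule wp_For[where k = m and T = 20 and I = "\<lambda>j s'. same {20, 23} s s' \<and>
      s' 23 0 = (\<Sum>i<j. of_bool (e i \<in> X) * weight I (e i))"], goal_cases)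
    case 1
    then show ?case using 7 .
  next
    case (5 j s')
    then show ?case using assms(2) by (simp add: inp_header same_def)
  next
    case (6 j s')
    have F: "s' 0 = inp" "s' 20 0 = j" "s' 6 j = of_bool (e j \<in> X)"
      using 6 assms(2,3) by (simp_all add: same_def flagged_def)
    have "(\<Sum>i<Suc j. of_bool (e i \<in> X) * weight I (e i)) \<le> (\<Sum>i<Suc j. weight I (e i))"
      by (intro sum_mono) simp
    also have "\<dots> \<le> (\<Sum>i<m. weight I (e i))" using 6 by (intro sum_mono2) auto
    also have "\<dots> \<le> L" using M_ge(8) by (rule le_L)
    finally have le23: "s' 23 0 + of_bool (e j \<in> X) * weight I (e j) \<le> L"
      using 6 by simp
    show ?case
      apply (rule wp_Assign_val[where k = 0 and v = "s' 23 0 + of_bool (e j \<in> X) * weight I (e j)"],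
        (simp add: F 6 inp_edge[OF 6(1)]; fail)+, rule le23)
      using 6 by (simp add: F)
  next
    case (7 t s')
    have F: "s' 0 = inp" "s' 23 0 = sum (weight I) X"
      using 7 assms(2) sum_edges[OF assms(4), of "weight I"] by (simp_all add: same_def)
    have same: "same {20, 23, 24} s s'" using 7 by (auto simp: same_def)
    show ?case
      apply (rule wp_Assign_val[where k = 0 and v = "of_bool (W \<le> sum (weight I) X)"],
        (simp add: F 7 inp_header not_less; fail)+)
      using same 7 by (intro Q) simp_all
  qed simp_all
qed (use assms in simp_all)

lemma spsp_answer_gdist:
  assumes "spsp_answer (variant X, u, v) out" "u \<in> verts I" "v \<in> verts I"
  shows "out 0 = gdist (edges I) (len (variant X)) u v"
  using assms sp_dist_gdist[OF paths_ne, of u v "len (variant X)"] by (simp add: spsp_answer_def)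

lemma wp_query:
  assumes ok: "ok s" and tab: "tables s" and i: "s 11 (s 12 (s 27 0)) = i" "i < m"
    and arr: "map (s 3) [2..<2 + 2 + 3 * m] = encode_graph (variant X)" and s24: "s 24 0 = of_bool b"
    and Q: "\<And>t s'. ok s' \<Longrightarrow> same {3, 13, 24} s s' \<Longrightarrow>
      map (s' 3) [2..<2 + 2 + 3 * m] = encode_graph (variant X) \<Longrightarrow>
      s' 24 0 = of_bool (b \<and> settled (edges I - X) (eu i) (ev i)) \<Longrightarrow> t \<le> t1 + 100 \<Longrightarrow> Q t s'"
  shows "wp (query p1) Q s"
  unfolding query_def
proof -
  note inp = inp_edge[OF i(2)]
  have s0: "s 0 = inp" "s 10 i = d (eu i) (ev i)" using tab i(2) by (simp_all add: tables_def)
  have uv: "eu i \<le> L" "ev i \<le> L" using endpoints[OF i(2)] inp_le_L(1) by linarith+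
  let ?s2 = "upd (upd s 3 0 (eu i)) 3 1 (ev i)"
  obtain tr sr where run: "exec L p1 (load (encode_spsp (variant X, eu i, ev i))) tr sr" "4 + 3 * m + tr \<le> t1"
    "spsp_answer (variant X, eu i, ev i) (sr 1)" using spsp_run endpoints_verts[OF i(2)] by blast
  have k: "val ?s2 (Const 4 +: Const 3 *: EdgesE) = 2 + 2 + 3 * m" by (simp add: s0 inp_header)
  have upt: "[0..<2 + 2 + 3 * m] = 0 # 1 # [2..<2 + 2 + 3 * m]"
    by (subst upt_conv_Cons, simp, subst upt_conv_Cons, simp_all flip: numeral_2_eq_2)
  have rest: "map (?s2 3) [2..<2 + 2 + 3 * m] = encode_graph (variant X)"
    unfolding arr[symmetric] by (intro map_cong refl) auto
  have "?s2 3 0 = eu i" "?s2 3 1 = ev i" by simp_all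
  then have arr2: "map (?s2 3) [0..<2 + 2 + 3 * m] = encode_spsp (variant X, eu i, ev i)"
    unfolding upt list.map rest encode_spsp_def prod.case by (simp only:)
  show "wp (3[Const 0] ::= edge_entry 5 (Read 11 (Read 12 (Var 27))) ;;
     3[Const 1] ::= edge_entry 6 (Read 11 (Read 12 (Var 27))) ;;
     Call p1 3 (Const 4 +: Const 3 *: EdgesE) 13 (Const 1) ;;
     24 :== Var 24 *: NotE (NumE *: Read 10 (Read 11 (Read 12 (Var 27))) <: DenE *: Var 13)) Q s"
    apply (rule wp_Seq, rule wp_Assign_val[where k = 0 and v = "eu i"], (simp add: i s0 ok uv inp; fail)+)
    apply (rule wp_Seq, rule wp_Assign_val[where k = 1 and v = "ev i"], (simp add: i s0 ok uv inp; fail)+)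
  proof (rule wp_Seq, rule wp_Call[where B' = L and t = tr and s' = sr], goal_cases)
    case 4
    show ?case unfolding k arr2 by (rule run(1))
  next
    case (6 x)
    have "x \<in> {0..<2 + 2 + 3 * m}" using 6 unfolding k by simp
    then have "?s2 3 x \<in> set (map (?s2 3) [0..<2 + 2 + 3 * m])" by (simp only: set_map set_upt imageI)
    then have "?s2 3 x < magnitude (encode_spsp (variant X, eu i, ev i))" unfolding arr2 by (rule magnitude_gt)
    then show ?case using magnitude_spsp[of "eu i" "ev i" X] endpoints[OF i(2)] M4L by linarith
  next
    case (8 out)
    have out: "out 0 = gdist (edges I) (len (variant X)) (eu i) (ev i)"
      using 8(4)[of 0] spsp_answer_gdist[OF run(3) endpoints_verts[OF i(2)]] by simp
    have st: "num * d (eu i) (ev i) < den * out 0 \<longleftrightarrow> \<not> settled (edges I - X) (eu i) (ev i)"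
      using variant_settled[OF endpoints_verts[OF i(2)], of X] unfolding out by (simp add: not_le[symmetric])
    have arr3: "map ((?s2(13 := out, 24 := f)) 3) [2..<2 + 2 + 3 * m] = encode_graph (variant X)" for f
      unfolding arr[symmetric] by (intro map_cong refl) auto
    show ?case
      apply (rule wp_Assign_val[where k = 0 and v = "of_bool (b \<and> settled (edges I - X) (eu i) (ev i))"],
        rule 8(3), (simp add: i s0 inp_header s24 st; fail)+)
      apply (rule Q, assumption, simp, rule arr3, simp)
      using run(2) by (simp add: s0 inp_header)
  qed (use L2 in simp_all)
qed

end

section \<open>Exhaustive search\<close>

text \<open>Counting with the lowest digit first: maximal digits become 0 until one can be
  increased, array 27 holding the position. If the position runs off the end, flag 26 is 0 and the
  last assignment merely writes 0 to cell \<open>W\<close>.\<close>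

definition incr :: com where
  "incr = 27 :== Const 0 ;;
     While ((Var 27 <: TargetE) *: NotE (Read 12 (Var 27) +: Const 1 <: Var 25))
      (12[Var 27] ::= Const 0 ;; 27 :== Var 27 +: Const 1) ;;
     26 :== (Var 27 <: TargetE) ;;
     12[Var 27] ::= (Read 12 (Var 27) +: Const 1) *: Var 26"

definition search :: "com \<Rightarrow> com" where
  "search p = 25 :== Var 25 +: Const 1 ;; For 20 TargetE (12[Var 20] ::= Const 0) ;; 26 :== Const 1 ;;
     While (Var 26 *: NotE (Var 24)) (check p ;; incr)"

lemma div_power_Suc_le:
  fixes k x :: nat
  assumes "0 < k" "k ^ j dvd x + 1"
  shows "(x + 1) div k ^ j = x div k ^ j + 1"
proof -
  obtain c where c: "x + 1 = k ^ j * c" using assms(2) by (rule dvdE)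
  then obtain c' where c': "c = Suc c'" by (cases c) auto
  have "x = k ^ j * c' + (k ^ j - 1)" using c c' assms(1) by simp
  moreover have "k ^ j - 1 < k ^ j" using assms(1) by simp
  ultimately have "x div k ^ j = c'" using assms(1) by (metis add.commute div_less div_mult_self2 add_0 gr_implies_not0)
  then show ?thesis using c c' assms(1) by simp
qed

lemma digit_of_multiple:
  fixes k x :: nat
  assumes "k ^ Suc i dvd x" "0 < k"
  shows "x div k ^ i mod k = 0"
proof -
  obtain c where "x = k ^ Suc i * c" using assms(1) by (rule dvdE)
  then have "x = k ^ i * (k * c)" by simp
  then show ?thesis using assms(2) by simp
qed

lemma digits_carry:
  fixes k x :: nat
  assumes "0 < k" "k ^ j dvd x + 1" "x div k ^ j mod k = k - 1"
  shows "k ^ Suc j dvd x + 1"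
proof -
  have "(x div k ^ j + 1) mod k = 0"
    using assms(1,3) mod_Suc[of "x div k ^ j" k] by simp
  then have "k dvd (x + 1) div k ^ j"
    using div_power_Suc_le[OF assms(1,2)] by (simp add: mod_eq_0_iff_dvd)
  then have "k ^ j * k dvd k ^ j * ((x + 1) div k ^ j)" by (rule mult_dvd_mono[OF dvd_refl])
  then show ?thesis unfolding dvd_mult_div_cancel[OF assms(2)] by (simp add: mult.commute)
qed

text \<open>The divisibility says that the \<open>j\<close> lowest digits of \<open>x\<close> are
  all \<open>k - 1\<close>; since digit \<open>j\<close> is not maximal, the carry stops
  there.\<close>

lemma digits_Suc:
  fixes k x :: nat
  assumes "0 < k" "k ^ j dvd x + 1" "x div k ^ j mod k + 1 < k"
  shows "i < j \<Longrightarrow> (x + 1) div k ^ i mod k = 0"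
    and "(x + 1) div k ^ j mod k = x div k ^ j mod k + 1"
    and "j < i \<Longrightarrow> (x + 1) div k ^ i mod k = x div k ^ i mod k"
proof -
  let ?q = "x div k ^ j"
  have q: "(x + 1) div k ^ j = ?q + 1" using div_power_Suc_le[OF assms(1,2)] .
  show "(x + 1) div k ^ i mod k = 0" if "i < j"
  proof (rule digit_of_multiple)
    show "k ^ Suc i dvd x + 1" using assms(2) that by (meson Suc_leI le_imp_power_dvd dvd_trans)
  qed (rule assms)
  show "(x + 1) div k ^ j mod k = ?q mod k + 1"
    using assms(3) mod_Suc[of ?q k] unfolding q by simp
  show "(x + 1) div k ^ i mod k = x div k ^ i mod k" if ji: "j < i"
  proof -
    obtain r where i: "i = j + Suc r" using ji less_imp_Suc_add[of j i] by auto
    have split: "y div k ^ i = y div k ^ j div k div k ^ r" for y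
      unfolding i div_mult2_eq[symmetric] by (simp add: power_add mult_ac)
    have "(?q + 1) div k = ?q div k" using assms(3) div_Suc[of ?q k] mod_Suc[of ?q k] by simp
    then show ?thesis unfolding split[of "x + 1"] split[of x] q by simp
  qed
qed

lemma exists_digits:
  fixes k :: nat
  assumes "\<forall>j<w. f j < k"
  shows "\<exists>x<k ^ w. \<forall>j<w. x div k ^ j mod k = f j"
  using assms
proof (induction w arbitrary: f)
  case (Suc w)
  have "\<forall>j<w. f (Suc j) < k" using Suc.prems by simp
  from Suc.IH[OF this] obtain x where x: "x < k ^ w" "\<forall>j<w. x div k ^ j mod k = f (Suc j)" by blast
  have k: "f 0 < k" using Suc.prems by simp
  have "f 0 + k * x < k * (x + 1)" using k by simp
  also have "\<dots> \<le> k ^ Suc w" using x(1) by (simp only: power_Suc) (intro mult_le_mono2, simp)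
  finally have "f 0 + k * x < k ^ Suc w" .
  moreover have "(f 0 + k * x) div k ^ j mod k = f j" if "j < Suc w" for j
  proof (cases j)
    case 0
    then show ?thesis using k by simp
  next
    case (Suc j')
    have "(f 0 + k * x) div k ^ j = (f 0 + k * x) div k div k ^ j'"
      by (simp add: Suc div_mult2_eq)
    also have "(f 0 + k * x) div k = x" using k by simp
    finally show ?thesis using x(2) that Suc by simp
  qed
  ultimately show ?case by blast
qed simp

context ram
begin

text \<open>Here the decreasing quantity is an index of the invariant instead of a function of the
  memory, for instance a number represented only by its digits. The least index for which the
  invariant holds serves as the measure.\<close>

lemma wp_While_index:
  assumes "J r s" "ok s" "deg e \<le> 300"
    and step: "\<And>r s. J r s \<Longrightarrow> ok s \<Longrightarrow> val s e \<noteq> 0 \<Longrightarrow> wp c (\<lambda>t s'. t \<le> T \<and> (\<exists>r'<r. J r' s')) s"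
  shows "wp (While e c) (\<lambda>t s'. t \<le> ((r :: nat) + 1) * (T + 1 + cost e) \<and> (\<exists>r. J r s') \<and> val s' e = 0) s"
proof -
  define \<mu> where "\<mu> s = (LEAST r. J r s)" for s
  have \<mu>: "\<mu> s \<le> r" if "J r s" for r s using that unfolding \<mu>_def by (rule Least_le)
  have "wp (While e c) (\<lambda>t s'. t \<le> (\<mu> s + 1) * (T + 1 + cost e) \<and> (\<exists>r. J r s') \<and> val s' e = 0) s"
  proof (rule wp_While)
    show "\<exists>r. J r s" using assms(1) by blast
    fix s assume J: "\<exists>r. J r s" and s: "ok s" "val s e \<noteq> 0"
    have "wp c (\<lambda>t s'. t \<le> T \<and> (\<exists>r'<\<mu> s. J r' s')) s"
      unfolding \<mu>_def by (rule step[OF LeastI_ex[OF J] s])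
    then show "wp c (\<lambda>t s'. t \<le> T \<and> (\<exists>r. J r s') \<and> \<mu> s' < \<mu> s) s"
      by (rule wp_mono) (use \<mu> in \<open>blast intro: le_less_trans\<close>)
  qed (rule assms)+
  moreover have "(\<mu> s + 1) * (T + 1 + cost e) \<le> (r + 1) * (T + 1 + cost e)"
    using \<mu>[OF assms(1)] by (intro mult_le_mono1) simp
  ultimately show ?thesis by (elim wp_mono) (blast intro: order_trans)
qed

end

context spanner_program
begin

lemma wp_incr:
  assumes "ok s" "s 0 = inp" "0 < k" "k \<le> L" "s 25 0 = k" "x < k ^ W"
    and dig: "\<And>j. j < W \<Longrightarrow> s 12 j = x div k ^ j mod k"
    and Q: "\<And>t s'. ok s' \<Longrightarrow> same {12, 26, 27} s s' \<Longrightarrow> (\<And>j. j < W \<Longrightarrow> s' 12 j = (x + 1) div k ^ j mod k) \<Longrightarrow>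
      s' 26 0 = of_bool (x + 1 < k ^ W) \<Longrightarrow> t \<le> 100 * (W + 1) \<Longrightarrow> Q t s'"
  shows "wp incr Q s"
  unfolding incr_def
proof (rule wp_Seq, rule wp_Assign_val[where k = 0 and v = 0], goal_cases)
  case 7
  let ?c = "(Var 27 <: TargetE) *: NotE (Read 12 (Var 27) +: Const 1 <: Var 25)"
  let ?s = "upd s 27 0 0"
  \<comment> \<open>The digits before the current position have been reset; the divisibility
    remembers that all of them were \<open>k - 1\<close>, so that the carry has reached this
    position.\<close>
  define J where "J s' \<longleftrightarrow> same {12, 27} s s' \<and> s' 27 0 \<le> W \<and> k ^ s' 27 0 dvd x + 1 \<and>
    (\<forall>i<s' 27 0. s' 12 i = 0) \<and> (\<forall>i. s' 27 0 \<le> i \<longrightarrow> i < W \<longrightarrow> s' 12 i = x div k ^ i mod k)" for s'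
  have J0: "s' 0 = inp" "s' 25 0 = k" if "J s'" for s'
    using that assms by (simp_all add: J_def same_def)
  have cond: "val s' ?c \<noteq> 0 \<longleftrightarrow> s' 27 0 < W \<and> \<not> x div k ^ s' 27 0 mod k + 1 < k" if "J s'" for s'
    using that J0[OF that] by (auto simp: J_def inp_header)
  have "wp (While ?c (12[Var 27] ::= Const 0 ;; 27 :== Var 27 +: Const 1))
      (\<lambda>t s'. t \<le> (W - ?s 27 0 + 1) * (20 + 1 + cost ?c) \<and> J s' \<and> val s' ?c = 0) ?s"
  proof (rule wp_While)
    show "J ?s" using dig by (simp add: J_def)
    show "ok ?s" by (rule 7)
    show "deg ?c \<le> 300" by simp
  next
    fix s' assume J: "J s'" and ok: "ok s'" and c: "val s' ?c \<noteq> 0"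
    define j where "j = s' 27 0"
    have j: "j < W" "k - 1 \<le> x div k ^ j mod k" using c cond[OF J] by (auto simp: j_def)
    then have "x div k ^ j mod k = k - 1" using assms(3) mod_less_divisor[of k "x div k ^ j"] by linarith
    then have dvd: "k ^ Suc j dvd x + 1" using J assms(3) by (intro digits_carry) (auto simp: J_def j_def)
    have "j \<le> L" "Suc j \<le> L" using j(1) inp_le_L(5) by linarith+
    then show "wp (12[Var 27] ::= Const 0 ;; 27 :== Var 27 +: Const 1)
        (\<lambda>t s''. t \<le> 20 \<and> J s'' \<and> W - s'' 27 0 < W - s' 27 0) s'"
      apply (intro wp_Seq)
      apply (rule wp_Assign_val[where k = j and v = 0], (simp add: j_def ok; fail)+)
      apply (rule wp_Assign_val[where k = 0 and v = "Suc j"], (simp add: j_def; fail)+)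
      using J j(1) dvd by (auto simp: J_def j_def all_less_Suc same_def)
  qed
  then show ?case
  proof (intro wp_Seq, elim wp_mono, elim conjE)
    fix t s' assume ok: "ok s'" and J: "J s'" and c: "val s' ?c = 0"
      and t: "t \<le> (W - ?s 27 0 + 1) * (20 + 1 + cost ?c)"
    define j where "j = s' 27 0"
    have j: "j \<le> W" "k ^ j dvd x + 1" using J by (simp_all add: J_def j_def)
    have F: "s' 27 0 = j" "s' 0 = inp" using J0[OF J] by (simp_all add: j_def)
    define v where "v = (s' 12 j + 1) * of_bool (j < W)"
    have last: "(\<forall>i<W. (upd s' 12 j v) 12 i = (x + 1) div k ^ i mod k) \<and> (j < W \<longleftrightarrow> x + 1 < k ^ W) \<and> v \<le> L"
    proof (cases "j < W")
      case True
      then have lt: "x div k ^ j mod k + 1 < k" using c cond[OF J] F by auto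
      note dS = digits_Suc[OF assms(3) j(2) lt]
      have v: "v = x div k ^ j mod k + 1" using True J by (simp add: v_def J_def j_def)
      have "(upd s' 12 j v) 12 i = (x + 1) div k ^ i mod k" if "i < W" for i
      proof (cases i j rule: linorder_cases)
        case less
        then show ?thesis using dS(1) J F by (simp add: J_def)
      next
        case equal
        then show ?thesis using dS(2) v by simp
      next
        case greater
        then show ?thesis using dS(3) J F that by (simp add: J_def)
      qed
      \<comment> \<open>Digit \<open>j\<close> of \<open>x + 1\<close> is positive, whereas
        \<open>k ^ W\<close> has only zeros below position \<open>W\<close>.\<close>
      moreover have "x + 1 \<noteq> k ^ W"
      proof
        assume *: "x + 1 = k ^ W"
        then have "(x + 1) div k ^ j mod k = 0"
          using True assms(3) by (intro digit_of_multiple) (simp_all only: le_imp_power_dvd Suc_le_eq)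
        then show False using dS(2) by simp
      qed
      then have "x + 1 < k ^ W" using assms(6) by linarith
      ultimately show ?thesis using True v lt assms(4) by simp
    next
      case False
      then have jW: "j = W" using j by simp
      have "x + 1 = k ^ W"
        using assms(6) dvd_imp_le[of "k ^ W" "x + 1"] j(2) jW by simp
      moreover have "s' 12 i = (x + 1) div k ^ i mod k" if "i < W" for i
      proof -
        have "k ^ Suc i dvd x + 1" using j(2) jW that by (meson Suc_leI le_imp_power_dvd dvd_trans)
        then show ?thesis using digit_of_multiple assms(3) J F jW that by (simp add: J_def)
      qed
      ultimately show ?thesis using jW by (simp add: v_def)
    qed
    have same: "same {12, 26, 27} s (upd (upd s' 26 0 y) 12 j z)" for y z
      using J by (auto simp: J_def same_def)
    show "wp (26 :== (Var 27 <: TargetE) ;; 12[Var 27] ::= (Read 12 (Var 27) +: Const 1) *: Var 26)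
       (\<lambda>t2. Q (1 + cost (Const 0) + cost (Const 0) + (t + t2))) s'"
      apply (intro wp_Seq)
      apply (rule wp_Assign_val[where k = 0 and v = "of_bool (j < W)"], (simp add: F ok inp_header; fail)+)
      apply (rule wp_Assign_val[where k = j and v = v], (simp add: F v_def; fail)+, use last in blast)
      apply (rule Q, assumption, rule same)
      using last t by simp_all
  qed
qed (use assms(1) in simp_all)

lemma pick_cong: "(\<And>j. j < W \<Longrightarrow> f j = g j) \<Longrightarrow> pick nl f = pick nl g"
  unfolding pick_def by (intro image_cong) auto

text \<open>The check goes through the positions, with one orientation per edge and possible
  repetitions; symmetry of \<open>settled\<close> covers the other orientation.\<close>

lemma good_pick_iff:
  assumes f: "\<And>j. j < W \<Longrightarrow> nl (f j) < m \<and> e (nl (f j)) \<in> N"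
  defines "X \<equiv> (edges I - E') \<union> pick nl f"
  shows "good (pick nl f) \<longleftrightarrow> W \<le> sum (weight I) X \<and>
    (\<forall>j<W. settled (edges I - X) (eu (nl (f j))) (ev (nl (f j))))"
proof -
  have R: "pick nl f \<subseteq> N" using f by (auto simp: pick_def)
  then have "finite (pick nl f)" "(edges I - E') \<inter> pick nl f = {}"
    using finite_N N_subset by (auto intro: finite_subset)
  then have sum: "sum (weight I) X = sum (weight I) (edges I - E') + sum (weight I) (pick nl f)"
    unfolding X_def using finite_E by (intro sum.union_disjoint) auto
  have X: "edges I - X = E' - pick nl f" using E'_subset by (auto simp: X_def)
  have "(\<forall>u v. {u, v} \<in> pick nl f \<longrightarrow> settled (E' - pick nl f) u v) \<longleftrightarrow>
      (\<forall>j<W. settled (E' - pick nl f) (eu (nl (f j))) (ev (nl (f j))))" (is "?A \<longleftrightarrow> ?B")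
  proof
    assume ?A
    then show ?B by (auto simp: pick_def e_def)
  next
    assume B: ?B
    show ?A
    proof (intro allI impI)
      fix u v assume "{u, v} \<in> pick nl f"
      then obtain j where "j < W" "{u, v} = {eu (nl (f j)), ev (nl (f j))}"
        by (auto simp: pick_def e_def)
      then show "settled (E' - pick nl f) u v"
        using B settled_commute by (auto simp: doubleton_eq_iff)
    qed
  qed
  then show ?thesis using R by (auto simp: good_def removable_def sum X)
qed

lemma wp_check:
  assumes "ok s" "tables s" "\<And>j. j < W \<Longrightarrow> s 12 j < s 22 0"
    and Q: "\<And>t s'. ok s' \<Longrightarrow> same {3, 6, 13, 20, 23, 24, 27} s s' \<Longrightarrow>
      flagged ((edges I - E') \<union> pick (s 11) (s 12)) s' \<Longrightarrow> s' 24 0 = of_bool (good (pick (s 11) (s 12))) \<Longrightarrow>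
      t \<le> 700 * (W + 1) * t1 \<Longrightarrow> Q t s'"
  shows "wp (check p1) Q s"
  unfolding check_def
proof (rule wp_Seq, rule wp_set_flags[OF assms(1-3)])
  fix ta sa assume ta: "ok sa" "same {6, 20} s sa" "flagged ((edges I - E') \<union> pick (s 11) (s 12)) sa"
    "ta \<le> 100 * (m + 1) + 100 * (W + 1)"
  define X where "X = (edges I - E') \<union> pick (s 11) (s 12)"
  have nl: "s 11 (s 12 j) < m \<and> e (s 11 (s 12 j)) \<in> N" if "j < W" for j
    using assms(2,3) that by (auto simp: tables_def bij_betw_def)
  have XE: "X \<subseteq> edges I" using e_in nl by (auto simp: X_def pick_def)
  have sa: "sa 0 = inp" "sa 21 0 = big" using ta(2) assms(2) by (simp_all add: same_def tables_def)
  show "wp (weigh ;; build 2 3 ;; For 27 TargetE (query p1)) (\<lambda>t2. Q (ta + t2)) sa"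
  proof (rule wp_Seq, rule wp_weigh[OF ta(1) sa(1) ta(3)[folded X_def] XE])
    fix tb sb assume tb: "ok sb" "same {20, 23, 24} sa sb" "sb 24 0 = of_bool (W \<le> sum (weight I) X)"
      "tb \<le> 100 * (m + 1)"
    have sb: "sb 0 = inp" "sb 21 0 = big" "\<And>i. i < m \<Longrightarrow> sb 6 i = of_bool (e i \<in> X)"
      using tb(2) sa ta(3) by (simp_all add: same_def flagged_def X_def)
    show "wp (build 2 3 ;; For 27 TargetE (query p1)) (\<lambda>t2. Q (ta + (tb + t2))) sb"
    proof (rule wp_Seq, rule wp_build[OF tb(1) sb])
      show "(2 :: nat) \<le> 2" "(3 :: nat) \<notin> {0, 6, 20, 21}" by simp_all
      fix tc sc assume tc: "ok sc" "same {3, 20} sb sc" "map (sc 3) [2..<2 + 2 + 3 * m] = encode_graph (variant X)"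
        "tc \<le> 200 * (m + 1)"
      have samec: "same {3, 6, 13, 20, 23, 24, 27} s sc"
        using ta(2) tb(2) tc(2) by (simp add: same_def)
      have flc: "flagged X sc" using sb(3) tc(2) by (simp add: same_def flagged_def)
      show "wp (For 27 TargetE (query p1)) (\<lambda>t2. Q (ta + (tb + (tc + t2)))) sc"
      proof (rule wp_For[where k = W and T = "t1 + 100" and I = "\<lambda>j s'. same {3, 13, 24, 27} sc s' \<and>
          map (s' 3) [2..<2 + 2 + 3 * m] = encode_graph (variant X) \<and>
          s' 24 0 = of_bool (W \<le> sum (weight I) X \<and>
            (\<forall>i<j. settled (edges I - X) (eu (s 11 (s 12 i))) (ev (s 11 (s 12 i)))))"], goal_cases)
        case 4
        then show ?case using tc(2,3) tb(3) by (simp add: same_def)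
      next
        case (5 j s')
        then have "s' 0 = inp" using samec assms(2) by (simp add: same_def tables_def)
        then show ?case by (simp add: inp_header)
      next
        case (6 j s')
        have tab: "tables s'" using 6 samec assms(2) by (simp add: same_def tables_def)
        have i: "s' 11 (s' 12 (s' 27 0)) = s 11 (s 12 j)" using 6 samec by (simp add: same_def)
        show ?case
        proof (rule wp_query[OF 6(2) tab i _ 6(3)[THEN conjunct2, THEN conjunct1]
              6(3)[THEN conjunct2, THEN conjunct2]], goal_cases)
          case 1
          then show ?case using nl 6 by blast
        next
          case (2 t s'')
          have "same {3, 13, 24, 27} sc (upd s'' 27 0 (Suc j))"
            using 2 6 by (auto simp: same_def)
          moreover have "s'' 27 0 = j" using 2 6 by (simp add: same_def)
          ultimately show ?case using 2 6 by (simp add: all_less_Suc del: upt_Suc)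
        qed
      next
        case (7 td s')
        have "same {3, 6, 13, 20, 23, 24, 27} s s'" using 7 samec by (auto simp: same_def)
        moreover have "flagged X s'" using 7 flc by (simp add: same_def flagged_def)
        moreover have "s' 24 0 = of_bool (good (pick (s 11) (s 12)))"
          using 7 good_pick_iff[of "s 11" "s 12"] nl unfolding X_def by simp
        \<comment> \<open>As \<open>t1\<close> includes reading the graph,
          \<open>m + 1 \<le> t1\<close> absorbs the linear work of setting flags, weighing and
          building.\<close>
        moreover have "ta + (tb + (tc + td)) \<le> 700 * (W + 1) * t1"
        proof -
          have "td \<le> (W + 1) * (t1 + 122)" using 7(3) by (simp add: algebra_simps)
          also have "\<dots> \<le> (W + 1) * (123 * t1)" using m_le_t1 by (intro mult_le_mono2) linarith
          finally have "td \<le> 123 * ((W + 1) * t1)" by (simp add: algebra_simps)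
          moreover have "W + 1 \<le> (W + 1) * t1" using m_le_t1 by (cases t1) simp_all
          moreover have "m + 1 \<le> (W + 1) * t1" using m_le_t1 by simp
          ultimately show ?thesis using ta(4) tb(4) tc(4) by (simp add: algebra_simps)
        qed
        ultimately show ?case using 7(1) by (intro Q) (simp_all add: X_def)
      qed (use tc(1) in simp_all)
    qed
  qed
qed

end

text \<open>The test of array 28 keeps the search from starting when no edge is critical, where the
  time bound leaves no room for it. Raising \<open>k\<close> by 1 per round avoids overshooting the
  unknown limit.\<close>

definition search_all :: "com \<Rightarrow> com" where
  "search_all p = While ((NotE (Var 24) *: (Const 0 <: Var 28)) *: (Var 25 <: Var 22)) (search p)"

definition finish :: com where
  "finish = 1[Const 0] ::= Var 24 ;;
     For 20 EdgesE (1[Var 20 +: Const 1] ::= NotE (Read 6 (Var 20)))"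

definition spanner_com :: "com \<Rightarrow> com \<Rightarrow> com" where
  "spanner_com p q = init ;; apsp q 4 ;; classify ;; apsp q 5 ;; mark_critical ;;
     24 :== NotE (Var 23 <: TargetE) ;; search_all p ;; finish"

context spanner_program
begin

definition found :: "memory \<Rightarrow> bool" where
  "found s \<longleftrightarrow> s 24 0 = 1 \<and> (\<exists>R. good R \<and> flagged ((edges I - E') \<union> R) s)"

definition refuted :: "nat \<Rightarrow> (nat \<Rightarrow> nat) \<Rightarrow> bool" where
  "refuted k nl \<longleftrightarrow> (\<forall>f. (\<forall>j<W. f j < k) \<longrightarrow> \<not> good (pick nl f))"

lemma found_same: "same X s s' \<Longrightarrow> 6 \<notin> X \<Longrightarrow> 24 \<notin> X \<Longrightarrow> found s' \<longleftrightarrow> found s"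
  by (simp add: found_def flagged_def same_def)

lemma tables_same: "same X s s' \<Longrightarrow> X \<inter> {0, 7, 8, 10, 11, 21, 22} = {} \<Longrightarrow> tables s' \<longleftrightarrow> tables s"
  by (auto simp: tables_def same_def)

text \<open>One share for each of the \<open>k ^ W\<close> choices, one for leaving the loop and one
  for resetting the digits.\<close>

abbreviation "TS k \<equiv> (k ^ W + 2) * (1200 * (W + 1) * t1)"

lemma wp_search:
  assumes "ok s" and tab: "tables s" and s24: "s 24 0 = 0" and lt: "s 25 0 < s 22 0"
  defines "k \<equiv> s 25 0 + 1"
  assumes Q: "\<And>t s'. ok s' \<Longrightarrow> same {3, 6, 12, 13, 20, 23, 24, 25, 26, 27} s s' \<Longrightarrow> s' 25 0 = k \<Longrightarrow>
      found s' \<or> s' 24 0 = 0 \<and> refuted k (s 11) \<Longrightarrow> t \<le> TS k \<Longrightarrow> Q t s'"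
  shows "wp (search p1) Q s"
proof -
  let ?F = "{3, 6, 12, 13, 20, 23, 24, 25, 26, 27}"
  define nl where "nl = s 11"
  define dig where "dig x j = x div k ^ j mod k" for x j
  have k: "0 < k" "k \<le> s 22 0" using lt by (simp_all add: k_def)
  then have kL: "k \<le> L" using tab inp_le_L(2) unfolding tables_def by linarith
  have s0: "s 0 = inp" using tab by (simp add: tables_def)
  \<comment> \<open>The alternatives are: searching, all choices rejected, found. While searching,
    \<open>x\<close> is the next choice and \<open>r\<close> the number of unchecked ones; in the
    other two states \<open>r\<close> is arbitrary, so it can drop to 0.\<close>
  define J where "J r s' \<longleftrightarrow> same ?F s s' \<and> s' 25 0 = k \<and>
    ((s' 24 0 = 0 \<and> s' 26 0 = 1 \<and> (\<exists>x<k ^ W. r = k ^ W - x \<and> (\<forall>j<W. s' 12 j = dig x j) \<and>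
        (\<forall>y<x. \<not> good (pick nl (dig y))))) \<or>
     (s' 24 0 = 0 \<and> s' 26 0 = 0 \<and> (\<forall>y<k ^ W. \<not> good (pick nl (dig y)))) \<or> found s')" for r s'
  let ?c = "Var 26 *: NotE (Var 24)"
  have W1: "1 \<le> (W + 1) * t1" "W + 1 \<le> (W + 1) * t1" using m_le_t1 by (cases t1; simp)+
  have step: "wp (check p1 ;; incr) (\<lambda>t s''. t \<le> 800 * (W + 1) * t1 \<and> (\<exists>r'<r. J r' s'')) s'"
    if J: "J r s'" and ok: "ok s'" and c: "val s' ?c \<noteq> 0" for r s'
  proof -
    have same: "same ?F s s'" "s' 25 0 = k" using J by (simp_all add: J_def)
    have "\<not> found s'" "s' 26 0 \<noteq> 0" using c by (auto simp: found_def)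
    then obtain x where x: "x < k ^ W" "r = k ^ W - x" "\<And>j. j < W \<Longrightarrow> s' 12 j = dig x j"
      "\<And>y. y < x \<Longrightarrow> \<not> good (pick nl (dig y))"
      using J by (auto simp: J_def)
    have tab': "tables s'" using tab tables_same[OF same(1)] by simp
    have s': "s' 22 0 = s 22 0" "s' 11 = nl" "s' 0 = inp" using same(1) s0 by (simp_all add: same_def nl_def)
    have "s' 12 j < s' 22 0" if "j < W" for j
    proof -
      have "dig x j < k" using k(1) by (simp add: dig_def)
      then show ?thesis using x(3)[OF that] k(2) s'(1) by linarith
    qed
    then show ?thesis
    proof (intro wp_Seq, intro wp_check[OF ok tab'])
      fix t s1 assume s1: "ok s1" "same {3, 6, 13, 20, 23, 24, 27} s' s1"
        "flagged ((edges I - E') \<union> pick (s' 11) (s' 12)) s1" "s1 24 0 = of_bool (good (pick (s' 11) (s' 12)))"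
        "t \<le> 700 * (W + 1) * t1"
      have pick: "pick (s' 11) (s' 12) = pick nl (dig x)" unfolding s'(2) by (rule pick_cong) (rule x(3))
      have d1: "s1 12 j = x div k ^ j mod k" if "j < W" for j
        using s1(2) x(3)[OF that] by (simp add: same_def dig_def)
      have s1': "s1 0 = inp" "s1 25 0 = k" using s1(2) s'(3) same(2) by (simp_all add: same_def)
      show "wp incr (\<lambda>t2 s''. t + t2 \<le> 800 * (W + 1) * t1 \<and> (\<exists>r'<r. J r' s'')) s1"
      proof (rule wp_incr[OF s1(1) s1'(1) k(1) kL s1'(2) x(1) d1])
        fix t2 s2 assume s2: "ok s2" "same {12, 26, 27} s1 s2" "\<And>j. j < W \<Longrightarrow> s2 12 j = (x + 1) div k ^ j mod k"
          "s2 26 0 = of_bool (x + 1 < k ^ W)" "t2 \<le> 100 * (W + 1)"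
        have "t + t2 \<le> 800 * (W + 1) * t1" using s1(5) s2(5) W1(2) by (simp add: algebra_simps)
        moreover have sm: "same ?F s s2" using same(1) s1(2) s2(2) by (simp add: same_def)
        moreover have s25: "s2 25 0 = k" using s1'(2) s2(2) by (simp add: same_def)
        moreover have "\<exists>r'<r. J r' s2"
        proof (cases "good (pick nl (dig x))")
          case True
          have "found s1" using True s1(3,4) by (auto simp: found_def pick)
          then have "found s2" using found_same[OF s2(2)] by simp
          then have "J 0 s2" using sm s25 by (simp add: J_def)
          moreover have "0 < r" using x(1,2) by simp
          ultimately show ?thesis by blast
        next
          case False
          then have s24: "s2 24 0 = 0" using s1(4) s2(2) by (simp add: same_def pick)
          have less: "\<not> good (pick nl (dig y))" if "y < x + 1" for y
            using that False x(4) by (cases "y = x") auto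
          show ?thesis
          proof (cases "x + 1 < k ^ W")
            case True
            have "J (k ^ W - (x + 1)) s2"
              unfolding J_def using sm s25 s24 True s2(3,4) less
              by (intro conjI disjI1 exI[of _ "x + 1"]) (simp_all add: dig_def)
            moreover have "k ^ W - (x + 1) < r" using x(1,2) by simp
            ultimately show ?thesis by blast
          next
            case False
            then have "x + 1 = k ^ W" using x(1) by simp
            then have "J 0 s2" unfolding J_def using sm s25 s24 s2(4) less by simp
            moreover have "0 < r" using x(1,2) by simp
            ultimately show ?thesis by blast
          qed
        qed
        ultimately show "t + t2 \<le> 800 * (W + 1) * t1 \<and> (\<exists>r'<r. J r' s2)" by blast
      qed
    qed
  qed
  have loop: "wp (While ?c (check p1 ;; incr)) (\<lambda>t3. Q (t0 + t3)) s3"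
    if J: "J (k ^ W) s3" and ok: "ok s3" and t0: "t0 \<le> 100 * (W + 1)" for s3 t0
  proof (rule wp_mono[OF wp_While_index[OF J ok _ step]])
    fix t s' assume ok': "ok s'" and *: "t \<le> (k ^ W + 1) * (800 * (W + 1) * t1 + 1 + cost ?c) \<and>
      (\<exists>r. J r s') \<and> val s' ?c = 0"
    then obtain r where J': "J r s'" by blast
    have c: "val s' ?c = 0" using * by blast
    show "Q (t0 + t) s'"
    proof (rule Q[OF ok'])
      show "same ?F s s'" "s' 25 0 = k" using J' by (simp_all add: J_def)
      have "refuted k nl" if bad: "\<forall>y<k ^ W. \<not> good (pick nl (dig y))"
        unfolding refuted_def
      proof (intro allI impI)
        fix f assume "\<forall>j<W. f j < k"
        then obtain y where y: "y < k ^ W" "\<forall>j<W. y div k ^ j mod k = f j" using exists_digits by blast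
        have "pick nl f = pick nl (dig y)" using y(2) by (intro pick_cong) (simp add: dig_def)
        then show "\<not> good (pick nl f)" using bad y(1) by simp
      qed
      moreover have "found s' \<or> s' 24 0 = 0 \<and> (\<forall>y<k ^ W. \<not> good (pick nl (dig y)))"
        using J' c by (auto simp: J_def)
      ultimately show "found s' \<or> s' 24 0 = 0 \<and> refuted k (s 11)" unfolding nl_def by blast
      have "800 * (W + 1) * t1 + 1 + cost ?c \<le> 1200 * (W + 1) * t1" using W1 by (simp add: algebra_simps)
      then have "(k ^ W + 1) * (800 * (W + 1) * t1 + 1 + cost ?c) \<le> (k ^ W + 1) * (1200 * (W + 1) * t1)"
        by (rule mult_le_mono2)
      then have "t \<le> (k ^ W + 1) * (1200 * (W + 1) * t1)" using * by linarith
      moreover have "t0 \<le> 1200 * (W + 1) * t1" using t0 W1 by (simp add: algebra_simps)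
      ultimately have "t0 + t \<le> 1200 * (W + 1) * t1 + (k ^ W + 1) * (1200 * (W + 1) * t1)" by linarith
      also have "\<dots> = TS k" by (simp add: algebra_simps)
      finally show "t0 + t \<le> TS k" .
    qed
  qed simp_all
  show ?thesis
    unfolding search_def
  proof (rule wp_Seq, rule wp_Assign_val[where k = 0 and v = k], goal_cases)
    case 7
    let ?s = "upd s 25 0 k"
    show ?case
    proof (rule wp_Seq, rule wp_For[where k = W and T = 20 and
        I = "\<lambda>j s'. same {12, 20} ?s s' \<and> (\<forall>i<j. s' 12 i = 0)"], goal_cases)
      case 1
      show ?case using 7 .
    next
      case (5 j s')
      then show ?case using s0 by (simp add: inp_header same_def)
    next
      case (6 j s')
      show ?case
        using 6 by (intro wp_Assign_val[where k = j and v = 0]) (simp_all add: all_less_Suc)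
    next
      case (7 t s')
      have F: "s' 0 = inp" "s' 24 0 = 0" "s' 25 0 = k" using 7 s0 s24 by (simp_all add: same_def)
      have J: "J (k ^ W) (upd s' 26 0 1)"
        unfolding J_def using 7 F k(1)
        by (intro conjI disjI1 exI[of _ 0]) (auto simp: same_def dig_def)
      show ?case
        apply (rule wp_Seq, rule wp_Assign_val[where k = 0 and v = 1], (simp add: 7; fail)+)
      proof -
        assume ok: "ok (upd s' 26 0 1)"
        have "t + 9 \<le> 100 * (W + 1)" using 7(3) by simp
        moreover have "1 + cost (Const 0) + cost (Var 25 +: Const 1) +
            (t + (1 + cost (Const 0) + cost (Const 1) + t')) = t + 9 + t'" for t' by simp
        ultimately show "wp (While ?c (check p1 ;; incr))
          (\<lambda>t2. Q (1 + cost (Const 0) + cost (Var 25 +: Const 1) + (t + (1 + cost (Const 0) + cost (Const 1) + t2))))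
          (upd s' 26 0 1)"
          using loop[OF J ok] by (simp only:)
      qed
    qed (use inp_le_L in simp_all)
  qed (use assms(1) kL in \<open>simp_all add: k_def\<close>)
qed

lemma wp_search_all:
  assumes ok: "ok s" and tab: "tables s" and s25: "s 25 0 = 0"
    and fl: "flagged ((edges I - E') \<union> (N - C)) s"
    and s24: "s 24 0 = of_bool (W \<le> sum (weight I) ((edges I - E') \<union> (N - C)))"
    and s28: "s 28 0 = 0 \<longleftrightarrow> C = {}"
  defines "k1 \<equiv> W * (2 * \<tau> + 1)"
  assumes Q: "\<And>t s'. ok s' \<Longrightarrow> s' 0 = inp \<Longrightarrow> found s' \<or> s' 24 0 = 0 \<and> \<not> has_solution I \<Longrightarrow>
      t \<le> 50 \<or> 0 < W \<and> 0 < \<tau> \<and> t \<le> (k1 + 1) * (TS k1 + 30) \<Longrightarrow> Q t s'"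
  shows "wp (search_all p1) Q s"
proof -
  let ?c = "(NotE (Var 24) *: (Const 0 <: Var 28)) *: (Var 25 <: Var 22)"
  let ?X = "(edges I - E') \<union> (N - C)"
  have s0: "s 0 = inp" using tab by (simp add: tables_def)
  have sum: "sum (weight I) ?X = sum (weight I) (edges I - E') + sum (weight I) (N - C)"
    using finite_E finite_N N_subset by (intro sum.union_disjoint) auto
  consider "W \<le> sum (weight I) ?X" | "sum (weight I) ?X < W" "C = {}" | "sum (weight I) ?X < W" "C \<noteq> {}"
    by linarith
  then show ?thesis
  proof cases
    case 1
    then have "good (N - C)" using noncritical_removable sum by (simp add: good_def)
    then have "found s" using 1 s24 fl by (auto simp: found_def)
    have "exec B (search_all p1) s (1 + cost ?c) s"
      unfolding search_all_def using ok 1 s24 by (intro exec.WhileFalse ok_fits) simp_all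
    moreover have "Q (1 + cost ?c) s" using ok s0 \<open>found s\<close> by (intro Q) simp_all
    ultimately show ?thesis unfolding wp_def using ok by blast
  next
    case 2
    \<comment> \<open>Without critical edges \<open>N - C\<close> is all of \<open>N\<close>, so no
      removable set is heavier.\<close>
    have "\<not> has_solution I"
    proof
      assume "has_solution I"
      then obtain R where R: "good R" using solution_good by blast
      then have "sum (weight I) R \<le> sum (weight I) (N - C)"
        using 2 finite_N by (intro sum_mono2) (auto simp: good_def removable_def)
      then show False using R 2 sum by (simp add: good_def)
    qed
    moreover have "exec B (search_all p1) s (1 + cost ?c) s"
      unfolding search_all_def using ok 2 s28 by (intro exec.WhileFalse ok_fits) simp_all
    ultimately have "Q (1 + cost ?c) s" using ok s0 2 s24 by (intro Q) simp_all
    then show ?thesis unfolding wp_def using ok \<open>exec B (search_all p1) s (1 + cost ?c) s\<close> by blast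
  next
    case 3
    have W: "0 < W" using 3 by simp
    have \<tau>: "0 < \<tau>" using tightness_pos[OF 3(2)] by simp
    let ?F = "{3, 6, 12, 13, 20, 23, 24, 25, 26, 27}"
    define nl where "nl = s 11"
    define c where "c = s 22 0"
    have nl: "bij_betw nl {..<c} {i. i < m \<and> e i \<in> N}" using tab by (simp add: tables_def nl_def c_def)
    have less: "k < k1" if "refuted k nl" "k \<le> c" for k
      using many_nontrivial_pick[OF nl W, of k] that unfolding refuted_def k1_def by (meson not_le)
    \<comment> \<open>\<open>r\<close> counts the values of \<open>k\<close> still ahead before
      \<open>k1\<close>. The limit \<open>k1\<close> exists only in this argument; the program
      compares \<open>k\<close> with \<open>c\<close>.\<close>
    define J where "J r s' \<longleftrightarrow> same ?F s s' \<and> (found s' \<and> r = 0 \<or>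
      s' 24 0 = 0 \<and> refuted (s' 25 0) nl \<and> s' 25 0 \<le> c \<and> r = k1 - s' 25 0)" for r s'
    have "refuted 0 nl" using W by (auto simp: refuted_def)
    then have J0: "J k1 s" using 3 s24 s25 by (simp add: J_def)
    show ?thesis
      unfolding search_all_def
    proof (rule wp_mono[OF wp_While_index[where J = J and r = k1 and T = "TS k1", OF J0 ok]])
      fix r s' assume J: "J r s'" and ok': "ok s'" and v: "val s' ?c \<noteq> 0"
      have same: "same ?F s s'" using J by (simp add: J_def)
      have s': "s' 24 0 = 0" "s' 25 0 < s' 22 0" using v by (auto split: if_splits)
      have s'': "s' 22 0 = c" "s' 11 = nl" using same by (simp_all add: same_def nl_def c_def)
      have ref: "refuted (s' 25 0) nl" "r = k1 - s' 25 0" using J s'(1) by (auto simp: J_def found_def)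
      have lt: "s' 25 0 < k1" using less[OF ref(1)] s' s'' by simp
      have tab': "tables s'" using tab tables_same[OF same] by simp
      show "wp (search p1) (\<lambda>t s''. t \<le> TS k1 \<and> (\<exists>r'<r. J r' s'')) s'"
      proof (rule wp_search[OF ok' tab' s'])
        fix t s2 assume s2: "ok s2" "same ?F s' s2" "s2 25 0 = s' 25 0 + 1"
          "found s2 \<or> s2 24 0 = 0 \<and> refuted (s' 25 0 + 1) (s' 11)" "t \<le> TS (s' 25 0 + 1)"
        have "(s' 25 0 + 1) ^ W \<le> k1 ^ W" using lt by (intro power_mono) simp_all
        then have "TS (s' 25 0 + 1) \<le> TS k1" by (intro mult_le_mono1) simp
        then have "t \<le> TS k1" using s2(5) by linarith
        moreover have sm: "same ?F s s2" using same s2(2) by (simp add: same_def)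
        have "\<exists>r'<r. J r' s2"
        proof (cases "found s2")
          case True
          then have "J 0 s2" using sm by (simp add: J_def)
          moreover have "0 < r" using ref(2) lt by simp
          ultimately show ?thesis by blast
        next
          case False
          then have "s2 24 0 = 0" "refuted (s2 25 0) nl" using s2(3,4) s''(2) by simp_all
          then have "J (k1 - s2 25 0) s2" using sm s2(3) s'(2) s''(1) by (simp add: J_def)
          moreover have "k1 - s2 25 0 < r" using ref(2) lt s2(3) by simp
          ultimately show ?thesis by blast
        qed
        ultimately show "t \<le> TS k1 \<and> (\<exists>r'<r. J r' s2)" by blast
      qed
    next
      fix t s' assume ok': "ok s'" and *: "t \<le> (k1 + 1) * (TS k1 + 1 + cost ?c) \<and> (\<exists>r. J r s') \<and> val s' ?c = 0"
      then obtain r where J: "J r s'" by blast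
      have same: "same ?F s s'" using J by (simp add: J_def)
      \<comment> \<open>Critical edges exist, so the loop can end without success only at
        \<open>k = c\<close>, when all nontrivial edges have been considered.\<close>
      have "s' 28 0 \<noteq> 0" "s' 22 0 = c" using same s28 3(2) by (simp_all add: same_def c_def)
      then have fin: "found s' \<or> s' 24 0 = 0 \<and> refuted c nl"
        using J * by (auto simp: J_def split: if_splits)
      have "sum (weight I) (edges I - E') < W" using 3(1) sum by linarith
      then have "\<not> has_solution I" if "refuted c nl"
        using solution_pick[OF nl] that unfolding refuted_def by blast
      then have res: "found s' \<or> s' 24 0 = 0 \<and> \<not> has_solution I" using fin by blast
      have "(k1 + 1) * (TS k1 + 1 + cost ?c) \<le> (k1 + 1) * (TS k1 + 30)" by (intro mult_le_mono2) simp
      then have "t \<le> (k1 + 1) * (TS k1 + 30)" using * by linarith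
      then show "Q t s'" using ok' res same s0 W \<tau> by (intro Q) (simp_all add: same_def)
    qed simp
  qed
qed

lemma wp_finish:
  assumes "ok s" "s 0 = inp" and res: "found s \<or> s 24 0 = 0 \<and> \<not> has_solution I"
    and Q: "\<And>t s'. decides_answer has_solution I (s' 1) \<Longrightarrow> witness_answer I (s' 1) \<Longrightarrow> t \<le> 100 * (m + 1) \<Longrightarrow> Q t s'"
  shows "wp finish Q s"
  unfolding finish_def
proof (rule wp_Seq, rule wp_Assign_val[where k = 0 and v = "s 24 0"], goal_cases)
  case 7
  show ?case
  proof (rule wp_For[where k = m and T = 20 and I = "\<lambda>j s'. same {1, 20} s s' \<and> s' 1 0 = s 24 0 \<and>
      (\<forall>i<j. s' 1 (Suc i) = 1 - s 6 i)"], goal_cases)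
    case 1
    show ?case using 7 .
  next
    case (5 j s')
    then show ?case using assms(2) by (simp add: inp_header same_def)
  next
    case (6 j s')
    have F: "s' 6 = s 6" using 6 by (simp add: same_def)
    show ?case
      apply (rule wp_Assign_val[where k = "Suc j" and v = "1 - s 6 j"], (simp add: 6 F; fail)+)
       apply (rule order_trans[of _ 1]; simp)
      using 6 by (simp add: all_less_Suc)
  next
    case (7 t s')
    have out: "s' 1 0 = s 24 0" "\<And>i. i < m \<Longrightarrow> s' 1 (Suc i) = 1 - s 6 i" using 7 by simp_all
    show ?case
    proof (rule Q)
      show "decides_answer has_solution I (s' 1)" "witness_answer I (s' 1)"
      proof -
        show "witness_answer I (s' 1)"
        proof (cases "found s")
          case True
          then obtain R where R: "good R" "flagged ((edges I - E') \<union> R) s" "s 24 0 = 1"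
            by (auto simp: found_def)
          have "R \<subseteq> E'" using R(1) N_subset by (auto simp: good_def removable_def)
          have "{to_edge (edge_list I ! i) |i. i < m \<and> s' 1 (Suc i) \<noteq> 0} =
              {e i |i. i < m \<and> e i \<notin> (edges I - E') \<union> R}"
            using out(2) R(2) by (auto simp: flagged_def e_eq of_bool_def split: if_splits)
          also have "\<dots> = E' - R"
          proof -
            have "E' \<subseteq> e ` {..<m}" using E'_subset edges_eq by simp
            then show ?thesis using e_in by auto
          qed
          finally have *: "is_solution I {to_edge (edge_list I ! i) |i. i < m \<and> s' 1 (Suc i) \<noteq> 0}"
            using good_is_solution[OF R(1)] by simp
          then have "has_solution I" by (auto simp: has_solution_def)
          then show ?thesis using * out(1) R(3) by (simp add: witness_answer_def)
        next
          case False
          then show ?thesis using res out(1) by (simp add: witness_answer_def)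
        qed
        then show "decides_answer has_solution I (s' 1)"
          by (auto simp: witness_answer_def decides_answer_def split: if_splits)
      qed
      show "1 + cost (Const 0) + cost (Var 24) + t \<le> 100 * (m + 1)" using 7 by simp
    qed
  qed simp_all
qed (use assms(1) in \<open>simp_all add: okD\<close>)

lemma wp_program:
  assumes "s = load (encode_spanner I)"
  defines "k1 \<equiv> W * (2 * \<tau> + 1)"
  shows "wp (spanner_com p1 p2) (\<lambda>t s'. decides_answer has_solution I (s' 1) \<and> witness_answer I (s' 1) \<and>
    (t \<le> 10000 * t2 \<or> 0 < W \<and> 0 < \<tau> \<and> t \<le> 10000 * t2 + (k1 + 1) * (TS k1 + 30))) s"
proof -
  let ?Post = "\<lambda>t s'. decides_answer has_solution I (s' 1) \<and> witness_answer I (s' 1) \<and>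
    (t \<le> 10000 * t2 \<or> 0 < W \<and> 0 < \<tau> \<and> t \<le> 10000 * t2 + (k1 + 1) * (TS k1 + 30))"
  let ?Y = "(edges I - E') \<union> N" and ?X = "(edges I - E') \<union> (N - C)"
  have "encode_spanner I ! i \<le> L" if "i < length (encode_spanner I)" for i
    using magnitude_gt[OF nth_mem[OF that]] by (intro le_L) (simp add: M_def)
  then have ok: "ok s" by (simp add: assms(1) ok_def load_def)
  have s: "s 0 = inp" "\<And>a i. a \<noteq> 0 \<Longrightarrow> s a i = 0" by (simp_all add: assms(1) load_def)
  show ?thesis
    unfolding spanner_com_def
  proof (rule wp_Seq, rule wp_init[OF ok s(1)])
    show "s 29 0 = 0" by (simp add: s(2))
    fix ta sa assume a: "ok sa" "same {20, 21, 29} s sa" "sa 21 0 = big" "ta \<le> 100 * (m + 1)"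
    have sa: "sa 0 = inp" using a(2) s(1) by (simp add: same_def)
    have "sa 6 i = of_bool (e i \<in> {})" if "i < m" for i using a(2) s(2) by (simp add: same_def)
    then show "wp (apsp p2 4 ;; classify ;; apsp p2 5 ;; mark_critical ;; 24 :== NotE (Var 23 <: TargetE) ;;
        search_all p1 ;; finish) (\<lambda>t'. ?Post (ta + t')) sa"
    proof (intro wp_Seq, intro wp_apsp[OF a(1) sa a(3)])
      fix tb sb assume b: "ok sb" "same {2, 20, 4} sa sb" "apsp2_answer (variant {}) (sb 4)" "tb \<le> 300 * t2"
      have sb: "sb 0 = inp" "sb 21 0 = big" "sb 22 0 = 0" using a(2,3) b(2) s by (simp_all add: same_def)
      show "wp (classify ;; apsp p2 5 ;; mark_critical ;; 24 :== NotE (Var 23 <: TargetE) ;;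
          search_all p1 ;; finish) (\<lambda>t'. ?Post (ta + (tb + t'))) sb"
      proof (rule wp_Seq, rule wp_classify[OF b(1) sb b(3)])
        fix tc sc assume c: "ok sc" "same {6, 7, 8, 10, 11, 20, 22} sb sc" "tables sc" "flagged ?Y sc"
          "tc \<le> 1000 * (m + 1)"
        have sc: "sc 0 = inp" "sc 21 0 = big" "\<And>i. i < m \<Longrightarrow> sc 6 i = of_bool (e i \<in> ?Y)"
          using c(3,4) by (simp_all add: tables_def flagged_def)
        show "wp (apsp p2 5 ;; mark_critical ;; 24 :== NotE (Var 23 <: TargetE) ;;
          search_all p1 ;; finish) (\<lambda>t'. ?Post (ta + (tb + (tc + t')))) sc"
        proof (rule wp_Seq, rule wp_apsp[OF c(1) sc])
          fix td sd assume d: "ok sd" "same {2, 20, 5} sc sd" "apsp2_answer (variant ?Y) (sd 5)" "td \<le> 300 * t2"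
          have sd: "tables sd" "flagged ?Y sd" "sd 23 0 = 0" "sd 28 0 = 0"
            using c(3,4) d(2) tables_same[OF d(2)] s(2) a(2) b(2) c(2)
            by (simp_all add: same_def flagged_def)
          show "wp (mark_critical ;; 24 :== NotE (Var 23 <: TargetE) ;;
            search_all p1 ;; finish) (\<lambda>t'. ?Post (ta + (tb + (tc + (td + t'))))) sd"
          proof (rule wp_Seq, rule wp_mark_critical[OF d(1) sd d(3)])
            fix te se assume e: "ok se" "same {6, 9, 20, 23, 28} sd se" "tables se" "flagged ?X se"
              "se 23 0 = sum (weight I) ?X" "se 28 0 = 0 \<longleftrightarrow> C = {}" "te \<le> 1000 * (m + 1)"
            let ?v = "of_bool (W \<le> sum (weight I) ?X)"
            have se0: "se 0 = inp" using e(3) by (simp add: tables_def)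
            show "wp (24 :== NotE (Var 23 <: TargetE) ;; search_all p1 ;; finish)
              (\<lambda>t'. ?Post (ta + (tb + (tc + (td + (te + t')))))) se"
            proof (rule wp_Seq, rule wp_Assign_val[where k = 0 and v = ?v])
              show "val se (NotE (Var 23 <: TargetE)) = ?v"
                by (simp add: se0 e(5) inp_header not_less)
              let ?s = "upd se 24 0 ?v"
              assume ok_s: "ok ?s"
              have "?s 25 0 = 0" using a(2) b(2) c(2) d(2) e(2) s(2) by (simp add: same_def)
              moreover have "tables ?s" "flagged ?X ?s" "?s 24 0 = ?v" "?s 28 0 = 0 \<longleftrightarrow> C = {}"
                using e(3,4,6) by (simp_all add: tables_def flagged_def)
              ultimately show "wp (search_all p1 ;; finish) (\<lambda>t'. ?Post (ta + (tb + (tc + (td + (te +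
                 (1 + cost (Const 0) + cost (NotE (Var 23 <: TargetE)) + t'))))))) ?s"
              proof (intro wp_Seq, intro wp_search_all[OF ok_s])
                fix tf sf assume f: "ok sf" "sf 0 = inp" "found sf \<or> sf 24 0 = 0 \<and> \<not> has_solution I"
                  "tf \<le> 50 \<or> 0 < W \<and> 0 < \<tau> \<and> tf \<le> (W * (2 * \<tau> + 1) + 1) * (TS (W * (2 * \<tau> + 1)) + 30)"
                show "wp finish (\<lambda>t'. ?Post (ta + (tb + (tc + (td + (te +
                  (1 + cost (Const 0) + cost (NotE (Var 23 <: TargetE)) + (tf + t')))))))) sf"
                proof (rule wp_finish[OF f(1-3)])
                  fix tg sg assume g: "decides_answer has_solution I (sg 1)" "witness_answer I (sg 1)"
                    "tg \<le> 100 * (m + 1)"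
                  have "ta + (tb + (tc + (td + (te + (1 + cost (Const 0) + cost (NotE (Var 23 <: TargetE)) + (tf + tg))))))
                      \<le> 5000 * t2 + tf"
                    using a(4) b(4) c(5) d(4) e(7) g(3) m_le_t2 by simp
                  moreover have "50 \<le> 5000 * t2" using m_le_t2 by simp
                  ultimately show "?Post (ta + (tb + (tc + (td + (te +
                    (1 + cost (Const 0) + cost (NotE (Var 23 <: TargetE)) + (tf + tg))))))) sg"
                    using g(1,2) f(4) unfolding k1_def by linarith
                qed
              qed
            qed (use e(1) in simp_all)
          qed
        qed
      qed
    qed
  qed
qed

end

section \<open>Running time\<close>

lemma solves_mono:
  assumes "solves p X enc b ok" and "\<And>x. x \<in> X \<Longrightarrow> b x \<le> b' x"
    and "\<And>x out. x \<in> X \<Longrightarrow> ok x out \<Longrightarrow> ok' x out"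
  shows "solves p X enc b' ok'"
proof -
  obtain K c where *: "\<forall>x\<in>X. \<exists>t s. exec (magnitude (enc x) ^ c) p (load (enc x)) t s \<and>
      length (enc x) + t \<le> K * b x \<and> ok x (s 1)"
    using assms(1) by (auto simp: solves_def)
  have "\<exists>t s. exec (magnitude (enc x) ^ c) p (load (enc x)) t s \<and>
      length (enc x) + t \<le> K * b' x \<and> ok' x (s 1)" if x: "x \<in> X" for x
  proof -
    obtain t s where "exec (magnitude (enc x) ^ c) p (load (enc x)) t s"
      "length (enc x) + t \<le> K * b x" "ok x (s 1)" using * x by blast
    moreover have "K * b x \<le> K * b' x" using assms(2)[OF x] by simp
    ultimately show ?thesis using assms(3)[OF x] order_trans by blast
  qed
  then show ?thesis unfolding solves_def by blast
qed

text \<open>With \<open>w = Suc v\<close>, the factor \<open>3 ^ (w + 1) = 9 * 3 ^ v\<close> is at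
  most \<open>27 * w ^ v\<close>, clearly so for \<open>w \<ge> 3\<close>, and
  \<open>w ^ v * w ^ (w + 2) = w ^ (2 * w + 1)\<close>. The other exponent comes from
  \<open>t ^ (w + 1) \<le> t ^ (2 * w)\<close>.\<close>

lemma search_space_bound:
  fixes w t :: nat
  assumes "0 < w" "0 < t"
  shows "(3 * w * t) ^ (w + 1) * w \<le> 27 * (w ^ (2 * w + 1) * t ^ (2 * w))"
proof -
  obtain v where w: "w = Suc v" using assms(1) by (cases w) auto
  have "(3 :: nat) ^ v \<le> 3 * w ^ v"
  proof (cases "v \<le> 1")
    case True
    then have "v = 0 \<or> v = 1" by auto
    then show ?thesis by (auto simp: w)
  next
    case False
    then have "(3 :: nat) ^ v \<le> w ^ v" by (intro power_mono) (auto simp: w)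
    then show ?thesis by simp
  qed
  then have "9 * 3 ^ v * w ^ (w + 2) \<le> 9 * (3 * w ^ v) * w ^ (w + 2)" by (intro mult_le_mono) simp_all
  also have "\<dots> = 27 * (w ^ v * w ^ (w + 2))" by simp
  also have "w ^ v * w ^ (w + 2) = w ^ (2 * w + 1)"
  proof -
    have "v + (w + 2) = 2 * w + 1" by (simp add: w)
    then show ?thesis by (simp only: power_add[symmetric])
  qed
  finally have 1: "9 * 3 ^ v * w ^ (w + 2) \<le> 27 * w ^ (2 * w + 1)" .
  have 2: "t ^ (w + 1) \<le> t ^ (2 * w)" using assms by (intro power_increasing) auto
  have "(3 * w * t) ^ (w + 1) * w = 3 ^ (w + 1) * w ^ (w + 1) * t ^ (w + 1) * w"
    by (simp only: power_mult_distrib)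
  also have "\<dots> = (9 * 3 ^ v * w ^ (w + 2)) * t ^ (w + 1)"
  proof -
    have "(3 :: nat) ^ (w + 1) = 9 * 3 ^ v" "w ^ (w + 2) = w ^ (w + 1) * w" by (simp_all add: w)
    then show ?thesis by (simp only: mult_ac)
  qed
  also have "\<dots> \<le> (27 * w ^ (2 * w + 1)) * t ^ (2 * w)" using 1 2 by (rule mult_le_mono)
  finally show ?thesis by (simp add: mult.assoc)
qed

text \<open>Positivity of \<open>t\<close> gives \<open>k \<le> 3 * w * t\<close>. In 777600 = 2 *
  14400 * 27, the 2 bounds \<open>k + 1\<close> by twice \<open>3 * w * t\<close>, 14400 belongs to
  one round, and 27 comes from \<open>search_space_bound\<close>.\<close>

lemma search_time_bound:
  fixes w t r :: nat
  assumes "0 < w" "0 < t" "0 < r"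
  defines "k \<equiv> w * (2 * t + 1)"
  shows "(k + 1) * ((k ^ w + 2) * (1200 * (w + 1) * r) + 30) \<le> 777600 * (w ^ (2 * w + 1) * t ^ (2 * w) * r)"
proof -
  define x where "x = 3 * w * t"
  have k: "k \<le> x" "1 \<le> x" using assms by (simp_all add: k_def x_def algebra_simps)
  have "k ^ w \<le> x ^ w" "1 \<le> x ^ w" using k by (simp_all add: power_mono)
  then have "k ^ w + 2 \<le> 3 * x ^ w" by linarith
  moreover have "1200 * (w + 1) * r \<le> 2400 * (w * r)" using assms(1) by (simp add: algebra_simps Suc_le_eq)
  ultimately have "(k ^ w + 2) * (1200 * (w + 1) * r) \<le> 3 * x ^ w * (2400 * (w * r))" by (rule mult_le_mono)
  moreover have "1 \<le> x ^ w * (w * r)" using k assms by simp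
  ultimately have "(k ^ w + 2) * (1200 * (w + 1) * r) + 30 \<le> 14400 * (x ^ w * (w * r))" by linarith
  moreover have "k + 1 \<le> 2 * x" using k by linarith
  ultimately have "(k + 1) * ((k ^ w + 2) * (1200 * (w + 1) * r) + 30) \<le> 2 * x * (14400 * (x ^ w * (w * r)))"
    by (intro mult_le_mono)
  also have "\<dots> = 28800 * (x ^ (w + 1) * w) * r" by simp
  also have "\<dots> \<le> 28800 * (27 * (w ^ (2 * w + 1) * t ^ (2 * w))) * r"
    unfolding x_def by (rule mult_le_mono1, rule mult_le_mono2, rule search_space_bound[OF assms(1,2)])
  finally show ?thesis by simp
qed

text \<open>This is the parameter function of the FPT bound: the exponent covers
  \<open>(2 * W + 1) + 2 * W\<close>. The word bound in \<open>computable2\<close> is free for each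
  input, so repeated multiplication will do.\<close>

lemma computable2_power: "computable2 (\<lambda>x y. (x + y + 2) ^ (4 * x + 2))"
proof -
  let ?N = "Const 4 *: Var 0 +: Const 2"
  let ?p = "1[Const 0] ::= Const 1 ;; For 2 ?N (1[Const 0] ::= Var 1 *: (Var 0 +: Read 0 (Const 1) +: Const 2))"
  have "\<exists>B t s. exec B ?p (load [x, y]) t s \<and> s 1 0 = (x + y + 2) ^ (4 * x + 2)" for x y
  proof -
    define b where "b = x + y + 2"
    \<comment> \<open>It bounds all intermediate powers and, because of \<open>b \<ge> 2\<close>,
      also the loop limit \<open>4 * x + 2\<close>.\<close>
    define L where "L = b ^ (4 * x + 3)"
    define B where "B = L ^ 301"
    have b: "2 \<le> b" by (simp add: b_def)
    have "4 * x + 3 < 2 ^ (4 * x + 3)" by (rule less_exp)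
    also have "\<dots> \<le> L" unfolding L_def using b by (intro power_mono) auto
    finally have L: "4 * x + 3 < L" .
    have bL: "b ^ j \<le> L" if "j \<le> 4 * x + 3" for j
      unfolding L_def using b that by (intro power_increasing) auto
    interpret ram L B
    proof
      show "2 \<le> L" using L by simp
      then show "L ^ 300 < B" unfolding B_def by (intro power_strict_increasing) auto
    qed
    have s: "load [x, y] 0 0 = x" "load [x, y] 0 (Suc 0) = y" by (simp_all add: load_def)
    have "load [x, y] a i \<le> b" for a i
      by (auto simp: load_def b_def less_Suc_eq nth_Cons split: nat.splits)
    then have ok: "ok (load [x, y])" using bL[of 1] by (auto simp: ok_def intro: order_trans)
    have "wp ?p (\<lambda>t s. s 1 0 = (x + y + 2) ^ (4 * x + 2)) (load [x, y])"
    proof (rule wp_Seq, rule wp_Assign_val[where k = 0 and v = 1], goal_cases)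
      case 7
      show ?case
      proof (rule wp_For[where k = "4 * x + 2" and T = 20 and
          I = "\<lambda>j s. s 0 = load [x, y] 0 \<and> s 1 0 = b ^ j"], goal_cases)
        case 1
        show ?case using 7 .
      next
        case (6 j s')
        then have "b ^ Suc j \<le> L" by (intro bL) simp
        moreover have "b ^ j * b = b ^ Suc j" by simp
        ultimately show ?case
          using 6 s by (intro wp_Assign_val[where k = 0 and v = "b ^ Suc j"]) (simp_all add: b_def)
      qed (use L s in \<open>simp_all add: b_def\<close>)
    qed (use ok L in simp_all)
    then show ?thesis unfolding wp_def by blast
  qed
  then show ?thesis unfolding computable2_def by blast
qed

lemma length_le_bit_length: "length xs \<le> bit_length xs"
  unfolding bit_length_def by (induction xs) simp_all

lemma solves_spanner:
  assumes "solves_SPSP p SPSP" and "solves_APSP2 q APSP2"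
  shows "solves (spanner_com p q) spanner_instances encode_spanner (spanner_time SPSP APSP2)
    (\<lambda>I out. decides_answer has_solution I out \<and> witness_answer I out)"
proof -
  obtain K1 c1 where p: "\<And>x. x \<in> spsp_instances \<Longrightarrow>
      \<exists>t s. exec (magnitude (encode_spsp x) ^ c1) p (load (encode_spsp x)) t s \<and>
        length (encode_spsp x) + t \<le> K1 * (case x of (I, u, v) \<Rightarrow> SPSP (nodes I) (num_edges I)) \<and>
        spsp_answer x (s 1)"
    using assms(1) unfolding solves_SPSP_def solves_def by blast
  obtain K2 c2 where q: "\<And>I. valid_graph I \<Longrightarrow>
      \<exists>t s. exec (magnitude (encode_graph I) ^ c2) q (load (encode_graph I)) t s \<and>
        length (encode_graph I) + t \<le> K2 * APSP2 (nodes I) (num_edges I) \<and> apsp2_answer I (s 1)"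
    using assms(2) unfolding solves_APSP2_def solves_def by blast
  \<comment> \<open>Inputs of the subroutines have magnitude at most \<open>M ^ 4\<close>, so their
    word bounds are at most \<open>(M ^ 4) ^ c1\<close> and \<open>(M ^ 4) ^ c2\<close>; the summand
    1 ensures \<open>M ^ 4 \<le> L\<close>.\<close>
  define D where "D = 4 * (c1 + c2 + 1)"
  define K where "K = 777600 * K1 + 20000 * K2"
  have main: "\<exists>t s. exec (magnitude (encode_spanner I) ^ (D * 301)) (spanner_com p q) (load (encode_spanner I)) t s \<and>
      length (encode_spanner I) + t \<le> K * spanner_time SPSP APSP2 I \<and>
      (decides_answer has_solution I (s 1) \<and> witness_answer I (s 1))" if I: "I \<in> spanner_instances" for I
  proof -
    interpret spanner_input I by unfold_locales (rule I)
    define L where "L = M ^ D"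
    define a where "a = K1 * SPSP n m"
    define b where "b = K2 * APSP2 n m"
    have M: "2 \<le> M" using M_ge(1) by simp
    have powM: "(M ^ 4) ^ c \<le> L" if "4 * c \<le> D" for c
      unfolding L_def power_mult[symmetric] using that M by (intro power_increasing) auto
    interpret spanner_program I L "L ^ 301" p q a b
    proof
      show "M ^ 4 \<le> L" using powM[of 1] by (simp add: D_def)
      then show "2 \<le> L" using M self_le_power[of M 4] by linarith
      then show "L ^ 300 < L ^ 301" by (intro power_strict_increasing) auto
    next
      fix u v X assume uv: "u \<in> verts I" "v \<in> verts I"
      have "(variant X, u, v) \<in> spsp_instances" using uv valid_variant by (simp add: spsp_instances_def)
      have len: "length (encode_spsp (variant X, u, v)) = 4 + 3 * m"
        by (simp add: encode_spsp_def length_encode_variant)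
      from p[OF \<open>(variant X, u, v) \<in> spsp_instances\<close>] obtain t s where *: "exec (magnitude (encode_spsp (variant X, u, v)) ^ c1) p (load (encode_spsp (variant X, u, v))) t s"
        "length (encode_spsp (variant X, u, v)) + t \<le> a" "spsp_answer (variant X, u, v) (s 1)"
        by (auto simp: a_def)
      have "magnitude (encode_spsp (variant X, u, v)) ^ c1 \<le> (M ^ 4) ^ c1"
        using uv by (intro power_mono magnitude_spsp) (simp_all add: verts_def)
      also have "\<dots> \<le> L" by (rule powM) (simp add: D_def)
      finally have "exec L p (load (encode_spsp (variant X, u, v))) t s" using exec_mono *(1) by blast
      then show "\<exists>t s. exec L p (load (encode_spsp (variant X, u, v))) t s \<and> 4 + 3 * m + t \<le> a \<and>
          spsp_answer (variant X, u, v) (s 1)"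
        using *(2,3) len by auto
    next
      fix X
      from q[OF valid_variant[of X]] obtain t s where *: "exec (magnitude (encode_graph (variant X)) ^ c2) q (load (encode_graph (variant X))) t s"
        "length (encode_graph (variant X)) + t \<le> b" "apsp2_answer (variant X) (s 1)"
        unfolding variant_simps b_def by blast
      have "magnitude (encode_graph (variant X)) ^ c2 \<le> (M ^ 4) ^ c2"
        using magnitude_variant[of X] by (intro power_mono) simp_all
      also have "\<dots> \<le> L" by (rule powM) (simp add: D_def)
      finally have "exec L q (load (encode_graph (variant X))) t s" using exec_mono *(1) by blast
      then show "\<exists>t s. exec L q (load (encode_graph (variant X))) t s \<and> 2 + 3 * m + t \<le> b \<and>
          apsp2_answer (variant X) (s 1)"
        using *(2,3) by (auto simp: length_encode_variant)
    qed
    let ?k = "W * (2 * \<tau> + 1)"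
    obtain t s where run: "exec (L ^ 301) (spanner_com p q) (load (encode_spanner I)) t s"
      "decides_answer has_solution I (s 1)" "witness_answer I (s 1)"
      "t \<le> 10000 * b \<or> 0 < W \<and> 0 < \<tau> \<and> t \<le> 10000 * b + (?k + 1) * ((?k ^ W + 2) * (1200 * (W + 1) * a) + 30)"
      using wp_program[OF refl] unfolding wp_def by blast
    have \<tau>: "inst_tightness I = \<tau>" by (simp add: inst_tightness_def stretch_eq)
    have time: "spanner_time SPSP APSP2 I = W ^ (2 * W + 1) * \<tau> ^ (2 * W) * SPSP n m + APSP2 n m"
      by (simp add: spanner_time_def \<tau>)
    have "0 < a" using m_le_t1 by simp
    have "t \<le> 10000 * b + 777600 * (W ^ (2 * W + 1) * \<tau> ^ (2 * W) * a)"
      using run(4) search_time_bound[of W \<tau> a] \<open>0 < a\<close> by linarith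
    moreover have "length (encode_spanner I) \<le> 10000 * b"
      using m_le_t2 by (simp add: length_encode)
    ultimately have "length (encode_spanner I) + t \<le>
        20000 * K2 * APSP2 n m + 777600 * K1 * (W ^ (2 * W + 1) * \<tau> ^ (2 * W) * SPSP n m)"
      by (simp add: a_def b_def algebra_simps)
    also have "\<dots> \<le> K * APSP2 n m + K * (W ^ (2 * W + 1) * \<tau> ^ (2 * W) * SPSP n m)"
      by (intro add_mono mult_le_mono1) (simp_all add: K_def)
    also have "\<dots> = K * spanner_time SPSP APSP2 I" by (simp add: time algebra_simps)
    finally have "length (encode_spanner I) + t \<le> K * spanner_time SPSP APSP2 I" .
    moreover have "L ^ 301 = magnitude (encode_spanner I) ^ (D * 301)"
      unfolding L_def M_def by (rule power_mult[symmetric])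
    ultimately show ?thesis using run(1-3) by metis
  qed
  then show ?thesis unfolding solves_def by blast
qed

lemma spanner_time_fpt:
  assumes "polynomially_bounded SPSP" and "polynomially_bounded APSP2"
  shows "\<exists>r :: nat poly. \<forall>I\<in>spanner_instances. spanner_time SPSP APSP2 I \<le>
    (removed_weight I + inst_tightness I + 2) ^ (4 * removed_weight I + 2) * poly r (bit_length (encode_spanner I))"
proof -
  obtain K1 k1 where 1: "\<And>n m. SPSP n m \<le> K1 * (n + m + 1) ^ k1"
    using assms(1) by (auto simp: polynomially_bounded_def)
  obtain K2 k2 where 2: "\<And>n m. APSP2 n m \<le> K2 * (n + m + 1) ^ k2"
    using assms(2) by (auto simp: polynomially_bounded_def)
  define r where "r = monom K1 k1 + monom K2 k2"
  have "spanner_time SPSP APSP2 I \<le>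
    (removed_weight I + inst_tightness I + 2) ^ (4 * removed_weight I + 2) * poly r (bit_length (encode_spanner I))"
    if I: "I \<in> spanner_instances" for I
  proof -
    interpret spanner_input I by unfold_locales (rule I)
    define b where "b = bit_length (encode_spanner I)"
    define x where "x = W + inst_tightness I + 2"
    let ?f = "x ^ (4 * W + 2)"
    have "n + m + 1 \<le> length (encode_spanner I)" using n_le by (simp add: length_encode)
    also have "\<dots> \<le> b" unfolding b_def by (rule length_le_bit_length)
    finally have "(n + m + 1) ^ k \<le> b ^ k" for k by (intro power_mono) simp_all
    then have S: "SPSP n m \<le> K1 * b ^ k1" and A: "APSP2 n m \<le> K2 * b ^ k2"
      using 1[of n m] 2[of n m] by (meson mult_le_mono2 order_trans)+
    have "W ^ (2 * W + 1) * inst_tightness I ^ (2 * W) \<le> x ^ (2 * W + 1) * x ^ (2 * W)"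
      by (intro mult_le_mono power_mono) (simp_all add: x_def)
    also have "\<dots> = x ^ (4 * W + 1)" by (simp add: power_add[symmetric])
    also have "\<dots> \<le> ?f" by (intro power_increasing) (simp_all add: x_def)
    finally have "W ^ (2 * W + 1) * inst_tightness I ^ (2 * W) * SPSP n m \<le> ?f * (K1 * b ^ k1)"
      using S by (rule mult_le_mono)
    moreover have "1 \<le> ?f" by (rule one_le_power) (simp add: x_def)
    then have "1 * APSP2 n m \<le> ?f * (K2 * b ^ k2)" using A by (rule mult_le_mono)
    ultimately have "spanner_time SPSP APSP2 I \<le> ?f * (K1 * b ^ k1) + ?f * (K2 * b ^ k2)"
      by (simp add: spanner_time_def)
    then show ?thesis by (simp add: r_def poly_monom distrib_left x_def b_def)
  qed
  then show ?thesis by blast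
qed

theorem theorem3:
  fixes SPSP APSP2 :: "nat \<Rightarrow> nat \<Rightarrow> nat"
  assumes "\<exists>p. solves_SPSP p SPSP" and "polynomially_bounded SPSP"
    and "\<exists>p. solves_APSP2 p APSP2" and "polynomially_bounded APSP2"
  shows "(\<exists>p. solves p spanner_instances encode_spanner
                (spanner_time SPSP APSP2) (decides_answer has_solution) \<and>
              fpt_algorithm p spanner_instances encode_spanner
                removed_weight inst_tightness has_solution) \<and>
         (\<exists>p. solves p spanner_instances encode_spanner
                (\<lambda>I. spanner_time SPSP APSP2 I + nodes I ^ 2 * num_edges I ^ 2) witness_answer)"
proof -
  obtain p q where "solves_SPSP p SPSP" "solves_APSP2 q APSP2" using assms(1,3) by blast
  note sol = solves_spanner[OF this]
  obtain r :: "nat poly" where "\<forall>I\<in>spanner_instances. spanner_time SPSP APSP2 I \<le>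
    (removed_weight I + inst_tightness I + 2) ^ (4 * removed_weight I + 2) * poly r (bit_length (encode_spanner I))"
    using spanner_time_fpt[OF assms(2,4)] by blast
  then have "solves (spanner_com p q) spanner_instances encode_spanner
      (\<lambda>I. (removed_weight I + inst_tightness I + 2) ^ (4 * removed_weight I + 2) *
        poly r (bit_length (encode_spanner I))) (decides_answer has_solution)"
    by (intro solves_mono[OF sol]) simp_all
  then have "fpt_algorithm (spanner_com p q) spanner_instances encode_spanner
      removed_weight inst_tightness has_solution"
    unfolding fpt_algorithm_def using computable2_power by blast
  moreover have "solves (spanner_com p q) spanner_instances encode_spanner
      (spanner_time SPSP APSP2) (decides_answer has_solution)"
    by (rule solves_mono[OF sol]) simp_all
  \<comment> \<open>The same program yields the witness: after a successful search the flags in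
    array 6 describe the removed edges, and their complement is written in linear time.\<close>
  moreover have "solves (spanner_com p q) spanner_instances encode_spanner
      (\<lambda>I. spanner_time SPSP APSP2 I + nodes I ^ 2 * num_edges I ^ 2) witness_answer"
    by (rule solves_mono[OF sol]) simp_all
  ultimately show ?thesis by blast
qed

end
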